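(* Let $d\ge2$ and let $(\mu_e)_{e\in E_d}$ be random conductances satisfying the standing assumptions (1)–(3) in the context. Let $X$ be the variable speed random walk (VSRW) with heat kernel $q^\omega_t(x,y)$. Let $T>0$. For $x\in\mathbb{R}^d$ write $\lfloor x\rfloor=(\lfloor x_1\rfloor,\dots,\lfloor x_d\rfloor)$. Then $$\lim_{n\to\infty}\sup_{x\in\mathbb{R}^d}\sup_{t\ge T}\left|n^{d/2}q^\omega_{nt}(0,\lfloor n^{1/2}x\rfloor)-k_t(x)\right|=0,\qquad\mathbb{P}\text{-a.s.},$$ where $k_t(x)=(2\pi t\sigma_V^2)^{-d/2}e^{-|x|^2/(2\sigma_V^2t)}$.
   Context: $E_d$ is the set of nonoriented nearest-neighbour edges of $\mathbb{Z}^d$; $(\mu_e)_{e\in E_d}$ are random variables on $(\Omega,\mathbb{P})$, with $\mu_{xy}=\mu_{yx}=\mu_{\{x,y\}}$ if $x\sim y$, $\mu_{xy}=0$ otherwise, $\mu_x=\sum_y\mu_{xy}$. For fixed $\omega$ the VSRW $X$ is the continuous time Markov chain on $\mathbb{Z}^d$ which waits at $x$ for an exponential time with mean $1/\mu_x$ and then jumps to $y$ with probability $\mu_{xy}/\mu_x$; $P^x_\omega$ is its law started at $x$, and $q^\omega_t(x,y)=P^x_\omega(X_t=y)$. $|\cdot|$ is the Euclidean norm. Standing assumptions: (1) $(\mu_e)$ is stationary and ergodic (under the translations of $\mathbb{Z}^d$), and its law is invariant under symmetries of $\mathbb{Z}^d$. (2) $\mu_e\in[1,\infty)$ for all $e\in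 E_d$, $\mathbb{P}$-a.s. (3) The following heat kernel bounds hold for the VSRW. For each $\eta\in(0,1)$ there exist random variables $U_x$, $x\in\mathbb{Z}^d$, and constants $c_i\in(0,\infty)$ such that $\mathbb{P}(U_x\ge n)\le c_1\exp(-c_2n^\eta)$ and, $\mathbb{P}$-a.s.: (a) $q^\omega_t(x,y)\le c_3t^{-d/2}$ for all $x,y,t$; (b) if $|x-y|\vee t^{1/2}\ge U_x$, then $q^\omega_t(x,y)\le c_3t^{-d/2}e^{-c_4|x-y|^2/t}$ when $t\ge|x-y|$, and $q^\omega_t(x,y)\le c_3\exp(-c_4|x-y|(1\vee\log(|x-y|/t)))$ when $t\le|x-y|$; (c) $q^\omega_t(x,y)\ge c_5t^{-d/2}e^{-c_6|x-y|^2/t}$ if $t\ge U_x^2\vee|x-y|^{1+\eta}$; and (d) $c_8t^{-d/2}e^{-c_9|x-y|^2/t}\le\mathbb{E}q^\omega_t(x,y)\le c_{10}t^{-d/2}e^{-c_{11}|x-y|^2/t}$ if $t\ge c_7\vee|x-y|^{1+\eta}$. The constant $\sigma_V>0$ is the nonrandom constant such that, for $\mathbb{P}$-a.e. $\omega$, the processes $(\varepsilon X_{t/\varepsilon^2})_{t\ge0}$ converge in law under $P^0_\omega$, as $\varepsilon\to0$, to a Brownian motion on $\mathbb{R}^d$ with covariance matrix $\sigma_V^2I$ (its existence is the quenched invariance principle for the VSRW, proved in the paper under these assumptions). *)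

theory Defs
  imports "HOL-Probability.Probability"
begin

section \<open>The lattice and its edges\<close>

definition emb :: "int ^ 'd \<Rightarrow> real ^ 'd" where
  "emb x = (\<chi> i. real_of_int (x $ i))"

definition ldist :: "int ^ 'd::finite \<Rightarrow> int ^ 'd \<Rightarrow> real" where
  "ldist x y = norm (emb x - emb y)"

definition nbr :: "int ^ 'd::finite \<Rightarrow> int ^ 'd \<Rightarrow> bool" where
  "nbr x y \<longleftrightarrow> ldist x y = 1"

definition edges :: "(int ^ 'd::finite) set set" where
  "edges = {{x, y} |x y. nbr x y}"

definition vfloor :: "real ^ 'd \<Rightarrow> int ^ 'd" where
  "vfloor x = (\<chi> i. \<lfloor>x $ i\<rfloor>)"

text \<open>A configuration of conductances is a function on edges; only its values on \<^const>\<open>edges\<close>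
  are ever used.\<close>

type_synonym 'd conf = "(int ^ 'd) set \<Rightarrow> real"

definition cond :: "'d::finite conf \<Rightarrow> int ^ 'd \<Rightarrow> int ^ 'd \<Rightarrow> real" where
  "cond c x y = (if nbr x y then c {x, y} else 0)"

definition rate :: "'d::finite conf \<Rightarrow> int ^ 'd \<Rightarrow> real" where
  "rate c x = (\<Sum>y\<in>{y. nbr x y}. cond c x y)"


section \<open>The variable speed random walk\<close>

text \<open>The trajectory of the walk is encoded by the sequence of pairs (site visited, time spent
  there). \<open>visit c z\<close> is the law of such a pair at site \<open>z\<close>; the law of the whole sequence is
  given by the Ionescu-Tulcea theorem.\<close>

abbreviation pair_space :: "((int ^ 'd) \<times> real) measure" where
  "pair_space \<equiv> count_space UNIV \<Otimes>\<^sub>M borel"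

definition visit :: "'d::finite conf \<Rightarrow> int ^ 'd \<Rightarrow> ((int ^ 'd) \<times> real) measure" where
  "visit c z = distr (density lborel (\<lambda>s. ennreal (exponential_density (rate c z) s)))
     pair_space (\<lambda>s. (z, s))"

definition jump :: "'d::finite conf \<Rightarrow> int ^ 'd \<Rightarrow> (int ^ 'd) measure" where
  "jump c x = density (count_space UNIV) (\<lambda>y. ennreal (cond c x y / rate c x))"

definition vsrw_step ::
  "'d::finite conf \<Rightarrow> int ^ 'd \<Rightarrow> nat \<Rightarrow> (nat \<Rightarrow> (int ^ 'd) \<times> real) \<Rightarrow> ((int ^ 'd) \<times> real) measure" where
  "vsrw_step c x n h =
     (if n = 0 then visit c x else jump c (fst (h (n - 1))) \<bind> visit c)"

definition vsrw_law :: "'d::finite conf \<Rightarrow> int ^ 'd \<Rightarrow> (nat \<Rightarrow> (int ^ 'd) \<times> real) measure" where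
  "vsrw_law c x =
     projective_family.lim UNIV (Ionescu_Tulcea.CI (vsrw_step c x) (\<lambda>_. pair_space))
       (\<lambda>_. pair_space)"

text \<open>Position at time \<open>t\<close>; the value \<^const>\<open>None\<close> is a cemetery, reached only after an explosion.\<close>

definition arrival :: "(nat \<Rightarrow> (int ^ 'd) \<times> real) \<Rightarrow> nat \<Rightarrow> real" where
  "arrival p n = (\<Sum>i<n. snd (p i))"

definition vsrw_at :: "real \<Rightarrow> (nat \<Rightarrow> (int ^ 'd) \<times> real) \<Rightarrow> (int ^ 'd) option" where
  "vsrw_at t p =
     (if \<exists>n. arrival p n \<le> t \<and> t < arrival p (Suc n)
      then Some (fst (p (LEAST n. arrival p n \<le> t \<and> t < arrival p (Suc n)))) else None)"

definition hk :: "'d::finite conf \<Rightarrow> real \<Rightarrow> int ^ 'd \<Rightarrow> int ^ 'd \<Rightarrow> real" where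
  "hk c t x y = measure (vsrw_law c x) {p \<in> space (vsrw_law c x). vsrw_at t p = Some y}"

text \<open>An exploding trajectory makes infinitely many jumps of size \<open>\<epsilon>\<close> in finite time, so it has no
  left limit at the explosion time, whatever \<open>the None\<close> is: it is not cadlag.\<close>

definition scaled_vsrw :: "real \<Rightarrow> real \<Rightarrow> (nat \<Rightarrow> (int ^ 'd) \<times> real) \<Rightarrow> real ^ 'd" where
  "scaled_vsrw \<epsilon> t p = \<epsilon> *\<^sub>R emb (the (vsrw_at (t / \<epsilon>\<^sup>2) p))"


section \<open>The random environment\<close>

abbreviation conf_space :: "('d::finite conf) measure" where
  "conf_space \<equiv> PiM edges (\<lambda>_. borel)"

definition env_law :: "'w measure \<Rightarrow> ((int ^ 'd::finite) set \<Rightarrow> 'w \<Rightarrow> real) \<Rightarrow> 'd conf measure" where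
  "env_law M \<mu> = distr M conf_space (\<lambda>\<omega>. \<lambda>e\<in>edges. \<mu> e \<omega>)"

definition relabel :: "(int ^ 'd::finite \<Rightarrow> int ^ 'd) \<Rightarrow> 'd conf \<Rightarrow> 'd conf" where
  "relabel T c = (\<lambda>e\<in>edges. c (T ` e))"

definition stationary_env :: "'w measure \<Rightarrow> ((int ^ 'd::finite) set \<Rightarrow> 'w \<Rightarrow> real) \<Rightarrow> bool" where
  "stationary_env M \<mu> \<longleftrightarrow>
     (\<forall>z. distr (env_law M \<mu>) conf_space (relabel (\<lambda>x. x + z)) = env_law M \<mu>)"

definition ergodic_env :: "'w measure \<Rightarrow> ((int ^ 'd::finite) set \<Rightarrow> 'w \<Rightarrow> real) \<Rightarrow> bool" where
  "ergodic_env M \<mu> \<longleftrightarrow>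
     (\<forall>A \<in> sets conf_space.
        (\<forall>z. relabel (\<lambda>x. x + z) -` A \<inter> space conf_space = A) \<longrightarrow>
        measure (env_law M \<mu>) A \<in> {0, 1})"

definition lattice_symmetry :: "(int ^ 'd::finite \<Rightarrow> int ^ 'd) \<Rightarrow> bool" where
  "lattice_symmetry T \<longleftrightarrow> bij T \<and> (\<forall>x y. ldist (T x) (T y) = ldist x y)"

definition symmetric_env :: "'w measure \<Rightarrow> ((int ^ 'd::finite) set \<Rightarrow> 'w \<Rightarrow> real) \<Rightarrow> bool" where
  "symmetric_env M \<mu> \<longleftrightarrow>
     (\<forall>T. lattice_symmetry T \<longrightarrow> distr (env_law M \<mu>) conf_space (relabel T) = env_law M \<mu>)"

text \<open>The averaged kernel \<open>Eq\<close> is integrated over the completion of \<open>M\<close>, because \<open>hk\<close> is only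
  meaningful, and hence only known to be measurable, off a null set of environments.\<close>

definition heat_kernel_bounds ::
  "'w measure \<Rightarrow> ((int ^ 'd::finite) set \<Rightarrow> 'w \<Rightarrow> real) \<Rightarrow> bool" where
  "heat_kernel_bounds M \<mu> \<longleftrightarrow>
    (\<forall>\<eta>::real. 0 < \<eta> \<and> \<eta> < 1 \<longrightarrow>
     (\<exists>(U :: int ^ 'd \<Rightarrow> 'w \<Rightarrow> real) (c :: nat \<Rightarrow> real).
        (\<forall>i. 0 < c i) \<and>
        (\<forall>x. U x \<in> borel_measurable M \<and> (\<forall>\<omega>\<in>space M. 0 \<le> U x \<omega>)) \<and>
        (\<forall>x (n::nat). measure M {\<omega> \<in> space M. real n \<le> U x \<omega>} \<le> c 1 * exp (- c 2 * real n powr \<eta>)) \<and>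
        (AE \<omega> in M. \<forall>x y. \<forall>t>0.
           let q = hk (\<lambda>e. \<mu> e \<omega>) t x y; r = ldist x y; D = t powr (- real CARD('d) / 2) in
             q \<le> c 3 * D \<and>
             (U x \<omega> \<le> max r (sqrt t) \<longrightarrow>
                (r \<le> t \<longrightarrow> q \<le> c 3 * D * exp (- c 4 * r\<^sup>2 / t)) \<and>
                (t \<le> r \<longrightarrow> q \<le> c 3 * exp (- c 4 * r * max 1 (ln (r / t))))) \<and>
             (max ((U x \<omega>)\<^sup>2) (r powr (1 + \<eta>)) \<le> t \<longrightarrow>
                c 5 * D * exp (- c 6 * r\<^sup>2 / t) \<le> q)) \<and>
        (\<forall>x y t.
           let Eq = (\<integral>\<omega>. hk (\<lambda>e. \<mu> e \<omega>) t x y \<partial>completion M);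
               r = ldist x y; D = t powr (- real CARD('d) / 2) in
             max (c 7) (r powr (1 + \<eta>)) \<le> t \<longrightarrow>
                c 8 * D * exp (- c 9 * r\<^sup>2 / t) \<le> Eq \<and>
                Eq \<le> c 10 * D * exp (- c 11 * r\<^sup>2 / t))))"


section \<open>Convergence in law in the Skorokhod space\<close>

text \<open>Paths are indexed by \<^typ>\<open>real\<close>, but only times \<open>t \<ge> 0\<close> are looked at: paths that agree on
  \<open>{0..}\<close> have the same open neighbourhoods.\<close>

definition cadlag :: "(real \<Rightarrow> 'v::metric_space) set" where
  "cadlag = {f. \<forall>t\<ge>0. (f \<longlongrightarrow> f t) (at_right t) \<and> (0 < t \<longrightarrow> (\<exists>l. (f \<longlongrightarrow> l) (at_left t)))}"

definition time_change :: "(real \<Rightarrow> real) \<Rightarrow> bool" where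
  "time_change \<theta> \<longleftrightarrow> bij_betw \<theta> {0..} {0..} \<and> strict_mono_on {0..} \<theta>"

definition skorokhod_nhd ::
  "(real \<Rightarrow> 'v::metric_space) \<Rightarrow> real \<Rightarrow> real \<Rightarrow> (real \<Rightarrow> 'v) set" where
  "skorokhod_nhd f N \<delta> =
     {g \<in> cadlag. \<exists>\<theta>. time_change \<theta> \<and> (\<forall>s\<ge>0. \<bar>\<theta> s - s\<bar> < \<delta>) \<and>
                    (\<forall>s\<in>{0..N}. dist (g (\<theta> s)) (f s) < \<delta>)}"

text \<open>This is the J1 topology on the space of cadlag paths on \<open>{0..}\<close>: a sequence \<open>f\<^sub>n\<close> converges to
  \<open>f\<close> iff there are time changes \<open>\<theta>\<^sub>n\<close> with \<open>\<theta>\<^sub>n - id \<rightarrow> 0\<close> uniformly and \<open>f\<^sub>n \<circ> \<theta>\<^sub>n \<rightarrow> f\<close>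
  uniformly on every \<open>{0..N}\<close>.\<close>

definition skorokhod :: "(real \<Rightarrow> 'v::metric_space) topology" where
  "skorokhod = topology (\<lambda>S. S \<subseteq> cadlag \<and> (\<forall>f\<in>S. \<exists>N. \<exists>\<delta>>0. skorokhod_nhd f N \<delta> \<subseteq> S))"

lemma skorokhod_nhd_mono:
  fixes f :: "real \<Rightarrow> 'a::metric_space"
  assumes le: "N \<le> N'" "\<delta>' \<le> \<delta>"
  shows "skorokhod_nhd f N' \<delta>' \<subseteq> skorokhod_nhd f N \<delta>"
proof
  fix g assume "g \<in> skorokhod_nhd f N' \<delta>'"
  then obtain \<theta> where g: "g \<in> cadlag" "time_change \<theta>"
    and d: "\<And>s. 0 \<le> s \<Longrightarrow> \<bar>\<theta> s - s\<bar> < \<delta>'" "\<And>s. s \<in> {0..N'} \<Longrightarrow> dist (g (\<theta> s)) (f s) < \<delta>'"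
    unfolding skorokhod_nhd_def by blast
  have "\<bar>\<theta> s - s\<bar> < \<delta>" if "0 \<le> s" for s
    using d(1)[OF that] le(2) by linarith
  moreover have "dist (g (\<theta> s)) (f s) < \<delta>" if "s \<in> {0..N}" for s
    using d(2)[of s] that le by simp
  ultimately show "g \<in> skorokhod_nhd f N \<delta>"
    using g unfolding skorokhod_nhd_def by blast
qed

lemma openin_skorokhod:
  "openin skorokhod S \<longleftrightarrow> S \<subseteq> cadlag \<and> (\<forall>f\<in>S. \<exists>N. \<exists>\<delta>>0. skorokhod_nhd f N \<delta> \<subseteq> S)"
proof -
  have "istopology (\<lambda>S::(real \<Rightarrow> 'a) set.
      S \<subseteq> cadlag \<and> (\<forall>f\<in>S. \<exists>N. \<exists>\<delta>>0. skorokhod_nhd f N \<delta> \<subseteq> S))"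
    unfolding istopology_def
  proof (intro conjI allI impI ballI)
    fix S T :: "(real \<Rightarrow> 'a) set" and f
    assume S: "S \<subseteq> cadlag \<and> (\<forall>f\<in>S. \<exists>N. \<exists>\<delta>>0. skorokhod_nhd f N \<delta> \<subseteq> S)"
      and T: "T \<subseteq> cadlag \<and> (\<forall>f\<in>T. \<exists>N. \<exists>\<delta>>0. skorokhod_nhd f N \<delta> \<subseteq> T)"
    show "S \<inter> T \<subseteq> cadlag" using S by blast
    assume "f \<in> S \<inter> T"
    then obtain N \<delta> N' \<delta>' where *: "\<delta> > 0" "\<delta>' > 0"
      "skorokhod_nhd f N \<delta> \<subseteq> S" "skorokhod_nhd f N' \<delta>' \<subseteq> T"
      using S T by blast
    have "skorokhod_nhd f (max N N') (min \<delta> \<delta>') \<subseteq> S \<inter> T"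
      using skorokhod_nhd_mono[of N "max N N'" "min \<delta> \<delta>'" \<delta> f]
        skorokhod_nhd_mono[of N' "max N N'" "min \<delta> \<delta>'" \<delta>' f] * by auto
    with * show "\<exists>N. \<exists>\<delta>>0. skorokhod_nhd f N \<delta> \<subseteq> S \<inter> T"
      by (intro exI[of _ "max N N'"] exI[of _ "min \<delta> \<delta>'"]) auto
  next
    fix K :: "(real \<Rightarrow> 'a) set set" and f
    assume K: "\<forall>S\<in>K. S \<subseteq> cadlag \<and> (\<forall>f\<in>S. \<exists>N. \<exists>\<delta>>0. skorokhod_nhd f N \<delta> \<subseteq> S)"
    show "\<Union>K \<subseteq> cadlag" using K by blast
    assume "f \<in> \<Union>K"
    then obtain S where "S \<in> K" "f \<in> S" by blast
    with K obtain N \<delta> where "\<delta> > 0" "skorokhod_nhd f N \<delta> \<subseteq> S" by blast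
    with \<open>S \<in> K\<close> show "\<exists>N. \<exists>\<delta>>0. skorokhod_nhd f N \<delta> \<subseteq> \<Union>K" by blast
  qed
  then show ?thesis by (simp add: skorokhod_def topology_inverse')
qed

lemma topspace_skorokhod: "topspace skorokhod = cadlag"
proof -
  have "openin skorokhod (cadlag :: (real \<Rightarrow> 'a) set)"
    unfolding openin_skorokhod skorokhod_nhd_def using zero_less_one by blast
  moreover have "topspace (skorokhod :: (real \<Rightarrow> 'a) topology) \<subseteq> cadlag"
    using openin_topspace[of skorokhod] unfolding openin_skorokhod by (rule conjunct1)
  ultimately show ?thesis
    by (intro antisym openin_subset)
qed

text \<open>Convergence in law, as \<open>\<epsilon> \<down> 0\<close>, of processes \<open>X \<epsilon>\<close> on the probability space \<open>P\<close> to a process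
  \<open>B\<close> on the probability space \<open>W\<close>. Completions are used because sample paths are only required
  to be cadlag almost surely.\<close>

definition converges_in_law ::
  "'p measure \<Rightarrow> (real \<Rightarrow> real \<Rightarrow> 'p \<Rightarrow> 'v::metric_space) \<Rightarrow> 'b measure \<Rightarrow> (real \<Rightarrow> 'b \<Rightarrow> 'v) \<Rightarrow> bool"
  where
  "converges_in_law P X W B \<longleftrightarrow>
     (\<forall>\<epsilon>>0. AE p in P. (\<lambda>t. X \<epsilon> t p) \<in> cadlag) \<and>
     (AE w in W. (\<lambda>t. B t w) \<in> cadlag) \<and>
     (\<forall>F :: (real \<Rightarrow> 'v) \<Rightarrow> real.
        continuous_map skorokhod euclideanreal F \<and> bounded (F ` cadlag) \<longrightarrow>
        ((\<lambda>\<epsilon>. \<integral>p. F (\<lambda>t. X \<epsilon> t p) \<partial>completion P) \<longlongrightarrow> (\<integral>w. F (\<lambda>t. B t w) \<partial>completion W))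
          (at_right 0))"

text \<open>Brownian motion started at 0 with covariance matrix \<open>\<sigma>\<^sup>2 I\<close>.\<close>

definition brownian_motion :: "real \<Rightarrow> 'b measure \<Rightarrow> (real \<Rightarrow> 'b \<Rightarrow> real ^ 'd::finite) \<Rightarrow> bool" where
  "brownian_motion \<sigma> W B \<longleftrightarrow>
     prob_space W \<and>
     (\<forall>t\<ge>0. B t \<in> borel_measurable W) \<and>
     (AE w in W. B 0 w = 0) \<and>
     (AE w in W. continuous_on {0..} (\<lambda>t. B t w)) \<and>
     (\<forall>(s::nat \<Rightarrow> real) n. 0 \<le> s 0 \<and> (\<forall>i<n. s i < s (Suc i)) \<longrightarrow>
        prob_space.indep_vars W (\<lambda>_. borel) (\<lambda>i w. B (s (Suc i)) w - B (s i) w) {..<n}) \<and>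
     (\<forall>s t. 0 \<le> s \<and> s < t \<longrightarrow>
        distributed W lborel (\<lambda>w. B t w - B s w)
          (\<lambda>x. ennreal (\<Prod>i\<in>UNIV. normal_density 0 (\<sigma> * sqrt (t - s)) (x $ i))))"

definition gauss_kernel :: "real \<Rightarrow> real \<Rightarrow> real ^ 'd::finite \<Rightarrow> real" where
  "gauss_kernel \<sigma> t x =
     (2 * pi * t * \<sigma>\<^sup>2) powr (- real CARD('d) / 2) * exp (- (norm x)\<^sup>2 / (2 * \<sigma>\<^sup>2 * t))"


section \<open>Well-definedness of the law of the walk\<close>

lemma finite_nbr: "finite {y. nbr x (y :: int ^ 'd::finite)}"
proof -
  have "{y. nbr x y} \<subseteq> vec_lambda ` (PiE UNIV (\<lambda>i. {x $ i - 1 .. x $ i + 1}))"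
  proof
    fix y assume "y \<in> {y. nbr x y}"
    then have n: "norm (emb x - emb y) = 1" by (simp add: nbr_def ldist_def)
    have "y $ i \<in> {x $ i - 1 .. x $ i + 1}" for i
    proof -
      have "\<bar>(emb x - emb y) $ i\<bar> \<le> 1" using component_le_norm_cart[of "emb x - emb y" i] n by simp
      then have "\<bar>real_of_int (x $ i - y $ i)\<bar> \<le> 1" by (simp add: emb_def)
      then show ?thesis by auto
    qed
    then have "vec_nth y \<in> PiE UNIV (\<lambda>i. {x $ i - 1 .. x $ i + 1})" by auto
    then show "y \<in> vec_lambda ` (PiE UNIV (\<lambda>i. {x $ i - 1 .. x $ i + 1}))"
      by (rule image_eqI[where x = "vec_nth y", rotated]) simp
  qed
  moreover have "finite (PiE (UNIV :: 'd set) (\<lambda>i. {x $ i - 1 .. x $ i + 1}))"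
    by (rule finite_PiE) simp_all
  ultimately show ?thesis by (rule finite_subset[OF _ finite_imageI])
qed

lemma ex_nbr: "\<exists>y. nbr x (y :: int ^ 'd::finite)"
proof -
  fix i :: 'd
  have "emb x - emb (x + axis i 1) = - axis i 1"
    by (simp add: emb_def vec_eq_iff axis_def)
  then have "nbr x (x + axis i 1)" by (simp add: nbr_def ldist_def)
  then show ?thesis ..
qed

lemma rate_pos:
  fixes c :: "'d::finite conf"
  assumes "\<And>e. e \<in> edges \<Longrightarrow> 0 < c e"
  shows "0 < rate c x"
  unfolding rate_def
proof (rule sum_pos[OF finite_nbr])
  show "{y. nbr x y} \<noteq> {}" using ex_nbr[of x] by blast
  fix y assume "y \<in> {y. nbr x y}"
  then have "nbr x y" "{x, y} \<in> edges" unfolding edges_def by blast+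
  then show "0 < cond c x y" using assms[of "{x, y}"] by (simp add: cond_def)
qed

lemma prob_space_visit:
  assumes "0 < rate c z" shows "prob_space (visit c z)"
proof -
  have m: "Pair z \<in> measurable (density lborel (\<lambda>s. ennreal (exponential_density (rate c z) s))) pair_space"
    by measurable
  show ?thesis
    unfolding visit_def
    by (rule prob_space.prob_space_distr[OF prob_space_exponential_density[OF assms] m])
qed

lemma prob_space_jump:
  fixes c :: "'d::finite conf"
  assumes "\<And>e. e \<in> edges \<Longrightarrow> 0 < c e"
  shows "prob_space (jump c x)"
proof
  have r: "0 < rate c x" by (rule rate_pos[OF assms])
  have c0: "0 \<le> cond c x y" for y 
  proof (cases "nbr x y")
    case True
    then have "{x, y} \<in> edges" unfolding edges_def by blast
    then show ?thesis using assms[of "{x, y}"] by (simp add: cond_def)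
  qed (simp add: cond_def)
  have "emeasure (jump c x) (space (jump c x)) =
      (\<integral>\<^sup>+y. ennreal (cond c x y / rate c x) \<partial>count_space UNIV)"
    unfolding jump_def by (subst emeasure_density) auto
  also have "\<dots> = (\<Sum>y\<in>{y. nbr x y}. ennreal (cond c x y / rate c x))"
    using finite_nbr[of x]
    by (intro nn_integral_count_space'[of "{y. nbr x y}"]) (auto simp: cond_def)
  also have "\<dots> = ennreal (\<Sum>y\<in>{y. nbr x y}. cond c x y / rate c x)"
    using r c0 by (intro sum_ennreal) auto
  also have "\<dots> = 1" using r by (simp add: sum_divide_distrib[symmetric] rate_def[symmetric])
  finally show "emeasure (jump c x) (space (jump c x)) = 1" .
qed

lemma Ionescu_Tulcea_vsrw:
  fixes c :: "'d::finite conf"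
  assumes pos: "\<And>e. e \<in> edges \<Longrightarrow> 0 < c e"
  shows "Ionescu_Tulcea (vsrw_step c x) (\<lambda>_. pair_space)"
proof (rule Ionescu_Tulcea.intro)
  have v: "prob_space (visit c z)" for z by (intro prob_space_visit rate_pos pos)
  have vs: "visit c z \<in> space (subprob_algebra pair_space)" for z
    using v[of z] by (auto simp: space_subprob_algebra visit_def intro: prob_space_imp_subprob_space)
  then have vm: "visit c \<in> measurable (count_space UNIV) (subprob_algebra pair_space)" by simp
  have j: "prob_space (jump c z)" for z by (intro prob_space_jump pos)
  have js: "sets (jump c z) = UNIV" "space (jump c z) = UNIV" for z by (auto simp: jump_def)
  have jv: "visit c \<in> measurable (jump c z) (subprob_algebra pair_space)" for z
    using vm by (simp add: measurable_def js)
  have b: "prob_space (jump c z \<bind> visit c)" for z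
    by (rule prob_space.prob_space_bind[OF j _ jv]) (simp add: v)
  have bs: "jump c z \<bind> visit c \<in> space (subprob_algebra pair_space)" for z
    using b[of z] sets_bind[of "jump c z" "visit c" pair_space] vs
    by (auto simp: space_subprob_algebra js intro: prob_space_imp_subprob_space)
  show "vsrw_step c x i \<in> measurable (PiM {0..<i} (\<lambda>_. pair_space)) (subprob_algebra pair_space)" for i
  proof (cases "i = 0")
    case True
    then have "vsrw_step c x i = (\<lambda>_. visit c x)" by (simp add: vsrw_step_def fun_eq_iff)
    then show ?thesis using vs by (simp only: measurable_const)
  next
    case False
    have m: "(\<lambda>h. h (i - 1)) \<in> measurable (PiM {0..<i} (\<lambda>_. pair_space :: ((int ^ 'd) \<times> real) measure)) pair_space"
      using False by (intro measurable_component_singleton) auto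
    have f: "(\<lambda>h. fst (h (i - 1))) \<in>
        measurable (PiM {0..<i} (\<lambda>_. pair_space :: ((int ^ 'd) \<times> real) measure)) (count_space UNIV)"
      by (rule measurable_compose[OF m measurable_fst])
    have g: "(\<lambda>z. jump c z \<bind> visit c) \<in> measurable (count_space UNIV) (subprob_algebra pair_space)"
      using bs by simp
    have "vsrw_step c x i = (\<lambda>h. jump c (fst (h (i - 1))) \<bind> visit c)"
      using False by (simp add: vsrw_step_def fun_eq_iff)
    then show ?thesis using measurable_compose[OF f g] by (simp only:)
  qed
  show "prob_space (vsrw_step c x i h)" for i h
    using v b by (simp add: vsrw_step_def)
qed

lemma vsrw_law_marginals:
  fixes c :: "'d::finite conf"
  assumes "\<And>e. e \<in> edges \<Longrightarrow> 0 < c e" "finite J"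
  shows "distr (vsrw_law c x) (PiM J (\<lambda>_. pair_space)) (\<lambda>p. restrict p J) =
    Ionescu_Tulcea.CI (vsrw_step c x) (\<lambda>_. pair_space) J"
  unfolding vsrw_law_def
  by (rule Ionescu_Tulcea.distr_lim[OF Ionescu_Tulcea_vsrw assms(2)]) (rule assms(1))

end

theory Submission
  imports Defs
begin

text \<open>The scaled kernel \<open>n\<^bsup>d/2\<^esup> q\<^sub>n\<^sub>t\<close> splits by Chapman--Kolmogorov and symmetry into the overlap of the kernel
  from \<open>0\<close> at time \<open>n(t - s)\<close> with the kernel from \<open>y\<close> at time \<open>ns\<close>. Conductances bounded below give a
  discrete energy bound on the latter, so that in \<open>\<ell>\<^sup>2\<close> it hardly changes under shifts by \<open>\<delta>\<surd>n\<close>. Averaging over such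
  shifts turns the first kernel into a smoothed law of the rescaled walk, which the invariance principle
  identifies with a Gaussian integral, locally uniformly in space. Since the kernel from \<open>y\<close> at time \<open>ns\<close> has mass one and is
  concentrated near \<open>y\<close> for small \<open>s\<close>, this gives the limit at a fixed point. No Harnack inequality is
  needed. The heat kernel upper bounds reduce the supremum to a compact set of \<open>(t, x)\<close>, on which sequences
  of worst points converge along subsequences. The random scales \<open>U\<^sub>x\<close> are harmless by Borel--Cantelli:
  they grow sublinearly in \<open>x\<close>.\<close>

section \<open>The heat kernel as a sum over the number of jumps\<close>

text \<open>The jump rates have no upper bound, so the generator is unbounded and differentiating
  the return probability is awkward. The energy is therefore taken at a finite time step h: the sum
  of q_h(x,y) (f(x) - f(y))^2 is computed exactly from symmetry, Chapman--Kolmogorov and mass one,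
  and h tends to 0 only at the end, by Fatou. In the overlap a shift by \<delta> sqrt n then costs
  n^(-d/4) * \<delta> sqrt n * n^(-d/4) / sqrt n = \<delta> n^(-d/2), up to a factor that depends on
  s: exactly the size of the kernel itself. Hence s is chosen first, then \<delta>, and n last.

  Mass one is not among the heat kernel bounds. It is extracted from the invariance principle:
  convergence in law presupposes cadlag paths, and an exploding walk has no left limit at its
  explosion time. This settles the start at 0, and the lower heat kernel bound carries it to all
  other sites.\<close>

text \<open>Decomposition at the first jump: the rate of the holding time cancels against the normalisation of
  the jump probabilities.\<close>

fun jump_kernel :: "'d::finite conf \<Rightarrow> nat \<Rightarrow> real \<Rightarrow> int ^ 'd \<Rightarrow> int ^ 'd \<Rightarrow> ennreal" where
  "jump_kernel c 0 t x y = (if x = y then ennreal (exp (- (rate c x * t))) else 0)"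
| "jump_kernel c (Suc n) t x y =
     (\<integral>\<^sup>+s. indicator {0..t} s * ennreal (exp (- (rate c x * s))) *
        (\<Sum>z\<in>{z. nbr x z}. ennreal (cond c x z) * jump_kernel c n (t - s) z y) \<partial>lborel)"

lemma nbr_sym: "nbr x y \<longleftrightarrow> nbr y x"
  by (simp add: nbr_def ldist_def norm_minus_commute)

lemma cond_sym: "cond c x y = cond c y x"
  using nbr_sym by (auto simp: cond_def insert_commute)

lemma measurable_indicator_Icc[measurable]:
  fixes f g h :: "'a \<Rightarrow> real"
  assumes [measurable]: "f \<in> borel_measurable M" "g \<in> borel_measurable M" "h \<in> borel_measurable M"
  shows "(\<lambda>x. indicator {f x..g x} (h x) :: ennreal) \<in> borel_measurable M"
proof -
  have "(\<lambda>x. indicator {f x..g x} (h x) :: ennreal) = (\<lambda>x. if f x \<le> h x \<and> h x \<le> g x then 1 else 0)"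
    by (auto simp: fun_eq_iff split: split_indicator)
  then show ?thesis by simp
qed

lemma measurable_jump_kernel[measurable]:
  "(\<lambda>t. jump_kernel c n t x y) \<in> borel_measurable borel"
proof (induction n arbitrary: x)
  case (Suc n)
  note Suc[measurable]
  show ?case by simp
qed simp

lemma nn_integral_reflect:
  fixes f :: "real \<Rightarrow> ennreal"
  assumes [measurable]: "f \<in> borel_measurable borel"
  shows "(\<integral>\<^sup>+s. f s \<partial>lborel) = (\<integral>\<^sup>+s. f (t - s) \<partial>lborel)"
  using nn_integral_real_affine[of f "-1" t] by simp

text \<open>Decomposition at the last jump, with \<open>s\<close> the time then spent at
  \<open>y\<close>. The induction exposes the first and the last holding time together and exchanges
  them by Fubini; symmetry of the kernel rests on this.\<close>

lemma jump_kernel_forward: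
  fixes c :: "'d::finite conf"
  shows "jump_kernel c (Suc n) t x y =
    (\<integral>\<^sup>+s. indicator {0..t} s * ennreal (exp (- (rate c y * s))) *
        (\<Sum>w\<in>{w. nbr y w}. ennreal (cond c y w) * jump_kernel c n (t - s) x w) \<partial>lborel)"
proof (induction n arbitrary: t x)
  case 0
  have 1: "(\<Sum>z\<in>{z. nbr x z}. ennreal (cond c x z) * jump_kernel c 0 r z y) =
     ennreal (cond c x y) * ennreal (exp (- (rate c y * r)))" for x y r
  proof -
    have "(\<Sum>z\<in>{z. nbr x z}. ennreal (cond c x z) * jump_kernel c 0 r z y) =
       (\<Sum>z\<in>{z. nbr x z}. if z = y then ennreal (cond c x y) * ennreal (exp (- (rate c y * r))) else 0)"
      by (intro sum.cong) auto
    also have "\<dots> = ennreal (cond c x y) * ennreal (exp (- (rate c y * r)))"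
      using finite_nbr[of x] by (auto simp: sum.delta cond_def)
    finally show ?thesis .
  qed
  have 2: "(\<Sum>z\<in>{z. nbr y z}. ennreal (cond c y z) * jump_kernel c 0 r x z) =
     ennreal (cond c y x) * ennreal (exp (- (rate c x * r)))" for r
  proof -
    have "(\<Sum>z\<in>{z. nbr y z}. ennreal (cond c y z) * jump_kernel c 0 r x z) =
       (\<Sum>z\<in>{z. nbr y z}. ennreal (cond c y z) * jump_kernel c 0 r z x)"
      by (intro sum.cong) auto
    then show ?thesis using 1[of y r x] by simp
  qed
  have "jump_kernel c (Suc 0) t x y =
     (\<integral>\<^sup>+s. indicator {0..t} s * ennreal (exp (- (rate c x * s))) *
        (ennreal (cond c x y) * ennreal (exp (- (rate c y * (t - s))))) \<partial>lborel)"
    unfolding jump_kernel.simps(2) 1 ..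
  also have "\<dots> = (\<integral>\<^sup>+s. indicator {0..t} (t - s) * ennreal (exp (- (rate c x * (t - s)))) *
        (ennreal (cond c x y) * ennreal (exp (- (rate c y * (t - (t - s)))))) \<partial>lborel)"
    by (rule nn_integral_reflect) measurable
  also have "\<dots> = (\<integral>\<^sup>+s. indicator {0..t} s * ennreal (exp (- (rate c y * s))) *
        (ennreal (cond c y x) * ennreal (exp (- (rate c x * (t - s))))) \<partial>lborel)"
    by (intro nn_integral_cong)
       (auto simp: cond_sym[of c y x] mult_ac split: split_indicator)
  finally show ?case unfolding 2 .
next
  case (Suc n)
  let ?e = "\<lambda>x s. ennreal (exp (- (rate c x * s)))"
  let ?I = "\<lambda>t s. indicator {0..t} s :: ennreal"
  let ?m = "\<lambda>x z. ennreal (cond c x z)"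
  let ?H = "\<lambda>s r. ?I t s * ?I (t - s) r * ?e x s * ?e y r *
      (\<Sum>z\<in>{z. nbr x z}. \<Sum>w\<in>{w. nbr y w}. ?m x z * ?m y w * jump_kernel c n (t - s - r) z w)"
  have "jump_kernel c (Suc (Suc n)) t x y = (\<integral>\<^sup>+s. ?I t s * ?e x s *
        (\<Sum>z\<in>{z. nbr x z}. ?m x z * (\<integral>\<^sup>+r. ?I (t - s) r * ?e y r *
        (\<Sum>w\<in>{w. nbr y w}. ?m y w * jump_kernel c n (t - s - r) z w) \<partial>lborel)) \<partial>lborel)"
    by (subst jump_kernel.simps(2)) (simp only: Suc)
  also have "\<dots> = (\<integral>\<^sup>+s. \<integral>\<^sup>+r. ?H s r \<partial>lborel \<partial>lborel)"
    by (intro nn_integral_cong)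
       (simp add: nn_integral_cmult[symmetric] nn_integral_sum[symmetric] sum_distrib_left mult_ac)
  also have "\<dots> = (\<integral>\<^sup>+r. \<integral>\<^sup>+s. ?H s r \<partial>lborel \<partial>lborel)"
    by (rule lborel_pair.Fubini'[symmetric]) measurable
  \<comment> \<open>The constraints on \<open>s\<close> and \<open>r\<close> describe one triangle,
    \<open>0 \<le> s\<close>, \<open>0 \<le> r\<close>, \<open>s + r \<le> t\<close>, read from
    either side.\<close>
  also have "\<dots> = (\<integral>\<^sup>+r. \<integral>\<^sup>+s. ?I t r * ?I (t - r) s * ?e x s * ?e y r *
      (\<Sum>w\<in>{w. nbr y w}. \<Sum>z\<in>{z. nbr x z}. ?m x z * ?m y w * jump_kernel c n (t - r - s) z w) \<partial>lborel \<partial>lborel)"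
    by (intro nn_integral_cong, subst sum.swap)
       (auto simp: algebra_simps split: split_indicator)
  also have "\<dots> = (\<integral>\<^sup>+r. ?I t r * ?e y r *
        (\<Sum>w\<in>{w. nbr y w}. ?m y w * jump_kernel c (Suc n) (t - r) x w) \<partial>lborel)"
    by (intro nn_integral_cong)
       (simp add: nn_integral_cmult[symmetric] nn_integral_sum[symmetric] sum_distrib_left mult_ac)
  finally show ?case .
qed

text \<open>Reversibility with respect to counting measure: at variable speed the jump rates are the
  conductances themselves, which are symmetric. The last-jump decomposition from \<open>x\<close> to
  \<open>y\<close> is the first-jump decomposition from \<open>y\<close> to
  \<open>x\<close>.\<close>

lemma jump_kernel_sym: "jump_kernel c n t x y = jump_kernel c n t y x"
proof (induction n arbitrary: t x y)
  case (Suc n)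
  have "jump_kernel c (Suc n) t x y = (\<integral>\<^sup>+s. indicator {0..t} s * ennreal (exp (- (rate c y * s))) *
        (\<Sum>w\<in>{w. nbr y w}. ennreal (cond c y w) * jump_kernel c n (t - s) w x) \<partial>lborel)"
    unfolding jump_kernel_forward by (simp only: Suc[of _ x])
  then show ?case by simp
qed simp

lemma nn_integral_Icc_split:
  fixes f :: "real \<Rightarrow> ennreal"
  assumes [measurable]: "f \<in> borel_measurable borel" and "0 \<le> s" "0 \<le> t"
  shows "(\<integral>\<^sup>+r. indicator {0..s + t} r * f r \<partial>lborel) =
    (\<integral>\<^sup>+r. indicator {0..s} r * f r \<partial>lborel) + (\<integral>\<^sup>+r. indicator {0..t} r * f (s + r) \<partial>lborel)"
proof -
  have "(\<integral>\<^sup>+r. indicator {0..s + t} r * f r \<partial>lborel) =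
    (\<integral>\<^sup>+r. indicator {0..s} r * f r + indicator {s..s + t} r * f r \<partial>lborel)"
  proof (intro nn_integral_cong_AE)
    show "AE r in lborel. indicator {0..s + t} r * f r =
        indicator {0..s} r * f r + indicator {s..s + t} r * f r"
      using AE_lborel_singleton[of s]
      by eventually_elim (use assms(2,3) in \<open>auto split: split_indicator\<close>)
  qed
  also have "\<dots> = (\<integral>\<^sup>+r. indicator {0..s} r * f r \<partial>lborel) + (\<integral>\<^sup>+r. indicator {s..s + t} r * f r \<partial>lborel)"
    by (rule nn_integral_add) auto
  also have "(\<integral>\<^sup>+r. indicator {s..s + t} r * f r \<partial>lborel) =
      (\<integral>\<^sup>+r. indicator {s..s + t} (s + 1 * r) * f (s + 1 * r) \<partial>lborel)"
    by (subst nn_integral_real_affine[of _ 1 s]) auto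
  also have "\<dots> = (\<integral>\<^sup>+r. indicator {0..t} r * f (s + r) \<partial>lborel)"
    by (intro nn_integral_cong) (auto split: split_indicator)
  finally show ?thesis .
qed

lemma borel_measurable_nn_integral_count_space:
  fixes f :: "'a \<Rightarrow> 'b::countable \<Rightarrow> ennreal"
  assumes [measurable]: "\<And>w. (\<lambda>r. f r w) \<in> borel_measurable M"
  shows "(\<lambda>r. \<integral>\<^sup>+w. f r w \<partial>count_space UNIV) \<in> borel_measurable M"
proof -
  have "(\<lambda>(r, w). f r w) \<in> borel_measurable (M \<Otimes>\<^sub>M count_space UNIV)"
    unfolding case_prod_beta
    by (rule measurable_compose_countable'[where f="\<lambda>w p. f (fst p) w" and g=snd and I=UNIV]) auto
  then show ?thesis
    by (rule sigma_finite_measure.borel_measurable_nn_integral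
          [OF sigma_finite_measure_count_space_countable[OF countableI_type]])
qed

text \<open>Some number \<open>k\<close> of the jumps happens by time \<open>s\<close>, the other
  \<open>n - k\<close> afterwards. Induction on the first jump: if it comes after \<open>s\<close>,
  the survival factor up to \<open>s\<close> splits off and gives the term \<open>k = 0\<close>; if
  it comes at \<open>r \<le> s\<close>, the induction hypothesis applies with
  \<open>s - r\<close>.\<close>

lemma jump_kernel_Chapman_Kolmogorov:
  fixes c :: "'d::finite conf"
  assumes "0 \<le> s" "0 \<le> t"
  shows "jump_kernel c n (s + t) x y =
    (\<Sum>k\<le>n. \<integral>\<^sup>+z. jump_kernel c k s x z * jump_kernel c (n - k) t z y \<partial>count_space UNIV)"
  using assms
proof (induction n arbitrary: s x)
  case 0
  have "(\<integral>\<^sup>+z. jump_kernel c 0 s x z * jump_kernel c 0 t z y \<partial>count_space UNIV) =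
     (\<integral>\<^sup>+z. (jump_kernel c 0 s x x * jump_kernel c 0 t x y) * indicator {x} z \<partial>count_space UNIV)"
    by (intro nn_integral_cong) (auto split: split_indicator)
  also have "\<dots> = jump_kernel c 0 s x x * jump_kernel c 0 t x y"
    by (simp add: nn_integral_cmult_indicator)
  finally show ?case
    by (simp add: ennreal_mult[symmetric] exp_add[symmetric] algebra_simps)
next
  case (Suc n)
  let ?e = "\<lambda>x s. ennreal (exp (- (rate c x * s)))"
  let ?I = "\<lambda>t s. indicator {0..t} s :: ennreal"
  let ?m = "\<lambda>x z. ennreal (cond c x z)"
  let ?S = "\<lambda>r. \<Sum>z\<in>{z. nbr x z}. ?m x z * jump_kernel c n (s + t - r) z y"
  have "jump_kernel c (Suc n) (s + t) x y = (\<integral>\<^sup>+r. ?I (s + t) r * (?e x r * ?S r) \<partial>lborel)"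
    by (simp add: mult_ac)
  also have "\<dots> = (\<integral>\<^sup>+r. ?I s r * (?e x r * ?S r) \<partial>lborel) +
      (\<integral>\<^sup>+r. ?I t r * (?e x (s + r) * ?S (s + r)) \<partial>lborel)"
    using Suc.prems by (intro nn_integral_Icc_split) measurable
  also have "(\<integral>\<^sup>+r. ?I t r * (?e x (s + r) * ?S (s + r)) \<partial>lborel) =
      ?e x s * jump_kernel c (Suc n) t x y"
  proof -
    have "?e x (s + r) = ?e x s * ?e x r" for r
      by (simp add: ennreal_mult[symmetric] exp_add[symmetric] ring_distribs)
    then show ?thesis
      unfolding jump_kernel.simps
      by (subst nn_integral_cmult[symmetric]) (auto intro!: nn_integral_cong simp: mult_ac)
  qed
  also have "?e x s * jump_kernel c (Suc n) t x y =
      (\<integral>\<^sup>+z. jump_kernel c 0 s x z * jump_kernel c (Suc n) t z y \<partial>count_space UNIV)"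
  proof -
    have "(\<integral>\<^sup>+z. jump_kernel c 0 s x z * jump_kernel c (Suc n) t z y \<partial>count_space UNIV) =
       (\<integral>\<^sup>+z. (?e x s * jump_kernel c (Suc n) t x y) * indicator {x} z \<partial>count_space UNIV)"
      by (intro nn_integral_cong) (auto split: split_indicator)
    then show ?thesis by (simp add: nn_integral_cmult_indicator)
  qed
  also have "(\<integral>\<^sup>+r. ?I s r * (?e x r * ?S r) \<partial>lborel) =
     (\<integral>\<^sup>+r. (\<Sum>k\<le>n. \<integral>\<^sup>+w. ?I s r * ?e x r * (\<Sum>z\<in>{z. nbr x z}. ?m x z * jump_kernel c k (s - r) z w)
         * jump_kernel c (n - k) t w y \<partial>count_space UNIV) \<partial>lborel)"
  proof (intro nn_integral_cong)
    fix r
    show "?I s r * (?e x r * ?S r) = (\<Sum>k\<le>n. \<integral>\<^sup>+w. ?I s r * ?e x r *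
        (\<Sum>z\<in>{z. nbr x z}. ?m x z * jump_kernel c k (s - r) z w)
         * jump_kernel c (n - k) t w y \<partial>count_space UNIV)" (is "?l = ?r")
    proof (cases "r \<in> {0..s}")
      case True
      then have r: "jump_kernel c n (s + t - r) z y =
        (\<Sum>k\<le>n. \<integral>\<^sup>+w. jump_kernel c k (s - r) z w * jump_kernel c (n - k) t w y \<partial>count_space UNIV)" for z
        using Suc.IH[of "s - r" z] Suc.prems by (simp add: algebra_simps)
      have "?l = ?e x r * (\<Sum>z\<in>{z. nbr x z}. \<Sum>k\<le>n. ?m x z * (\<integral>\<^sup>+w. jump_kernel c k (s - r) z w * jump_kernel c (n - k) t w y \<partial>count_space UNIV))"
        using True by (simp add: r sum_distrib_left)
      also have "\<dots> = ?e x r * (\<Sum>k\<le>n. \<Sum>z\<in>{z. nbr x z}. ?m x z * (\<integral>\<^sup>+w. jump_kernel c k (s - r) z w * jump_kernel c (n - k) t w y \<partial>count_space UNIV))"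
        by (subst sum.swap) simp
      also have "\<dots> = ?r"
        using True by (simp add: sum_distrib_left sum_distrib_right nn_integral_cmult[symmetric] nn_integral_sum[symmetric] mult_ac)
      finally show ?thesis .
    qed simp
  qed
  also have "\<dots> = (\<Sum>k\<le>n. \<integral>\<^sup>+r. (\<integral>\<^sup>+w. ?I s r * ?e x r * (\<Sum>z\<in>{z. nbr x z}. ?m x z * jump_kernel c k (s - r) z w)
         * jump_kernel c (n - k) t w y \<partial>count_space UNIV) \<partial>lborel)"
    by (intro nn_integral_sum borel_measurable_nn_integral_count_space) measurable
  also have "\<dots> = (\<Sum>k\<le>n. \<integral>\<^sup>+w. (\<integral>\<^sup>+r. ?I s r * ?e x r * (\<Sum>z\<in>{z. nbr x z}. ?m x z * jump_kernel c k (s - r) z w)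
         * jump_kernel c (n - k) t w y \<partial>lborel) \<partial>count_space UNIV)"
    by (intro sum.cong refl nn_integral_count_space_nn_integral) measurable
  also have "\<dots> = (\<Sum>k\<le>n. \<integral>\<^sup>+w. jump_kernel c (Suc k) s x w * jump_kernel c (Suc n - Suc k) t w y \<partial>count_space UNIV)"
    by (intro sum.cong refl nn_integral_cong) (simp add: nn_integral_multc)
  finally show ?case
    by (simp add: sum.atMost_Suc_shift add.commute del: sum.atMost_Suc jump_kernel.simps)
qed

section \<open>The law of the walk\<close>

locale positive_conductances =
  fixes c :: "'d::finite conf"
  assumes pos: "\<And>e. e \<in> edges \<Longrightarrow> 0 < c e"
begin

lemma rate_gt_0: "0 < rate c x"
  by (rule rate_pos[OF pos])

lemma cond_nonneg: "0 \<le> cond c x y"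
proof (cases "nbr x y")
  case True
  then have "{x, y} \<in> edges" unfolding edges_def by blast
  then show ?thesis using pos[of "{x, y}"] by (simp add: cond_def)
qed (simp add: cond_def)

lemma space_pair_space[simp]: "space pair_space = UNIV"
  by (simp add: space_pair_measure)

lemma Ionescu_Tulcea_walk: "Ionescu_Tulcea (vsrw_step c x) (\<lambda>_. pair_space)"
  by (rule Ionescu_Tulcea_vsrw[OF pos])

lemma sets_vsrw_law[measurable_cong, simp]: "sets (vsrw_law c x) = sets (PiM UNIV (\<lambda>_. pair_space))"
proof -
  interpret Ionescu_Tulcea "vsrw_step c x" "\<lambda>_. pair_space" by (rule Ionescu_Tulcea_walk)
  show ?thesis unfolding vsrw_law_def by (rule PF.sets_lim)
qed

lemma space_vsrw_law[simp]: "space (vsrw_law c x) = UNIV"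
  using sets_eq_imp_space_eq[OF sets_vsrw_law, of x] by (simp add: space_PiM)

text \<open>\<open>CI J\<close> runs the construction for \<open>up_to J\<close> steps and projects
  to \<open>J\<close>. For an initial segment nothing is projected away, so the recursion of
  \<open>C\<close> becomes available for the law of the walk.\<close>

lemma vsrw_law_initial_segment:
  "distr (vsrw_law c x) (PiM {0..<m} (\<lambda>_. pair_space)) (\<lambda>p. restrict p {0..<m}) =
    Ionescu_Tulcea.C (vsrw_step c x) (\<lambda>_. pair_space) 0 m (\<lambda>_. undefined)"
proof -
  interpret Ionescu_Tulcea "vsrw_step c x" "\<lambda>_. pair_space" by (rule Ionescu_Tulcea_walk)
  have "up_to {0..<m} = m"
  proof (rule antisym)
    show "up_to {0..<m} \<le> m" by (simp add: up_to_iff)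
    show "m \<le> up_to {0..<m}"
    proof (cases m)
      case (Suc k)
      then show ?thesis using up_to_less[of "{0..<m}" k] by simp
    qed simp
  qed
  then have "CI {0..<m} = C 0 m (\<lambda>_. undefined)"
    unfolding CI_def using distr_C[of m m "\<lambda>_. undefined" 0] by simp
  then show ?thesis
    by (subst vsrw_law_marginals[OF pos]) simp_all
qed

text \<open>Total mass is visible in every marginal; the one on the empty index set is the
  simplest.\<close>

lemma prob_space_vsrw_law: "prob_space (vsrw_law c x)"
proof -
  interpret Ionescu_Tulcea "vsrw_step c x" "\<lambda>_. pair_space" by (rule Ionescu_Tulcea_walk)
  have "prob_space (distr (vsrw_law c x) (PiM {0..<0} (\<lambda>_. pair_space)) (\<lambda>p. restrict p {0..<0}))"
    unfolding vsrw_law_initial_segment by (rule prob_space_C) simp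
  then show ?thesis
    by (rule prob_space_distrD[rotated]) (auto intro!: measurable_restrict)
qed

lemma nn_integral_vsrw_law_step:
  assumes f[measurable]: "f \<in> borel_measurable (PiM {0..<Suc m} (\<lambda>_. pair_space))"
  shows "(\<integral>\<^sup>+p. f (restrict p {0..<Suc m}) \<partial>vsrw_law c x) =
    (\<integral>\<^sup>+p. (\<integral>\<^sup>+z. f ((restrict p {0..<m})(m := z)) \<partial>vsrw_step c x m (restrict p {0..<m})) \<partial>vsrw_law c x)"
proof -
  interpret Ionescu_Tulcea "vsrw_step c x" "\<lambda>_. pair_space" by (rule Ionescu_Tulcea_walk)
  let ?u = "\<lambda>_::nat. undefined :: (int ^ 'd) \<times> real"
  have u: "?u \<in> space (PiM {0..<0} (\<lambda>_. pair_space))" by simp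
  have r[measurable]: "(\<lambda>p. restrict p {0..<k}) \<in> measurable (vsrw_law c x) (PiM {0..<k} (\<lambda>_. pair_space))" for k
    by (auto intro!: measurable_restrict)
  have "(\<integral>\<^sup>+p. f (restrict p {0..<Suc m}) \<partial>vsrw_law c x) = (\<integral>\<^sup>+w. f w \<partial>C 0 (Suc m) ?u)"
    unfolding vsrw_law_initial_segment[symmetric] by (rule nn_integral_distr[symmetric]) measurable
  also have "\<dots> = (\<integral>\<^sup>+w. (\<integral>\<^sup>+v. f v \<partial>eP m w) \<partial>C 0 m ?u)"
    unfolding C.simps
  proof (subst nn_integral_bind[where B="PiM {0..<Suc m} (\<lambda>_. pair_space)"])
    show "eP (0 + m) \<in> C 0 m ?u \<rightarrow>\<^sub>M subprob_algebra (PiM {0..<Suc m} (\<lambda>_. pair_space))"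
      using measurable_eP[of m] unfolding measurable_cong_sets[OF sets_C[OF u] refl] by simp
  qed auto
  also have "\<dots> = (\<integral>\<^sup>+w. (\<integral>\<^sup>+z. f (w(m := z)) \<partial>vsrw_step c x m w) \<partial>C 0 m ?u)"
    by (intro nn_integral_cong nn_integral_eP f) (simp add: space_C[OF u])
  also have "\<dots> = (\<integral>\<^sup>+p. (\<integral>\<^sup>+z. f ((restrict p {0..<m})(m := z)) \<partial>vsrw_step c x m (restrict p {0..<m})) \<partial>vsrw_law c x)"
  proof -
    have "(\<lambda>w. \<integral>\<^sup>+z. f z \<partial>eP m w) \<in> borel_measurable (PiM {0..<m} (\<lambda>_. pair_space))"
      by measurable
    moreover have "(\<integral>\<^sup>+z. f z \<partial>eP m w) = (\<integral>\<^sup>+z. f (w(m := z)) \<partial>vsrw_step c x m w)"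
      if "w \<in> space (PiM {0..<m} (\<lambda>_. pair_space))" for w
      by (rule nn_integral_eP[OF that f])
    ultimately have "(\<lambda>w. \<integral>\<^sup>+z. f (w(m := z)) \<partial>vsrw_step c x m w) \<in>
        borel_measurable (PiM {0..<m} (\<lambda>_. pair_space))"
      by (rule measurable_cong[THEN iffD1, rotated])
    then show ?thesis
      unfolding vsrw_law_initial_segment[symmetric] by (simp add: nn_integral_distr[OF r])
  qed
  finally show ?thesis .
qed

lemma sets_visit[measurable_cong, simp]: "sets (visit c z) = sets pair_space"
  by (simp add: visit_def)

lemma nn_integral_visit:
  assumes [measurable]: "g \<in> borel_measurable pair_space"
  shows "(\<integral>\<^sup>+p. g p \<partial>visit c z) =
    (\<integral>\<^sup>+s. ennreal (exponential_density (rate c z) s) * g (z, s) \<partial>lborel)"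
proof -
  have [measurable]: "Pair z \<in> measurable (density lborel (\<lambda>s. ennreal (exponential_density (rate c z) s))) pair_space"
    by measurable
  show ?thesis
    unfolding visit_def by (simp add: nn_integral_distr nn_integral_density)
qed

lemma nn_integral_jump_visit:
  assumes [measurable]: "g \<in> borel_measurable pair_space"
  shows "(\<integral>\<^sup>+p. g p \<partial>(jump c x \<bind> visit c)) =
    (\<Sum>z\<in>{z. nbr x z}. ennreal (cond c x z / rate c x) * (\<integral>\<^sup>+p. g p \<partial>visit c z))"
proof -
  have v: "visit c z \<in> space (subprob_algebra pair_space)" for z
    using prob_space_visit[OF rate_gt_0, of z] 
    by (auto simp: space_subprob_algebra intro: prob_space_imp_subprob_space)
  have "visit c \<in> measurable (count_space UNIV) (subprob_algebra pair_space)"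
    using v by simp
  then have m: "visit c \<in> measurable (jump c x) (subprob_algebra pair_space)"
    by (simp add: jump_def measurable_def)
  have "(\<integral>\<^sup>+p. g p \<partial>(jump c x \<bind> visit c)) = (\<integral>\<^sup>+z. (\<integral>\<^sup>+p. g p \<partial>visit c z) \<partial>jump c x)"
    by (rule nn_integral_bind[OF _ m]) measurable
  also have "\<dots> = (\<integral>\<^sup>+z. ennreal (cond c x z / rate c x) * (\<integral>\<^sup>+p. g p \<partial>visit c z) \<partial>count_space UNIV)"
    unfolding jump_def by (rule nn_integral_density) auto
  also have "\<dots> = (\<Sum>z\<in>{z. nbr x z}. ennreal (cond c x z / rate c x) * (\<integral>\<^sup>+p. g p \<partial>visit c z))"
    using finite_nbr[of x] by (intro nn_integral_count_space') (auto simp: cond_def)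
  finally show ?thesis .
qed

lemma measurable_component[measurable]: "(\<lambda>p. p i) \<in> measurable (vsrw_law c x) pair_space"
  by (rule measurable_cong_sets[OF sets_vsrw_law refl, THEN equalityD2, THEN subsetD]) simp

lemma arrival_cong: "(\<And>i. i < n \<Longrightarrow> p i = q i) \<Longrightarrow> arrival p n = arrival q n"
  by (simp add: arrival_def)

lemma arrival_Suc: "arrival p (Suc n) = arrival p n + snd (p n)"
  by (simp add: arrival_def)

lemma measurable_arrival[measurable]: "(\<lambda>p. arrival p n) \<in> borel_measurable (vsrw_law c x)"
  unfolding arrival_def by measurable

lemma measurable_arrival_PiM: "n \<le> m \<Longrightarrow>
  (\<lambda>p. arrival p n) \<in> borel_measurable (PiM {0..<m} (\<lambda>_. pair_space :: ((int ^ 'd) \<times> real) measure))"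
  unfolding arrival_def
proof (rule borel_measurable_sum)
  fix i assume "n \<le> m" "i \<in> {..<n}"
  then have [measurable]: "(\<lambda>p. p i) \<in> measurable (PiM {0..<m} (\<lambda>_. pair_space :: ((int ^ 'd) \<times> real) measure)) pair_space"
    by (intro measurable_component_singleton) simp
  show "(\<lambda>p. snd (p i)) \<in> borel_measurable (PiM {0..<m} (\<lambda>_. pair_space :: ((int ^ 'd) \<times> real) measure))"
    by measurable
qed

lemma nn_integral_vsrw_law_0:
  assumes [measurable]: "case_prod g \<in> borel_measurable (borel \<Otimes>\<^sub>M pair_space)"
  shows "(\<integral>\<^sup>+p. g (arrival p 0) (p 0) \<partial>vsrw_law c x) = (\<integral>\<^sup>+z. g 0 z \<partial>visit c x)"
proof -
  interpret prob_space "vsrw_law c x" by (rule prob_space_vsrw_law)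
  have [measurable]: "(\<lambda>p. p 0) \<in> measurable (PiM {0..<Suc 0} (\<lambda>_. pair_space :: ((int ^ 'd) \<times> real) measure)) pair_space"
    by (rule measurable_component_singleton) simp
  have "(\<integral>\<^sup>+p. g (arrival p 0) (p 0) \<partial>vsrw_law c x) =
    (\<integral>\<^sup>+p. (\<lambda>p. g 0 (p 0)) (restrict p {0..<Suc 0}) \<partial>vsrw_law c x)"
    by (simp add: arrival_def)
  also have "\<dots> = (\<integral>\<^sup>+z. g 0 z \<partial>visit c x)"
    by (subst nn_integral_vsrw_law_step) (simp_all add: vsrw_step_def emeasure_space_1[simplified])
  finally show ?thesis .
qed

text \<open>Functionals of the arrival time and the current visit are closed under stepping back one
  visit: the right-hand side is again of this form, at \<open>n\<close>. This is the Markov property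
  in the shape used by the induction over jumps.\<close>

lemma nn_integral_vsrw_law_Suc:
  assumes g[measurable]: "case_prod g \<in> borel_measurable (borel \<Otimes>\<^sub>M pair_space)"
  shows "(\<integral>\<^sup>+p. g (arrival p (Suc n)) (p (Suc n)) \<partial>vsrw_law c x) =
    (\<integral>\<^sup>+p. (\<Sum>z\<in>{z. nbr (fst (p n)) z}. ennreal (cond c (fst (p n)) z / rate c (fst (p n))) *
        (\<integral>\<^sup>+q. g (arrival p n + snd (p n)) q \<partial>visit c z)) \<partial>vsrw_law c x)"
proof -
  let ?P = "PiM {0..<Suc (Suc n)} (\<lambda>_. pair_space :: ((int ^ 'd) \<times> real) measure)"
  have [measurable]: "(\<lambda>p. p (Suc n)) \<in> measurable ?P pair_space"
    by (rule measurable_component_singleton) simp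
  have [measurable]: "(\<lambda>p. arrival p (Suc n)) \<in> borel_measurable ?P"
    by (rule measurable_arrival_PiM) simp
  have r: "arrival (restrict p {0..<Suc (Suc n)}) (Suc n) = arrival p (Suc n)"
    and u: "arrival ((restrict p {0..<Suc n})(Suc n := z)) (Suc n) = arrival p (Suc n)" for p :: "nat \<Rightarrow> (int ^ 'd) \<times> real" and z
    by (rule arrival_cong, simp)+
  have "(\<integral>\<^sup>+p. g (arrival p (Suc n)) (p (Suc n)) \<partial>vsrw_law c x) =
    (\<integral>\<^sup>+p. (\<lambda>p. g (arrival p (Suc n)) (p (Suc n))) (restrict p {0..<Suc (Suc n)}) \<partial>vsrw_law c x)"
    unfolding r by simp
  also have "\<dots> = (\<integral>\<^sup>+p. (\<integral>\<^sup>+z. g (arrival p (Suc n)) z \<partial>vsrw_step c x (Suc n) (restrict p {0..<Suc n})) \<partial>vsrw_law c x)"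
    by (subst nn_integral_vsrw_law_step) (measurable, simp only: u fun_upd_same)
  also have "\<dots> = (\<integral>\<^sup>+p. (\<integral>\<^sup>+z. g (arrival p (Suc n)) z \<partial>(jump c (fst (p n)) \<bind> visit c)) \<partial>vsrw_law c x)"
    by (simp add: vsrw_step_def)
  also have "\<dots> = (\<integral>\<^sup>+p. (\<Sum>z\<in>{z. nbr (fst (p n)) z}. ennreal (cond c (fst (p n)) z / rate c (fst (p n))) *
        (\<integral>\<^sup>+q. g (arrival p n + snd (p n)) q \<partial>visit c z)) \<partial>vsrw_law c x)"
    unfolding arrival_Suc
    by (intro nn_integral_cong nn_integral_jump_visit measurable_compose[OF _ g, simplified])
       measurable
  finally show ?thesis .
qed

end

text \<open>Kept in \<open>ennreal\<close>, so that sums over jumps, sums over sites and integrals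
  interchange freely; \<open>hk_eq_heat\<close> identifies it with the probabilistic kernel.\<close>

definition heat :: "'d::finite conf \<Rightarrow> real \<Rightarrow> int ^ 'd \<Rightarrow> int ^ 'd \<Rightarrow> ennreal" where
  "heat c t x y = (\<Sum>n. jump_kernel c n t x y)"

lemma heat_sym: "heat c t x y = heat c t y x"
  unfolding heat_def by (subst jump_kernel_sym) (rule refl)

lemma suminf_triangle_ennreal:
  fixes f :: "nat \<Rightarrow> nat \<Rightarrow> ennreal"
  shows "(\<Sum>n. \<Sum>k\<le>n. f k (n - k)) = (\<Sum>k. \<Sum>m. f k m)"
proof -
  let ?g = "\<lambda>n k. f k (n - k) * indicator {k..} n"
  have "(\<Sum>n. \<Sum>k\<le>n. f k (n - k)) = (\<Sum>n. \<Sum>k. ?g n k)"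
  proof (rule suminf_cong)
    fix n
    have "(\<Sum>k. ?g n k) = (\<Sum>k\<le>n. ?g n k)"
      by (rule suminf_finite) auto
    also have "\<dots> = (\<Sum>k\<le>n. f k (n - k))" by (intro sum.cong) auto
    finally show "(\<Sum>k\<le>n. f k (n - k)) = (\<Sum>k. ?g n k)" ..
  qed
  also have "\<dots> = (\<Sum>k. \<Sum>n. ?g n k)"
    unfolding nn_integral_count_space_nat[symmetric]
    by (rule nn_integral_count_space_nn_integral) auto
  also have "\<dots> = (\<Sum>k. \<Sum>m. f k m)"
  proof (rule suminf_cong)
    fix k
    have "bij_betw (\<lambda>m::nat. m + k) UNIV {k..}"
      by (rule bij_betw_byWitness[where f' = "\<lambda>n. n - k"]) auto
    from nn_integral_bij_count_space[OF this, of "\<lambda>n. f k (n - k)"]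
    show "(\<Sum>n. ?g n k) = (\<Sum>m. f k m)"
      by (simp add: nn_integral_count_space_nat[symmetric] nn_integral_count_space_indicator[of "{k..}"])
  qed
  finally show ?thesis .
qed

lemma heat_Chapman_Kolmogorov:
  assumes "0 \<le> s" "0 \<le> t"
  shows "heat c (s + t) x y = (\<integral>\<^sup>+z. heat c s x z * heat c t z y \<partial>count_space UNIV)"
proof -
  have "(\<integral>\<^sup>+z. heat c s x z * heat c t z y \<partial>count_space UNIV) =
    (\<integral>\<^sup>+z. (\<Sum>k. \<Sum>m. jump_kernel c k s x z * jump_kernel c m t z y) \<partial>count_space UNIV)"
    unfolding heat_def by (simp only: ennreal_suminf_multc ennreal_suminf_cmult)
  also have "\<dots> = (\<Sum>k. \<Sum>m. \<integral>\<^sup>+z. jump_kernel c k s x z * jump_kernel c m t z y \<partial>count_space UNIV)"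
    by (simp add: nn_integral_suminf del: ennreal_suminf_cmult ennreal_suminf_multc)
  also have "\<dots> = (\<Sum>n. \<Sum>k\<le>n. \<integral>\<^sup>+z. jump_kernel c k s x z * jump_kernel c (n - k) t z y \<partial>count_space UNIV)"
    by (rule suminf_triangle_ennreal[symmetric])
  also have "\<dots> = heat c (s + t) x y"
    unfolding heat_def jump_kernel_Chapman_Kolmogorov[OF assms] ..
  finally show ?thesis ..
qed

context positive_conductances
begin

text \<open>Only trajectories with exactly one jump are counted, and both stays are charged with
  survival over the whole interval. As \<open>h\<close> tends to 0 the bound recovers the
  conductance to first order, which later turns a sum weighted by the kernel at time
  \<open>h\<close> into a sum over edges.\<close>

lemma heat_lower:
  assumes "nbr x y" "0 \<le> h"
  shows "ennreal (h * (cond c x y * exp (- ((rate c x + rate c y) * h)))) \<le> heat c h x y"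
proof -
  let ?K = "cond c x y * exp (- ((rate c x + rate c y) * h))"
  have "ennreal (h * ?K) = (\<integral>\<^sup>+s. ennreal ?K * indicator {0..h} s \<partial>lborel)"
    using assms cond_nonneg by (subst nn_integral_cmult_indicator) (auto simp: ennreal_mult[symmetric] mult_ac)
  also have "\<dots> \<le> jump_kernel c (Suc 0) h x y"
    unfolding jump_kernel.simps(2)
  proof (rule nn_integral_mono)
    fix s
    show "ennreal ?K * indicator {0..h} s \<le> indicator {0..h} s * ennreal (exp (- (rate c x * s))) *
      (\<Sum>z\<in>{z. nbr x z}. ennreal (cond c x z) * jump_kernel c 0 (h - s) z y)"
    proof (cases "s \<in> {0..h}")
      case True
      have "?K \<le> exp (- (rate c x * s)) * (cond c x y * exp (- (rate c y * (h - s))))"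
      proof -
        have "rate c x * s \<le> rate c x * h" "rate c y * (h - s) \<le> rate c y * h"
          using True rate_gt_0[of x] rate_gt_0[of y] by auto
        then have "rate c x * s + rate c y * (h - s) \<le> (rate c x + rate c y) * h"
          by (simp add: ring_distribs)
        then have "exp (- ((rate c x + rate c y) * h)) \<le> exp (- (rate c x * s)) * exp (- (rate c y * (h - s)))"
          by (simp add: exp_add[symmetric])
        from mult_left_mono[OF this cond_nonneg[of x y]] show ?thesis by (simp add: mult_ac)
      qed
      then have "ennreal ?K \<le> ennreal (exp (- (rate c x * s))) * (ennreal (cond c x y) * jump_kernel c 0 (h - s) y y)"
        using cond_nonneg by (simp add: ennreal_mult[symmetric] ennreal_leI)
      also have "ennreal (cond c x y) * jump_kernel c 0 (h - s) y y \<le> 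
         (\<Sum>z\<in>{z. nbr x z}. ennreal (cond c x z) * jump_kernel c 0 (h - s) z y)"
        using assms(1) finite_nbr[of x] by (intro member_le_sum[of y]) auto
      finally show ?thesis using True by (simp add: mult_left_mono)
    qed simp
  qed
  also have "\<dots> \<le> heat c h x y"
  proof -
    have "(\<Sum>n\<in>{Suc 0}. jump_kernel c n h x y) \<le> (\<Sum>n. jump_kernel c n h x y)"
      by (rule sum_le_suminf) auto
    then show ?thesis unfolding heat_def by simp
  qed
  finally show ?thesis .
qed

lemma nn_integral_exp_tail:
  assumes "0 < l"
  shows "(\<integral>\<^sup>+s. ennreal (l * exp (- (s * l))) * indicator {a..} s \<partial>lborel) = ennreal (exp (- (a * l)))"
proof -
  have "((\<lambda>s. - exp (- (s * l))) \<longlongrightarrow> - 0) at_top"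
    using assms
    by (intro tendsto_minus filterlim_compose[OF exp_at_bot] filterlim_compose[OF filterlim_uminus_at_bot_at_top]
          filterlim_at_top_mult_tendsto_pos[OF tendsto_const assms filterlim_ident])
  then have "(\<integral>\<^sup>+s. ennreal (l * exp (- (s * l))) * indicator {a..} s \<partial>lborel) = ennreal (- 0 - (- exp (- (a * l))))"
    using assms
    by (intro nn_integral_FTC_atLeast) (auto intro!: derivative_eq_intros)
  then show ?thesis by simp
qed

text \<open>The statement is general in \<open>k\<close> because one more visit of the walk turns a functional that
  integrates to the \<open>k\<close>-jump kernel into one for \<open>k + 1\<close> jumps.\<close>

lemma nn_integral_vsrw_law_jump_kernel:
  assumes "case_prod g \<in> borel_measurable (borel \<Otimes>\<^sub>M pair_space)" and t: "0 \<le> t"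
    and V: "\<And>a z. (\<integral>\<^sup>+p. g a p \<partial>visit c z) = indicator {..t} a * jump_kernel c k (t - a) z y"
  shows "(\<integral>\<^sup>+p. g (arrival p n) (p n) \<partial>vsrw_law c x) = jump_kernel c (n + k) t x y"
  using assms(1) V
proof (induction n arbitrary: g k)
  case 0
  then show ?case using t by (simp add: nn_integral_vsrw_law_0)
next
  case (Suc n)
  note [measurable] = Suc.prems(1)
  define g' where "g' = (\<lambda>a p. (\<Sum>z\<in>{z. nbr (fst p) z}. ennreal (cond c (fst p) z / rate c (fst p)) *
        (indicator {..t} (a + snd p) * jump_kernel c k (t - (a + snd p)) z y)))"
  have g': "case_prod g' \<in> borel_measurable (borel \<Otimes>\<^sub>M pair_space)"
  proof -
    have "(\<lambda>q. (\<lambda>x q. \<Sum>z\<in>{z. nbr x z}. ennreal (cond c x z / rate c x) *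
        (indicator {..t} (fst q + snd (snd q)) * jump_kernel c k (t - (fst q + snd (snd q))) z y)) (fst (snd q)) q)
      \<in> borel_measurable (borel \<Otimes>\<^sub>M pair_space)"
      by (rule measurable_compose_countable'[where I=UNIV]) auto
    then show ?thesis by (simp add: g'_def case_prod_beta')
  qed
  have "(\<integral>\<^sup>+p. g (arrival p (Suc n)) (p (Suc n)) \<partial>vsrw_law c x) = (\<integral>\<^sup>+p. g' (arrival p n) (p n) \<partial>vsrw_law c x)"
    by (subst nn_integral_vsrw_law_Suc) (simp_all add: g'_def Suc.prems)
  also have "\<dots> = jump_kernel c (n + Suc k) t x y"
  proof (rule Suc.IH[OF g'])
    fix a z
    have [measurable]: "g' a \<in> borel_measurable pair_space"
      using measurable_compose[OF _ g', of "\<lambda>p. (a, p)"] by simp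
    have "(\<integral>\<^sup>+p. g' a p \<partial>visit c z) = (\<integral>\<^sup>+s. indicator {..t} a * (indicator {0..t - a} s * ennreal (exp (- (rate c z * s))) *
        (\<Sum>w\<in>{w. nbr z w}. ennreal (cond c z w) * jump_kernel c k (t - a - s) w y)) \<partial>lborel)"
      unfolding nn_integral_visit[OF \<open>g' a \<in> _\<close>]
    proof (rule nn_integral_cong)
      fix s
      have e: "ennreal (rate c z * exp (- (s * rate c z))) * (ennreal (cond c z w / rate c z) * u) =
         ennreal (exp (- (rate c z * s))) * (ennreal (cond c z w) * u)" for w u
        using rate_gt_0[of z] cond_nonneg[of z w]
        by (simp add: ennreal_mult[symmetric] mult.assoc[symmetric] mult_ac)
      show "ennreal (exponential_density (rate c z) s) * g' a (z, s) = 
        indicator {..t} a * (indicator {0..t - a} s * ennreal (exp (- (rate c z * s))) *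
        (\<Sum>w\<in>{w. nbr z w}. ennreal (cond c z w) * jump_kernel c k (t - a - s) w y))"
      proof (cases "0 \<le> s \<and> a + s \<le> t")
        case True
        then show ?thesis
          by (simp add: exponential_density_def g'_def sum_distrib_left e diff_diff_eq)
      next
        case False
        then show ?thesis
          by (auto simp: exponential_density_def g'_def split: split_indicator)
      qed
    qed
    also have "\<dots> = indicator {..t} a * jump_kernel c (Suc k) (t - a) z y"
      by (simp add: nn_integral_cmult)
    finally show "(\<integral>\<^sup>+p. g' a p \<partial>visit c z) = indicator {..t} a * jump_kernel c (Suc k) (t - a) z y" .
  qed
  finally show ?case by simp
qed

lemma measurable_present_indicator:
  "(\<lambda>(a, p). indicator {a. a \<le> t} a * indicator {b. t < b} (a + snd p) * indicator {y} (fst p) :: ennreal)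
    \<in> borel_measurable (borel \<Otimes>\<^sub>M pair_space)"
  by measurable

text \<open>The event is a function of the n-th arrival and the n-th visit. Integrating out the last
  holding time leaves a survival probability, which is the kernel with no jump, so the general
  induction applies with \<open>k = 0\<close>.\<close>

lemma emeasure_jump_kernel:
  assumes t: "0 \<le> t"
  shows "emeasure (vsrw_law c x) {p. arrival p n \<le> t \<and> t < arrival p (Suc n) \<and> fst (p n) = y} =
    jump_kernel c n t x y"
proof -
  let ?g = "\<lambda>a p. indicator {a. a \<le> t} a * indicator {b. t < b} (a + snd p) * indicator {y} (fst p) :: ennreal"
  have A: "{p. arrival p n \<le> t \<and> t < arrival p (Suc n) \<and> fst (p n) = y} \<in> sets (vsrw_law c x)"
  proof -
    have "{p \<in> space (vsrw_law c x). arrival p n \<le> t \<and> t < arrival p (Suc n) \<and> fst (p n) = y} \<in> sets (vsrw_law c x)"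
      by measurable
    then show ?thesis by simp
  qed
  have V: "(\<integral>\<^sup>+p. ?g a p \<partial>visit c z) = indicator {..t} a * jump_kernel c 0 (t - a) z y" for a z
  proof -
    have "(\<integral>\<^sup>+p. ?g a p \<partial>visit c z) = (\<integral>\<^sup>+s. ennreal (exponential_density (rate c z) s) * ?g a (z, s) \<partial>lborel)"
      by (rule nn_integral_visit) measurable
    also have "\<dots> = (\<integral>\<^sup>+s. indicator {..t} a * indicator {y} z *
        (ennreal (rate c z * exp (- (s * rate c z))) * indicator {t - a..} s) \<partial>lborel)"
    proof (rule nn_integral_cong_AE)
      show "AE s in lborel. ennreal (exponential_density (rate c z) s) * ?g a (z, s) =
        indicator {..t} a * indicator {y} z * (ennreal (rate c z * exp (- (s * rate c z))) * indicator {t - a..} s)"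
        using AE_lborel_singleton[of "t - a"]
        by eventually_elim (auto simp: exponential_density_def split: split_indicator)
    qed
    also have "\<dots> = indicator {..t} a * indicator {y} z * ennreal (exp (- ((t - a) * rate c z)))"
      by (subst nn_integral_cmult) (auto simp: nn_integral_exp_tail[OF rate_gt_0])
    also have "\<dots> = indicator {..t} a * jump_kernel c 0 (t - a) z y"
      by (auto simp: mult_ac split: split_indicator)
    finally show ?thesis .
  qed
  have "emeasure (vsrw_law c x) {p. arrival p n \<le> t \<and> t < arrival p (Suc n) \<and> fst (p n) = y} =
    (\<integral>\<^sup>+p. ?g (arrival p n) (p n) \<partial>vsrw_law c x)"
    unfolding nn_integral_indicator[OF A, symmetric]
    by (intro nn_integral_cong) (auto simp: arrival_Suc split: split_indicator)
  also have "\<dots> = jump_kernel c (n + 0) t x y"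
    by (rule nn_integral_vsrw_law_jump_kernel[OF measurable_present_indicator t V])
  finally show ?thesis by simp
qed

section \<open>Almost sure properties of the trajectories\<close>

lemma AE_holding_pos: "AE p in vsrw_law c x. \<forall>n. 0 < snd (p n)"
  unfolding AE_all_countable
proof
  fix n
  let ?g = "\<lambda>a p. indicator {..0} (snd p) :: ennreal"
  have g[measurable]: "case_prod ?g \<in> borel_measurable (borel \<Otimes>\<^sub>M pair_space)"
    by measurable
  have V: "(\<integral>\<^sup>+p. ?g a p \<partial>visit c z) = 0" for a :: real and z
  proof -
    have "(\<integral>\<^sup>+p. ?g a p \<partial>visit c z) = (\<integral>\<^sup>+s. ennreal (exponential_density (rate c z) s) * ?g a (z, s) \<partial>lborel)"
      by (rule nn_integral_visit) measurable
    also have "\<dots> = (\<integral>\<^sup>+s. 0 \<partial>(lborel :: real measure))"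
    proof (rule nn_integral_cong_AE)
      show "AE s in lborel. ennreal (exponential_density (rate c z) s) * ?g a (z, s) = 0"
        using AE_lborel_singleton[of 0]
        by eventually_elim (auto simp: exponential_density_def split: split_indicator)
    qed
    finally show ?thesis by simp
  qed
  have "(\<integral>\<^sup>+p. ?g (arrival p n) (p n) \<partial>vsrw_law c x) = 0"
  proof (cases n)
    case 0
    then show ?thesis using nn_integral_vsrw_law_0[OF g] V by simp
  next
    case (Suc m)
    then show ?thesis using nn_integral_vsrw_law_Suc[OF g] V by simp
  qed
  then have "AE p in vsrw_law c x. ?g (arrival p n) (p n) = 0"
    by (subst (asm) nn_integral_0_iff_AE) measurable
  then show "AE p in vsrw_law c x. 0 < snd (p n)"
    by eventually_elim (auto simp: not_le[symmetric] split: split_indicator_asm)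
qed

text \<open>For the absence of explosion: jumps of fixed size rule out a left limit where jump times
  accumulate.\<close>

lemma AE_nbr: "AE p in vsrw_law c x. \<forall>n. nbr (fst (p n)) (fst (p (Suc n)))"
  unfolding AE_all_countable
proof
  fix n
  let ?P = "PiM {0..<Suc (Suc n)} (\<lambda>_. pair_space :: ((int ^ 'd) \<times> real) measure)"
  let ?f = "\<lambda>p. of_bool (\<not> nbr (fst (p n)) (fst (p (Suc n)))) :: ennreal"
  have [measurable]: "(\<lambda>p. p i) \<in> measurable ?P pair_space" if "i < Suc (Suc n)" for i
    using that by (intro measurable_component_singleton) simp
  have [measurable]: "?f \<in> borel_measurable ?P"
    by measurable
  have "(\<integral>\<^sup>+p. ?f p \<partial>vsrw_law c x) = (\<integral>\<^sup>+p. ?f (restrict p {0..<Suc (Suc n)}) \<partial>vsrw_law c x)"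
    by simp
  also have "\<dots> = (\<integral>\<^sup>+p. (\<integral>\<^sup>+z. of_bool (\<not> nbr (fst (p n)) (fst z)) \<partial>(jump c (fst (p n)) \<bind> visit c)) \<partial>vsrw_law c x)"
    by (subst nn_integral_vsrw_law_step) (measurable, simp add: vsrw_step_def)
  also have "\<dots> = (\<integral>\<^sup>+p. 0 \<partial>vsrw_law c x)"
  proof (rule nn_integral_cong)
    fix p :: "nat \<Rightarrow> (int ^ 'd) \<times> real"
    let ?x = "fst (p n)"
    have "(\<integral>\<^sup>+z. of_bool (\<not> nbr ?x (fst z)) \<partial>(jump c ?x \<bind> visit c)) =
      (\<Sum>z\<in>{z. nbr ?x z}. ennreal (cond c ?x z / rate c ?x) * (\<integral>\<^sup>+q. of_bool (\<not> nbr ?x (fst q)) \<partial>visit c z))"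
      by (rule nn_integral_jump_visit) measurable
    also have "\<dots> = 0"
      by (intro sum.neutral ballI, subst nn_integral_visit) auto
    finally show "(\<integral>\<^sup>+z. of_bool (\<not> nbr ?x (fst z)) \<partial>(jump c ?x \<bind> visit c)) = (0::ennreal)" .
  qed
  finally have "(\<integral>\<^sup>+p. ?f p \<partial>vsrw_law c x) = 0" by simp
  then have "AE p in vsrw_law c x. ?f p = 0"
    by (subst (asm) nn_integral_0_iff_AE) measurable
  then show "AE p in vsrw_law c x. nbr (fst (p n)) (fst (p (Suc n)))"
    by eventually_elim simp
qed

end

lemma arrival_mono:
  assumes "\<And>n. 0 \<le> snd (p n)" "m \<le> n"
  shows "arrival p m \<le> arrival p n"
  unfolding arrival_def using assms by (intro sum_mono2) auto

text \<open>Nonnegative holding times make the half-open intervals between consecutive arrivals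
  disjoint, so the \<open>LEAST\<close> in \<open>vsrw_at\<close> picks the only candidate.\<close>

lemma vsrw_at_eq_Some_iff:
  assumes nonneg: "\<And>n. 0 \<le> snd (p n)"
  shows "vsrw_at t p = Some y \<longleftrightarrow> (\<exists>n. arrival p n \<le> t \<and> t < arrival p (Suc n) \<and> fst (p n) = y)"
proof -
  have u: "m = n" if "arrival p n \<le> t \<and> t < arrival p (Suc n)" "arrival p m \<le> t \<and> t < arrival p (Suc m)" for m n
    using arrival_mono[of p "Suc n" m] arrival_mono[of p "Suc m" n] nonneg that
    by (metis Suc_leI linorder_neqE_nat not_le order.trans)
  have "(LEAST n. arrival p n \<le> t \<and> t < arrival p (Suc n)) = n" if "arrival p n \<le> t \<and> t < arrival p (Suc n)" for n
    using that by (rule Least_equality) (use u[OF that] in auto)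
  then show ?thesis unfolding vsrw_at_def by auto
qed

context positive_conductances
begin

lemma measurable_vsrw_at[measurable]: "vsrw_at t \<in> measurable (vsrw_law c x) (count_space UNIV)"
proof -
  have m: "(\<lambda>p. fst (p (LEAST n. arrival p n \<le> t \<and> t < arrival p (Suc n)))) \<in>
      measurable (vsrw_law c x) (count_space UNIV)"
    by (rule measurable_compose_countable) measurable
  note m[measurable]
  show ?thesis unfolding vsrw_at_def[abs_def] by measurable
qed

lemma emeasure_vsrw_at:
  assumes t: "0 \<le> t"
  shows "emeasure (vsrw_law c x) {p. vsrw_at t p = Some y} = heat c t x y"
proof -
  let ?A = "\<lambda>n. {p. arrival p n \<le> t \<and> t < arrival p (Suc n) \<and> fst (p n) = y}"
  have A[measurable]: "?A n \<in> sets (vsrw_law c x)" for n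
  proof -
    have "{p \<in> space (vsrw_law c x). arrival p n \<le> t \<and> t < arrival p (Suc n) \<and> fst (p n) = y} \<in> sets (vsrw_law c x)"
      by measurable
    then show ?thesis by simp
  qed
  have [measurable]: "{p. vsrw_at t p = Some y} \<in> sets (vsrw_law c x)"
  proof -
    have "{p \<in> space (vsrw_law c x). vsrw_at t p = Some y} \<in> sets (vsrw_law c x)"
      by measurable
    then show ?thesis by simp
  qed
  have "emeasure (vsrw_law c x) {p. vsrw_at t p = Some y} = (\<integral>\<^sup>+p. indicator {p. vsrw_at t p = Some y} p \<partial>vsrw_law c x)"
    by (rule nn_integral_indicator[symmetric]) measurable
  also have "\<dots> = (\<integral>\<^sup>+p. (\<Sum>n. indicator (?A n) p) \<partial>vsrw_law c x)"
  proof (rule nn_integral_cong_AE)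
    show "AE p in vsrw_law c x. indicator {p. vsrw_at t p = Some y} p = (\<Sum>n. indicator (?A n) p :: ennreal)"
      using AE_holding_pos
    proof eventually_elim
      fix p :: "nat \<Rightarrow> (int ^ 'd) \<times> real" assume "\<forall>n. 0 < snd (p n)"
      then have nonneg: "\<forall>n. 0 \<le> snd (p n)" by (simp add: less_imp_le)
      \<comment> \<open>Intersecting with \<open>{p}\<close> localises to one trajectory with
        positive holding times; the events themselves are disjoint in \<open>n\<close> only off a
        null set.\<close>
      have U: "{p. vsrw_at t p = Some y} \<inter> {p} = (\<Union>n. ?A n \<inter> {p})"
        using vsrw_at_eq_Some_iff[of p t y] nonneg by auto
      have D: "disjoint_family (\<lambda>n. ?A n \<inter> {p})"
        unfolding disjoint_family_on_def
      proof (intro ballI impI)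
        fix m n :: nat assume "m \<noteq> n"
        then show "?A m \<inter> {p} \<inter> (?A n \<inter> {p}) = {}"
          using arrival_mono[of p "Suc n" m] arrival_mono[of p "Suc m" n] nonneg
          by (cases "m < n") auto
      qed
      have "(\<Sum>n. indicator (?A n \<inter> {p}) p) = (indicator (\<Union>n. ?A n \<inter> {p}) p :: ennreal)"
        by (rule suminf_indicator[OF D])
      then show "indicator {p. vsrw_at t p = Some y} p = (\<Sum>n. indicator (?A n) p :: ennreal)"
        unfolding U[symmetric] by (simp add: indicator_inter_arith)
    qed
  qed
  also have "\<dots> = (\<Sum>n. emeasure (vsrw_law c x) (?A n))"
    by (subst nn_integral_suminf) (measurable, simp only: nn_integral_indicator[OF A])
  finally show ?thesis by (simp only: emeasure_jump_kernel[OF t] heat_def)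
qed

lemma hk_eq_heat: "0 \<le> t \<Longrightarrow> hk c t x y = enn2real (heat c t x y)"
  unfolding hk_def using emeasure_vsrw_at[of t x y] by (simp add: measure_def)

lemma heat_le_1: "0 \<le> t \<Longrightarrow> heat c t x y \<le> 1"
  using prob_space.measure_le_1[OF prob_space_vsrw_law, of x "{p. vsrw_at t p = Some y}"]
  by (simp add: emeasure_vsrw_at)

lemma ennreal_hk: "0 \<le> t \<Longrightarrow> ennreal (hk c t x y) = heat c t x y"
  using heat_le_1[of t x y] by (simp add: hk_eq_heat ennreal_enn2real_if) (metis ennreal_one_less_top not_le)

text \<open>The cemetery contributes 0, so for \<open>f = 1\<close> the total mass of the kernel is
  the probability that the walk is alive at \<open>t\<close>.\<close>

lemma nn_integral_heat:
  assumes "0 \<le> t"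
  shows "(\<integral>\<^sup>+y. f y * heat c t x y \<partial>count_space UNIV) = 
     (\<integral>\<^sup>+p. (case vsrw_at t p of None \<Rightarrow> 0 | Some y \<Rightarrow> f y) \<partial>vsrw_law c x)"
proof -
  have "(\<integral>\<^sup>+p. (case vsrw_at t p of None \<Rightarrow> 0 | Some y \<Rightarrow> f y) \<partial>vsrw_law c x) =
     (\<integral>\<^sup>+p. (\<integral>\<^sup>+y. f y * indicator {p. vsrw_at t p = Some y} p \<partial>count_space UNIV) \<partial>vsrw_law c x)"
  proof (rule nn_integral_cong)
    fix p :: "nat \<Rightarrow> (int ^ 'd) \<times> real"
    show "(case vsrw_at t p of None \<Rightarrow> 0 | Some y \<Rightarrow> f y) =
       (\<integral>\<^sup>+y. f y * indicator {p. vsrw_at t p = Some y} p \<partial>count_space UNIV)"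
    proof (cases "vsrw_at t p")
      case (Some z)
      have "(\<integral>\<^sup>+y. f y * indicator {p. vsrw_at t p = Some y} p \<partial>count_space UNIV) =
         (\<integral>\<^sup>+y. f z * indicator {z} y \<partial>count_space UNIV)"
        using Some by (intro nn_integral_cong) (auto split: split_indicator)
      then show ?thesis using Some by (simp add: nn_integral_cmult_indicator)
    qed simp
  qed
  also have "\<dots> = (\<integral>\<^sup>+y. (\<integral>\<^sup>+p. f y * indicator {p. vsrw_at t p = Some y} p \<partial>vsrw_law c x) \<partial>count_space UNIV)"
  proof (rule nn_integral_count_space_nn_integral)
    fix y
    have "{p \<in> space (vsrw_law c x). vsrw_at t p = Some y} \<in> sets (vsrw_law c x)"
      by measurable
    then show "(\<lambda>p. f y * indicator {p. vsrw_at t p = Some y} p) \<in> borel_measurable (vsrw_law c x)"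
      by simp
  qed simp
  also have "\<dots> = (\<integral>\<^sup>+y. f y * heat c t x y \<partial>count_space UNIV)"
  proof (rule nn_integral_cong)
    fix y
    have "{p \<in> space (vsrw_law c x). vsrw_at t p = Some y} \<in> sets (vsrw_law c x)"
      by measurable
    then show "(\<integral>\<^sup>+p. f y * indicator {p. vsrw_at t p = Some y} p \<partial>vsrw_law c x) = f y * heat c t x y"
      using emeasure_vsrw_at[OF assms, of x y] by (simp add: nn_integral_cmult_indicator)
  qed
  finally show ?thesis ..
qed

end

section \<open>Conservativeness and energy estimates\<close>

text \<open>Without a position at \<open>t\<close> all arrivals stay at or below \<open>t\<close>,
  hence increase to a finite \<zeta>. The positions at these arrivals form a sequence with steps of
  length 1, which cannot converge, so there is no left limit at \<zeta>.\<close>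

lemma cadlag_imp_no_explosion:
  fixes p :: "nat \<Rightarrow> (int ^ 'd::finite) \<times> real"
  assumes hold: "\<And>n. 0 < snd (p n)"
    and nbr: "\<And>n. nbr (fst (p n)) (fst (p (Suc n)))"
    and cadlag: "(\<lambda>t. scaled_vsrw 1 t p) \<in> cadlag"
    and "0 \<le> t"
  shows "vsrw_at t p \<noteq> None"
proof
  assume None: "vsrw_at t p = None"
  define \<zeta> where "\<zeta> = (SUP n. arrival p n)"
  have Suc: "arrival p (Suc n) = arrival p n + snd (p n)" for n
    by (simp add: arrival_def)
  have le: "arrival p n \<le> t" for n
  proof (induction n)
    case 0
    show ?case using \<open>0 \<le> t\<close> by (simp add: arrival_def)
  next
    case (Suc n)
    show ?case
    proof (rule ccontr)
      assume "\<not> arrival p (Suc n) \<le> t"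
      then have "\<exists>n. arrival p n \<le> t \<and> t < arrival p (Suc n)"
        using Suc by (intro exI[of _ n]) simp
      then show False using None unfolding vsrw_at_def by simp
    qed
  qed
  have inc: "incseq (arrival p)"
    by (rule incseq_SucI) (use Suc hold in \<open>simp add: less_imp_le\<close>)
  have bdd: "bdd_above (range (arrival p))"
    using le by (intro bdd_aboveI[of _ t]) auto
  have lim: "arrival p \<longlonglongrightarrow> \<zeta>"
    unfolding \<zeta>_def by (rule LIMSEQ_incseq_SUP[OF bdd inc])
  have lt: "arrival p n < \<zeta>" for n
  proof -
    have "arrival p n < arrival p (Suc n)" using hold[of n] Suc by simp
    also have "\<dots> \<le> \<zeta>" unfolding \<zeta>_def by (rule cSUP_upper[OF _ bdd]) simp
    finally show ?thesis .
  qed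
  have pos: "0 < \<zeta>" using lt[of 0] by (simp add: arrival_def)
  have at: "scaled_vsrw 1 (arrival p n) p = emb (fst (p n))" for n
  proof -
    have "vsrw_at (arrival p n) p = Some (fst (p n))"
      using vsrw_at_eq_Some_iff[of p "arrival p n" "fst (p n)"] hold Suc[of n]
      by (metis less_add_same_cancel1 less_imp_le order_refl)
    then show ?thesis by (simp add: scaled_vsrw_def)
  qed
  obtain l where "((\<lambda>t. scaled_vsrw 1 t p) \<longlongrightarrow> l) (at_left \<zeta>)"
    using cadlag pos unfolding cadlag_def mem_Collect_eq by (meson less_imp_le)
  moreover have "filterlim (arrival p) (at_left \<zeta>) sequentially"
    using lim by (simp add: filterlim_at less_imp_neq[OF lt] lt)
  ultimately have l: "(\<lambda>n. emb (fst (p n))) \<longlonglongrightarrow> l"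
    using filterlim_compose[of "\<lambda>t. scaled_vsrw 1 t p" "nhds l" "at_left \<zeta>" "arrival p" sequentially]
    by (simp add: at)
  have "(\<lambda>n. norm (emb (fst (p n)) - emb (fst (p (Suc n))))) \<longlonglongrightarrow> norm (l - l)"
    by (intro tendsto_intros l LIMSEQ_Suc)
  moreover have "norm (emb (fst (p n)) - emb (fst (p (Suc n)))) = 1" for n
    using nbr[of n] by (simp add: nbr_def ldist_def)
  ultimately show False
    by (simp add: LIMSEQ_const_iff)
qed

context positive_conductances
begin

lemma AE_no_explosion:
  assumes "AE p in vsrw_law c x. (\<lambda>t. scaled_vsrw 1 t p) \<in> cadlag"
  shows "AE p in vsrw_law c x. \<forall>t\<ge>0. vsrw_at t p \<noteq> None"
  using assms AE_holding_pos AE_nbr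
proof eventually_elim
  case (elim p)
  show ?case
  proof (intro allI impI)
    fix t :: real assume "0 \<le> t"
    show "vsrw_at t p \<noteq> None"
      by (rule cadlag_imp_no_explosion) (use elim \<open>0 \<le> t\<close> in blast)+
  qed
qed

lemma nn_integral_heat_eq_1:
  assumes "AE p in vsrw_law c x. (\<lambda>t. scaled_vsrw 1 t p) \<in> cadlag" "0 \<le> t"
  shows "(\<integral>\<^sup>+y. heat c t x y \<partial>count_space UNIV) = 1"
proof -
  interpret prob_space "vsrw_law c x" by (rule prob_space_vsrw_law)
  have "(\<integral>\<^sup>+y. heat c t x y \<partial>count_space UNIV) =
      (\<integral>\<^sup>+p. (case vsrw_at t p of None \<Rightarrow> 0 | Some y \<Rightarrow> 1) \<partial>vsrw_law c x)"
    using nn_integral_heat[OF assms(2), of "\<lambda>_. 1"] by simp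
  also have "\<dots> = (\<integral>\<^sup>+p. 1 \<partial>vsrw_law c x)"
    using AE_no_explosion[OF assms(1)] assms(2)
    by (intro nn_integral_cong_AE) (auto split: option.split)
  finally show ?thesis using emeasure_space_1 by simp
qed

lemma nn_integral_heat_le_1:
  assumes "0 \<le> t"
  shows "(\<integral>\<^sup>+y. heat c t x y \<partial>count_space UNIV) \<le> 1"
proof -
  interpret prob_space "vsrw_law c x" by (rule prob_space_vsrw_law)
  have "(\<integral>\<^sup>+y. heat c t x y \<partial>count_space UNIV) =
      (\<integral>\<^sup>+p. (case vsrw_at t p of None \<Rightarrow> 0 | Some y \<Rightarrow> 1) \<partial>vsrw_law c x)"
    using nn_integral_heat[OF assms, of "\<lambda>_. 1"] by simp
  also have "\<dots> \<le> (\<integral>\<^sup>+p. 1 \<partial>vsrw_law c x)"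
    by (intro nn_integral_mono) (auto split: option.split)
  finally show ?thesis using emeasure_space_1 by simp
qed

text \<open>Chapman--Kolmogorov writes the mass 1 from \<open>x\<close> as an average of the masses
  from the sites \<open>w\<close>, with weights \<open>heat c s x w\<close> of total 1. Each of
  these masses is at most 1, so a site of positive weight has mass exactly 1. Cadlag paths are given
  from one starting point only; the other sites are reached in this way.\<close>

lemma nn_integral_heat_eq_1_transfer:
  assumes mass: "\<And>t. 0 \<le> t \<Longrightarrow> (\<integral>\<^sup>+y. heat c t x y \<partial>count_space UNIV) = 1"
    and "0 \<le> s" "0 \<le> t" and pos: "heat c s x z \<noteq> 0"
  shows "(\<integral>\<^sup>+y. heat c t z y \<partial>count_space UNIV) = 1"
proof -
  let ?m = "\<lambda>w. \<integral>\<^sup>+y. heat c t w y \<partial>count_space UNIV"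
  have m: "?m w \<le> 1" for w by (rule nn_integral_heat_le_1[OF \<open>0 \<le> t\<close>])
  have "1 = (\<integral>\<^sup>+y. heat c (s + t) x y \<partial>count_space UNIV)"
    using assms by simp
  also have "\<dots> = (\<integral>\<^sup>+y. (\<integral>\<^sup>+w. heat c s x w * heat c t w y \<partial>count_space UNIV) \<partial>count_space UNIV)"
    using assms by (simp add: heat_Chapman_Kolmogorov)
  also have "\<dots> = (\<integral>\<^sup>+w. (\<integral>\<^sup>+y. heat c s x w * heat c t w y \<partial>count_space UNIV) \<partial>count_space UNIV)"
    by (rule nn_integral_count_space_nn_integral) auto
  also have "\<dots> = (\<integral>\<^sup>+w. heat c s x w * ?m w \<partial>count_space UNIV)"
    by (simp add: nn_integral_cmult)
  finally have 1: "(\<integral>\<^sup>+w. heat c s x w * ?m w \<partial>count_space UNIV) = 1" ..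
  have "1 = (\<integral>\<^sup>+w. heat c s x w * ?m w + heat c s x w * (1 - ?m w) \<partial>count_space UNIV)"
    using m mass[OF \<open>0 \<le> s\<close>] by (simp add: distrib_left[symmetric] add_diff_inverse_ennreal)
  also have "\<dots> = 1 + (\<integral>\<^sup>+w. heat c s x w * (1 - ?m w) \<partial>count_space UNIV)"
    by (simp add: nn_integral_add 1)
  finally have "(\<integral>\<^sup>+w. heat c s x w * (1 - ?m w) \<partial>count_space UNIV) = 0"
    using ennreal_add_left_cancel[of 1 0 "\<integral>\<^sup>+w. heat c s x w * (1 - ?m w) \<partial>count_space UNIV"] by simp
  then have "heat c s x z * (1 - ?m z) = 0"
    by (simp add: nn_integral_0_iff_AE AE_count_space)
  then have "1 - ?m z = 0" using pos by simp
  then show ?thesis using m[of z] by (simp add: diff_eq_0_iff_ennreal antisym)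
qed

end

section \<open>Discrete energy and decay of the return probability\<close>

locale conservative_walk = positive_conductances c
  for c :: "'d::finite conf" +
  assumes mass: "0 \<le> t \<Longrightarrow> (\<integral>\<^sup>+y. heat c t x y \<partial>count_space UNIV) = 1"
begin

lemma hk_nonneg: "0 \<le> hk c t x y"
  by (simp add: hk_def)

lemma nn_integral_heat_square:
  "0 \<le> t \<Longrightarrow> (\<integral>\<^sup>+x. (heat c t a x)\<^sup>2 \<partial>count_space UNIV) = heat c (2 * t) a a"
  using heat_Chapman_Kolmogorov[of t t c a a]
  by (simp add: power2_eq_square heat_sym[of c t _ a])

text \<open>After expanding the square, mass one and symmetry turn each of the two square terms into
  the return probability at \<open>2 * t\<close>; the mixed term is a threefold convolution and
  gives the one at \<open>2 * t + h\<close>. This replaces the time derivative of the return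
  probability. It is stated as a sum because subtraction in \<open>ennreal\<close>
  truncates.\<close>

lemma energy_identity:
  assumes t: "0 \<le> t" and h: "0 \<le> h"
  shows "(\<integral>\<^sup>+x. \<integral>\<^sup>+y. heat c h x y * ennreal ((hk c t a x - hk c t a y)\<^sup>2) \<partial>count_space UNIV \<partial>count_space UNIV)
      + 2 * heat c (2 * t + h) a a = 2 * heat c (2 * t) a a"
proof -
  let ?C = "count_space UNIV :: (int ^ 'd) measure"
  let ?E = "\<lambda>x y. ennreal ((hk c t a x - hk c t a y)\<^sup>2)"
  have e: "?E x y + 2 * (heat c t a x * heat c t a y) = (heat c t a x)\<^sup>2 + (heat c t a y)\<^sup>2" for x y
  proof -
    have "(hk c t a x - hk c t a y)\<^sup>2 + 2 * (hk c t a x * hk c t a y) = (hk c t a x)\<^sup>2 + (hk c t a y)\<^sup>2"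
      by (simp add: power2_eq_square algebra_simps)
    then have "?E x y + ennreal (2 * (hk c t a x * hk c t a y)) = ennreal ((hk c t a x)\<^sup>2) + ennreal ((hk c t a y)\<^sup>2)"
      by (simp add: ennreal_plus[symmetric] hk_nonneg del: ennreal_plus)
    then show ?thesis
      by (simp add: ennreal_mult hk_nonneg ennreal_hk[OF t] ennreal_power[symmetric])
  qed
  have 1: "(\<integral>\<^sup>+x. \<integral>\<^sup>+y. heat c h x y * (heat c t a x)\<^sup>2 \<partial>?C \<partial>?C) = heat c (2 * t) a a"
    using h t by (simp add: nn_integral_multc mass nn_integral_heat_square)
  have "(\<integral>\<^sup>+x. \<integral>\<^sup>+y. heat c h x y * (heat c t a y)\<^sup>2 \<partial>?C \<partial>?C) =
      (\<integral>\<^sup>+y. \<integral>\<^sup>+x. heat c h x y * (heat c t a y)\<^sup>2 \<partial>?C \<partial>?C)"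
    by (rule nn_integral_count_space_nn_integral) auto
  also have "\<dots> = heat c (2 * t) a a"
    using 1 by (simp add: heat_sym[of c h])
  finally have 2: "(\<integral>\<^sup>+x. \<integral>\<^sup>+y. heat c h x y * (heat c t a y)\<^sup>2 \<partial>?C \<partial>?C) = heat c (2 * t) a a" .
  have "(\<integral>\<^sup>+x. \<integral>\<^sup>+y. heat c h x y * (heat c t a x * heat c t a y) \<partial>?C \<partial>?C) =
     (\<integral>\<^sup>+x. heat c t a x * (\<integral>\<^sup>+y. heat c h x y * heat c t y a \<partial>?C) \<partial>?C)"
    by (simp add: nn_integral_cmult[symmetric] mult_ac heat_sym[of c t _ a])
  also have "\<dots> = heat c (t + (h + t)) a a"
    using h t by (simp only: heat_Chapman_Kolmogorov[of h t c _ a, symmetric]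
        heat_Chapman_Kolmogorov[of t "h + t" c a a] add_nonneg_nonneg)
  finally have 3: "(\<integral>\<^sup>+x. \<integral>\<^sup>+y. heat c h x y * (heat c t a x * heat c t a y) \<partial>?C \<partial>?C) = heat c (2 * t + h) a a"
    by (simp add: algebra_simps)
  have "(\<integral>\<^sup>+x. \<integral>\<^sup>+y. heat c h x y * ?E x y \<partial>?C \<partial>?C) + 2 * heat c (2 * t + h) a a =
     (\<integral>\<^sup>+x. \<integral>\<^sup>+y. heat c h x y * ?E x y + 2 * (heat c h x y * (heat c t a x * heat c t a y)) \<partial>?C \<partial>?C)"
    by (simp add: 3[symmetric] nn_integral_add nn_integral_cmult)
  also have "\<dots> = (\<integral>\<^sup>+x. \<integral>\<^sup>+y. heat c h x y * (heat c t a x)\<^sup>2 + heat c h x y * (heat c t a y)\<^sup>2 \<partial>?C \<partial>?C)"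
  proof (intro nn_integral_cong)
    fix x y
    have "heat c h x y * ?E x y + 2 * (heat c h x y * (heat c t a x * heat c t a y)) =
        heat c h x y * (?E x y + 2 * (heat c t a x * heat c t a y))"
      by (simp add: distrib_left mult_ac)
    then show "heat c h x y * ?E x y + 2 * (heat c h x y * (heat c t a x * heat c t a y)) =
        heat c h x y * (heat c t a x)\<^sup>2 + heat c h x y * (heat c t a y)\<^sup>2"
      unfolding e by (simp only: distrib_left)
  qed
  also have "\<dots> = 2 * heat c (2 * t) a a"
    by (simp add: nn_integral_add 1 2 flip: mult_2)
  finally show ?thesis .
qed

text \<open>The energy of the kernel at time \<open>s / 2\<close>, with increment
  \<open>t - s\<close>, is nonnegative.\<close>

lemma hk_diag_antimono:
  assumes "0 \<le> s" "s \<le> t"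
  shows "hk c t a a \<le> hk c s a a"
proof -
  have "2 * heat c t a a \<le> 2 * heat c s a a"
  proof -
    have "2 * heat c s a a = (\<integral>\<^sup>+x. \<integral>\<^sup>+y. heat c (t - s) x y * ennreal ((hk c (s / 2) a x - hk c (s / 2) a y)\<^sup>2)
        \<partial>count_space UNIV \<partial>count_space UNIV) + 2 * heat c t a a"
      using energy_identity[of "s / 2" "t - s" a] assms by simp
    then show ?thesis by (simp only: add_increasing zero_le order_refl)
  qed
  then have "ennreal (2 * hk c t a a) \<le> ennreal (2 * hk c s a a)"
    using assms by (simp add: ennreal_mult hk_nonneg ennreal_hk)
  then show ?thesis by (simp add: hk_nonneg)
qed

text \<open>The return probability at \<open>u + v\<close> is the inner product of the kernels at
  \<open>u\<close> and at \<open>v\<close>, so \<open>2ab \<le> a^2 + b^2\<close> applies site by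
  site.\<close>

lemma hk_diag_midpoint_convex:
  assumes "0 \<le> u" "0 \<le> v"
  shows "2 * hk c (u + v) a a \<le> hk c (2 * u) a a + hk c (2 * v) a a"
proof -
  have "2 * heat c (u + v) a a = (\<integral>\<^sup>+x. 2 * heat c u a x * heat c v a x \<partial>count_space UNIV)"
    using assms by (simp add: heat_Chapman_Kolmogorov nn_integral_cmult mult.assoc heat_sym[of c v _ a])
  also have "\<dots> \<le> (\<integral>\<^sup>+x. (heat c u a x)\<^sup>2 + (heat c v a x)\<^sup>2 \<partial>count_space UNIV)"
    by (intro nn_integral_mono sum_of_squares_ge_ennreal)
  also have "\<dots> = heat c (2 * u) a a + heat c (2 * v) a a"
    using assms by (simp add: nn_integral_add nn_integral_heat_square)
  finally have "ennreal (2 * hk c (u + v) a a) \<le> ennreal (hk c (2 * u) a a + hk c (2 * v) a a)"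
    using assms by (simp add: ennreal_mult hk_nonneg ennreal_hk)
  then show ?thesis by (simp add: ennreal_plus[symmetric] hk_nonneg del: ennreal_plus)
qed

text \<open>On a grid of mesh \<open>t / K\<close> the decrements are monotone by midpoint convexity, so the last one is at
  most the average of \<open>K\<close> of them.\<close>

lemma hk_diag_decrement:
  assumes t: "0 < t" and K: "0 < (K::nat)"
  shows "hk c (2 * t) a a - hk c (2 * t + t / real K) a a \<le> hk c t a a / real K"
proof -
  define h where "h = t / real K"
  define \<alpha> where "\<alpha> = (\<lambda>r. hk c r a a)"
  define D where "D k = \<alpha> (2 * t - real k * h) - \<alpha> (2 * t - real k * h + h)" for k
  have h: "0 < h" "real K * h = t" using t K by (auto simp: h_def)
  have kh: "real k * h \<le> t" if "k \<le> K" for k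
  proof -
    have "real k * h \<le> real K * h" using that h by (intro mult_right_mono) auto
    then show ?thesis using h by simp
  qed
  have step: "D k \<le> D (Suc k)" if "Suc k \<le> K" for k
  proof -
    let ?r = "2 * t - real k * h"
    have "2 * \<alpha> ((?r - h) / 2 + (?r + h) / 2) \<le> \<alpha> (2 * ((?r - h) / 2)) + \<alpha> (2 * ((?r + h) / 2))"
      unfolding \<alpha>_def using kh[OF that] t h(1) kh[of k] that
      by (intro hk_diag_midpoint_convex) (auto simp: ring_distribs)
    moreover have "(?r - h) / 2 + (?r + h) / 2 = ?r" "2 * ((?r - h) / 2) = ?r - h" "2 * ((?r + h) / 2) = ?r + h"
      by (simp_all add: field_simps)
    ultimately have "2 * \<alpha> ?r \<le> \<alpha> (?r - h) + \<alpha> (?r + h)" by (simp only:)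
    moreover have e: "2 * t - real (Suc k) * h = ?r - h"
      by (simp add: algebra_simps)
    ultimately show ?thesis unfolding D_def e diff_add_cancel by linarith
  qed
  have D0: "D 0 \<le> D k" if "k \<le> K" for k
    using that
  proof (induction k)
    case (Suc k)
    then show ?case using step[of k] by simp
  qed simp
  have tel: "(\<Sum>k<m. D k) = \<alpha> (2 * t - real m * h + h) - \<alpha> (2 * t + h)" for m
    by (induction m) (auto simp: D_def algebra_simps)
  have "real K * D 0 = (\<Sum>k<K. D 0)" by simp
  also have "\<dots> \<le> (\<Sum>k<K. D k)" by (intro sum_mono D0) auto
  also have "\<dots> \<le> \<alpha> (2 * t - real K * h + h)"
    unfolding tel by (simp add: \<alpha>_def hk_nonneg)
  also have "\<dots> \<le> \<alpha> t"
    unfolding \<alpha>_def using h t by (intro hk_diag_antimono) auto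
  finally have "D 0 \<le> \<alpha> t / real K" using K by (simp add: field_simps)
  then show ?thesis by (simp add: D_def \<alpha>_def h_def)
qed

end

locale elliptic_walk = conservative_walk c
  for c :: "'d::finite conf" +
  assumes elliptic: "e \<in> edges \<Longrightarrow> 1 \<le> c e"
begin

lemma cond_ge_1: "nbr x y \<Longrightarrow> 1 \<le> cond c x y"
  using elliptic[of "{x, y}"] unfolding edges_def cond_def by auto

text \<open>The energy identity is used with \<open>h = t / Suc K\<close>. Of the double sum only
  the pairs \<open>(z, z + e)\<close> are kept; by \<open>heat_lower\<close> and ellipticity their
  weight is at least \<open>h\<close> times \<open>?w K z\<close>. The difference of return
  probabilities is of order \<open>h\<close> by \<open>hk_diag_decrement\<close>, so
  \<open>h\<close> cancels. As \<open>K\<close> grows the factors \<open>?w K z\<close> tend to 1 at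
  each \<open>z\<close>, but not uniformly, since the rates have no common upper bound; hence
  Fatou.\<close>

lemma gradient_bound:
  assumes t: "0 < t" and e: "\<And>z. nbr z (z + e)"
  shows "(\<integral>\<^sup>+z. ennreal ((hk c t a (z + e) - hk c t a z)\<^sup>2) \<partial>count_space UNIV) \<le> ennreal (2 * hk c t a a / t)"
proof -
  let ?C = "count_space UNIV :: (int ^ 'd) measure"
  let ?f = "\<lambda>z. (hk c t a z - hk c t a (z + e))\<^sup>2"
  let ?w = "\<lambda>K z. exp (- ((rate c z + rate c (z + e)) * (t / real (Suc K))))"
  have K: "(\<integral>\<^sup>+z. ennreal (?w K z * ?f z) \<partial>?C) \<le> ennreal (2 * hk c t a a / t)" for K
  proof -
    define h where "h = t / real (Suc K)"
    have h: "0 < h" and hw: "?w K z = exp (- ((rate c z + rate c (z + e)) * h))" for z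
      using t by (auto simp: h_def)
    have "ennreal h * (\<integral>\<^sup>+z. ennreal (?w K z * ?f z) \<partial>?C) = (\<integral>\<^sup>+z. ennreal (h * ?w K z) * ennreal (?f z) \<partial>?C)"
      unfolding hw using h by (simp add: nn_integral_cmult[symmetric] ennreal_mult mult.assoc)
    also have "\<dots> \<le> (\<integral>\<^sup>+x. \<integral>\<^sup>+y. heat c h x y * ennreal ((hk c t a x - hk c t a y)\<^sup>2) \<partial>?C \<partial>?C)"
    proof (rule nn_integral_mono)
      fix z
      have "ennreal (h * ?w K z) \<le> ennreal (h * (cond c z (z + e) * ?w K z))"
        using h cond_ge_1[OF e, of z] by (intro ennreal_leI mult_left_mono) auto
      also have "\<dots> \<le> heat c h z (z + e)"
        unfolding hw by (rule heat_lower[OF e]) (use h in simp)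
      finally have "ennreal (h * ?w K z) * ennreal (?f z) \<le> heat c h z (z + e) * ennreal (?f z)"
        by (rule mult_right_mono) simp
      also have "\<dots> \<le> (\<integral>\<^sup>+y. heat c h z y * ennreal ((hk c t a z - hk c t a y)\<^sup>2) \<partial>?C)"
        by (rule nn_integral_ge_point) simp
      finally show "ennreal (h * ?w K z) * ennreal (?f z) \<le>
        (\<integral>\<^sup>+y. heat c h z y * ennreal ((hk c t a z - hk c t a y)\<^sup>2) \<partial>?C)" .
    qed
    also have "\<dots> \<le> ennreal (2 * (hk c t a a / real (Suc K)))"
    proof -
      let ?L = "\<integral>\<^sup>+x. \<integral>\<^sup>+y. heat c h x y * ennreal ((hk c t a x - hk c t a y)\<^sup>2) \<partial>?C \<partial>?C"
      have L: "?L + ennreal (2 * hk c (2 * t + h) a a) = ennreal (2 * hk c (2 * t) a a)"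
        using energy_identity[of t h a] t h by (simp add: ennreal_mult hk_nonneg ennreal_hk)
      then obtain l where l: "?L = ennreal l" "0 \<le> l"
        by (cases ?L) auto
      from L l have "ennreal (l + 2 * hk c (2 * t + h) a a) = ennreal (2 * hk c (2 * t) a a)"
        by (subst ennreal_plus) (auto simp: hk_nonneg)
      then have "l + 2 * hk c (2 * t + h) a a = 2 * hk c (2 * t) a a"
        by (rule ennreal_inj[THEN iffD1, rotated 2]) (use l(2) in \<open>auto simp: hk_nonneg\<close>)
      then have "l \<le> 2 * (hk c t a a / real (Suc K))"
        using hk_diag_decrement[OF t, of "Suc K" a] unfolding h_def by simp
      then show ?thesis unfolding l(1) by (rule ennreal_leI)
    qed
    also have "\<dots> = ennreal h * ennreal (2 * hk c t a a / t)"
    proof -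
      have "2 * (hk c t a a / real (Suc K)) = h * (2 * hk c t a a / t)"
        using t by (simp add: h_def)
      then show ?thesis using t h hk_nonneg by (simp only: ennreal_mult divide_nonneg_pos mult_nonneg_nonneg zero_le_numeral less_imp_le)
    qed
    finally show ?thesis
      using h by (subst (asm) ennreal_mult_le_mult_iff) (auto simp: ennreal_eq_0_iff)
  qed
  have lim: "liminf (\<lambda>K. ennreal (?w K z * ?f z)) = ennreal (?f z)" for z
  proof (rule lim_imp_Liminf)
    have "(\<lambda>K. t / real (Suc K)) \<longlonglongrightarrow> 0"
      using LIMSEQ_Suc[OF lim_const_over_n[of t]] by simp
    then have "(\<lambda>K. ?w K z * ?f z) \<longlonglongrightarrow> exp (- ((rate c z + rate c (z + e)) * 0)) * ?f z"
      by (intro tendsto_intros)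
    then show "(\<lambda>K. ennreal (?w K z * ?f z)) \<longlonglongrightarrow> ennreal (?f z)"
      by (intro tendsto_ennrealI) simp
  qed simp
  have "(\<integral>\<^sup>+z. ennreal ((hk c t a (z + e) - hk c t a z)\<^sup>2) \<partial>?C) = (\<integral>\<^sup>+z. liminf (\<lambda>K. ennreal (?w K z * ?f z)) \<partial>?C)"
    unfolding lim by (simp add: power2_commute)
  also have "\<dots> \<le> liminf (\<lambda>K. \<integral>\<^sup>+z. ennreal (?w K z * ?f z) \<partial>?C)"
    by (rule nn_integral_liminf) simp
  also have "\<dots> \<le> ennreal (2 * hk c t a a / t)"
  proof -
    have "liminf (\<lambda>K. \<integral>\<^sup>+z. ennreal (?w K z * ?f z) \<partial>?C) \<le> liminf (\<lambda>K::nat. ennreal (2 * hk c t a a / t))"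
      by (intro Liminf_mono always_eventually allI K)
    then show ?thesis by (simp add: Liminf_const)
  qed
  finally show ?thesis .
qed

end

section \<open>Shifts and sums on the lattice\<close>

text \<open>Cauchy--Schwarz and Minkowski are used through \<open>L2_set\<close> on finite sets;
  this passes to the whole lattice.\<close>

lemma nn_integral_count_space_le_finite:
  fixes f :: "'a::countable \<Rightarrow> ennreal"
  assumes "\<And>A. finite A \<Longrightarrow> (\<Sum>x\<in>A. f x) \<le> B"
  shows "(\<integral>\<^sup>+x. f x \<partial>count_space UNIV) \<le> B"
proof -
  define A where "A n = {x::'a. to_nat x < n}" for n
  have fin: "finite (A n)" for n
  proof (rule finite_imageD)
    show "finite (to_nat ` A n)" by (rule finite_subset[of _ "{..<n}"]) (auto simp: A_def)
  qed auto
  have sup: "(SUP n. f x * indicator (A n) x) = f x" for x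
  proof (rule antisym)
    show "(SUP n. f x * indicator (A n) x) \<le> f x"
      by (intro SUP_least) (auto split: split_indicator)
    have "f x = f x * indicator (A (Suc (to_nat x))) x" by (simp add: A_def)
    also have "\<dots> \<le> (SUP n. f x * indicator (A n) x)" by (rule SUP_upper) simp
    finally show "f x \<le> (SUP n. f x * indicator (A n) x)" .
  qed
  have inc: "incseq (\<lambda>n x. f x * indicator (A n) x)"
    by (auto simp: incseq_def le_fun_def A_def split: split_indicator)
  have "(\<integral>\<^sup>+x. f x \<partial>count_space UNIV) = (SUP n. \<integral>\<^sup>+x. f x * indicator (A n) x \<partial>count_space UNIV)"
    using nn_integral_monotone_convergence_SUP[OF inc, of "count_space UNIV"] by (simp add: sup image_comp)
  also have "\<dots> \<le> B"
    using assms[OF fin] by (intro SUP_least) (simp add: nn_integral_indicator_finite[OF fin])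
  finally show ?thesis .
qed

lemma sum_le_nn_integral_count_space:
  fixes f :: "'a \<Rightarrow> ennreal"
  assumes "finite A"
  shows "(\<Sum>x\<in>A. f x) \<le> (\<integral>\<^sup>+x. f x \<partial>count_space UNIV)"
proof -
  have "(\<Sum>x\<in>A. f x) = (\<integral>\<^sup>+x. f x * indicator A x \<partial>count_space UNIV)"
    using assms by (simp add: nn_integral_indicator_finite)
  also have "\<dots> \<le> (\<integral>\<^sup>+x. f x \<partial>count_space UNIV)"
    by (intro nn_integral_mono) (auto split: split_indicator)
  finally show ?thesis .
qed

lemma nn_integral_count_space_shift:
  fixes f :: "'a::group_add \<Rightarrow> ennreal"
  shows "(\<integral>\<^sup>+z. f (z + h) \<partial>count_space UNIV) = (\<integral>\<^sup>+z. f z \<partial>count_space UNIV)"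
  by (rule nn_integral_bij_count_space) (rule bij_betw_byWitness[where f' = "\<lambda>z. z - h"], auto)

text \<open>Minkowski, after inserting the value at \<open>z + h\<close>. The bounds are assumed for
  all finite sets because the second increment lives on a translate of \<open>A\<close>.\<close>

lemma L2_set_shift_add:
  fixes f :: "'a::ab_group_add \<Rightarrow> real"
  assumes 1: "\<And>A. finite A \<Longrightarrow> L2_set (\<lambda>z. f (z + h) - f z) A \<le> K"
    and 2: "\<And>A. finite A \<Longrightarrow> L2_set (\<lambda>z. f (z + h') - f z) A \<le> K'"
    and A: "finite A"
  shows "L2_set (\<lambda>z. f (z + (h + h')) - f z) A \<le> K + K'"
proof -
  have "L2_set (\<lambda>z. f (z + (h + h')) - f z) A =
      L2_set (\<lambda>z. (f (z + h) - f z) + (f ((z + h) + h') - f (z + h))) A"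
    by (intro L2_set_cong) (auto simp: algebra_simps)
  also have "\<dots> \<le> L2_set (\<lambda>z. f (z + h) - f z) A + L2_set (\<lambda>z. f ((z + h) + h') - f (z + h)) A"
    by (rule L2_set_triangle_ineq)
  also have "L2_set (\<lambda>z. f ((z + h) + h') - f (z + h)) A = L2_set (\<lambda>z. f (z + h') - f z) ((\<lambda>z. z + h) ` A)"
    unfolding L2_set_def by (subst sum.reindex) (auto simp: inj_on_def)
  also have "L2_set (\<lambda>z. f (z + h) - f z) A + \<dots> \<le> K + K'"
    using 1[OF A] 2[of "(\<lambda>z. z + h) ` A"] A by auto
  finally show ?thesis .
qed

text \<open>A path from 0 to \<open>h\<close> parallel to the axes has as many unit steps as the l1
  norm of \<open>h\<close>, and each of them costs at most \<open>G\<close>. The walk along one axis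
  comes first, then the coordinates are added one by one.\<close>

lemma L2_set_shift_lattice:
  fixes f :: "int ^ 'd::finite \<Rightarrow> real"
  assumes unit: "\<And>i s A. s \<in> {1, -1} \<Longrightarrow> finite A \<Longrightarrow> L2_set (\<lambda>z. f (z + axis i s) - f z) A \<le> G"
    and A: "finite A"
  shows "L2_set (\<lambda>z. f (z + h) - f z) A \<le> (\<Sum>i\<in>UNIV. \<bar>real_of_int (h $ i)\<bar>) * G"
proof -
  have add: "axis i (a + b) = axis i a + axis i b" for i :: 'd and a b :: int
    by (simp add: axis_def vec_eq_iff)
  have 1: "L2_set (\<lambda>z. f (z + axis i (s * int n)) - f z) A \<le> real n * G"
    if "finite A" and s: "s \<in> {1, -1}" for i s n A
    using \<open>finite A\<close>
  proof (induction n arbitrary: A)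
    case 0
    have z: "axis i (0::int) = 0" by (simp add: axis_def vec_eq_iff)
    show ?case by (simp add: L2_set_def z)
  next
    case (Suc n)
    have "axis i (s * int (Suc n)) = axis i (s * int n) + axis i s"
      by (simp add: add[symmetric] algebra_simps)
    then show ?case
      using L2_set_shift_add[OF Suc.IH unit[OF s] Suc.prems] by (simp add: algebra_simps)
  qed
  have 2: "L2_set (\<lambda>z. f (z + axis i k) - f z) A \<le> \<bar>real_of_int k\<bar> * G" if "finite A" for i k A
    using 1[OF that, of 1 i "nat k"] 1[OF that, of "-1" i "nat (- k)"] by (cases "0 \<le> k") auto
  have "L2_set (\<lambda>z. f (z + (\<chi> i. if i \<in> I then h $ i else 0)) - f z) A \<le> (\<Sum>i\<in>I. \<bar>real_of_int (h $ i)\<bar>) * G"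
    if "finite I" "finite A" for I A
    using that
  proof (induction I arbitrary: A rule: finite_induct)
    case empty
    have "(\<chi> i. if i \<in> {} then h $ i else 0) = (0 :: int ^ 'd)" by (simp add: vec_eq_iff)
    then show ?case by (simp add: L2_set_def)
  next
    case (insert j I)
    have "(\<chi> i. if i \<in> insert j I then h $ i else 0) = (\<chi> i. if i \<in> I then h $ i else 0) + axis j (h $ j)"
      using insert.hyps by (auto simp: vec_eq_iff axis_def)
    then show ?case
      using L2_set_shift_add[OF insert.IH 2 insert.prems, of j "h $ j"] insert.hyps
      by (simp add: algebra_simps)
  qed
  from this[of UNIV A] A show ?thesis by simp
qed

lemma nbr_axis: "s \<in> {1, -1} \<Longrightarrow> nbr z (z + axis i s)" for z :: "int ^ 'd::finite"
proof -
  assume s: "s \<in> {1, -1}"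
  have "emb z - emb (z + axis i s) = (- real_of_int s) *\<^sub>R axis i 1"
    by (simp add: emb_def vec_eq_iff axis_def)
  then show ?thesis using s by (auto simp: nbr_def ldist_def)
qed

context elliptic_walk
begin

lemma L2_set_hk_shift:
  assumes t: "0 < t" and A: "finite A"
  shows "L2_set (\<lambda>z. hk c t a (z + h) - hk c t a z) A \<le>
    (\<Sum>i\<in>UNIV. \<bar>real_of_int (h $ i)\<bar>) * sqrt (2 * hk c t a a / t)"
proof (rule L2_set_shift_lattice[OF _ A])
  fix i :: 'd and s :: int and A :: "(int ^ 'd) set" assume s: "s \<in> {1, -1}" and A: "finite A"
  have "ennreal (\<Sum>z\<in>A. (hk c t a (z + axis i s) - hk c t a z)\<^sup>2) =
      (\<Sum>z\<in>A. ennreal ((hk c t a (z + axis i s) - hk c t a z)\<^sup>2))"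
    by (simp add: sum_ennreal)
  also have "\<dots> \<le> (\<integral>\<^sup>+z. ennreal ((hk c t a (z + axis i s) - hk c t a z)\<^sup>2) \<partial>count_space UNIV)"
    by (rule sum_le_nn_integral_count_space[OF A])
  also have "\<dots> \<le> ennreal (2 * hk c t a a / t)"
    by (rule gradient_bound[OF t nbr_axis[OF s]])
  finally have "(\<Sum>z\<in>A. (hk c t a (z + axis i s) - hk c t a z)\<^sup>2) \<le> 2 * hk c t a a / t"
    using t hk_nonneg[of t a a] by (subst (asm) ennreal_le_iff) auto
  then show "L2_set (\<lambda>z. hk c t a (z + axis i s) - hk c t a z) A \<le> sqrt (2 * hk c t a a / t)"
    unfolding L2_set_def by (rule real_sqrt_le_mono)
qed

lemma L2_set_hk:
  assumes t: "0 \<le> t" and A: "finite A"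
  shows "L2_set (hk c t a) A \<le> sqrt (hk c (2 * t) a a)"
proof -
  have "ennreal (\<Sum>z\<in>A. (hk c t a z)\<^sup>2) = (\<Sum>z\<in>A. (heat c t a z)\<^sup>2)"
    by (simp add: ennreal_hk[OF t, symmetric] ennreal_power hk_nonneg)
  also have "\<dots> \<le> (\<integral>\<^sup>+z. (heat c t a z)\<^sup>2 \<partial>count_space UNIV)"
    by (rule sum_le_nn_integral_count_space[OF A])
  also have "\<dots> = ennreal (hk c (2 * t) a a)"
    using t by (simp add: nn_integral_heat_square ennreal_hk)
  finally have "(\<Sum>z\<in>A. (hk c t a z)\<^sup>2) \<le> hk c (2 * t) a a"
    using t hk_nonneg[of "2 * t" a a] by (subst (asm) ennreal_le_iff) auto
  then show ?thesis
    unfolding L2_set_def by (rule real_sqrt_le_mono)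
qed

text \<open>Cauchy--Schwarz: the first factor of \<open>E\<close> bounds the l2 norm of the kernel
  from \<open>a\<close>, the second the l2 norm of the increment of the kernel from
  \<open>b\<close>. The two one-sided bounds stand for an absolute difference of
  \<open>ennreal\<close> values.\<close>

lemma overlap_shift:
  fixes a b h :: "int ^ 'd"
  assumes r: "0 < r" and s: "0 < s"
  defines "E \<equiv> sqrt (hk c (2 * r) a a) * ((\<Sum>i\<in>UNIV. \<bar>real_of_int (h $ i)\<bar>) * sqrt (2 * hk c s b b / s))"
  shows "(\<integral>\<^sup>+z. heat c r a z * heat c s b z \<partial>count_space UNIV) \<le>
      (\<integral>\<^sup>+z. heat c r a z * heat c s b (z + h) \<partial>count_space UNIV) + ennreal E" (is ?A)
    and "(\<integral>\<^sup>+z. heat c r a z * heat c s b (z + h) \<partial>count_space UNIV) \<le>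
      (\<integral>\<^sup>+z. heat c r a z * heat c s b z \<partial>count_space UNIV) + ennreal E" (is ?B)
proof -
  let ?C = "count_space UNIV :: (int ^ 'd) measure"
  let ?D = "\<lambda>z. hk c r a z * \<bar>hk c s b (z + h) - hk c s b z\<bar>"
  have D: "(\<integral>\<^sup>+z. ennreal (?D z) \<partial>?C) \<le> ennreal E"
  proof (rule nn_integral_count_space_le_finite)
    fix A :: "(int ^ 'd) set" assume A: "finite A"
    have "(\<Sum>z\<in>A. ?D z) = (\<Sum>z\<in>A. \<bar>hk c r a z\<bar> * \<bar>hk c s b (z + h) - hk c s b z\<bar>)"
      by (simp add: hk_nonneg)
    also have "\<dots> \<le> L2_set (hk c r a) A * L2_set (\<lambda>z. hk c s b (z + h) - hk c s b z) A"
      by (rule L2_set_mult_ineq)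
    also have "\<dots> \<le> E"
      unfolding E_def using r by (intro mult_mono L2_set_hk L2_set_hk_shift s A) (auto simp: hk_nonneg)
    finally show "(\<Sum>z\<in>A. ennreal (?D z)) \<le> ennreal E"
      by (simp add: sum_ennreal hk_nonneg ennreal_leI)
  qed
  have pt: "heat c r a z * heat c s b z \<le> heat c r a z * heat c s b (z + h) + ennreal (?D z)"
    "heat c r a z * heat c s b (z + h) \<le> heat c r a z * heat c s b z + ennreal (?D z)" for z
  proof -
    have "hk c r a z * hk c s b z \<le> hk c r a z * hk c s b (z + h) + ?D z"
      "hk c r a z * hk c s b (z + h) \<le> hk c r a z * hk c s b z + ?D z"
      unfolding distrib_left[symmetric] by (intro mult_left_mono; simp add: hk_nonneg)+
    then have "ennreal (hk c r a z * hk c s b z) \<le> ennreal (hk c r a z * hk c s b (z + h) + ?D z)"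
      "ennreal (hk c r a z * hk c s b (z + h)) \<le> ennreal (hk c r a z * hk c s b z + ?D z)"
      by (simp_all only: ennreal_leI)
    then show "heat c r a z * heat c s b z \<le> heat c r a z * heat c s b (z + h) + ennreal (?D z)"
      "heat c r a z * heat c s b (z + h) \<le> heat c r a z * heat c s b z + ennreal (?D z)"
      using r s by (simp_all add: ennreal_plus hk_nonneg ennreal_mult[of "hk c r a z" "hk c s b _"] ennreal_hk)
  qed
  have "(\<integral>\<^sup>+z. heat c r a z * heat c s b z \<partial>?C) \<le> (\<integral>\<^sup>+z. heat c r a z * heat c s b (z + h) + ennreal (?D z) \<partial>?C)"
    by (intro nn_integral_mono pt)
  also have "\<dots> \<le> (\<integral>\<^sup>+z. heat c r a z * heat c s b (z + h) \<partial>?C) + ennreal E"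
    using D by (simp add: nn_integral_add add_left_mono)
  finally show ?A .
  have "(\<integral>\<^sup>+z. heat c r a z * heat c s b (z + h) \<partial>?C) \<le> (\<integral>\<^sup>+z. heat c r a z * heat c s b z + ennreal (?D z) \<partial>?C)"
    by (intro nn_integral_mono pt)
  also have "\<dots> \<le> (\<integral>\<^sup>+z. heat c r a z * heat c s b z \<partial>?C) + ennreal E"
    using D by (simp add: nn_integral_add add_left_mono)
  finally show ?B .
qed

end

section \<open>Lattice sums reduced to one dimension\<close>

lemma nn_integral_prod_lattice:
  fixes f :: "'d::finite \<Rightarrow> int \<Rightarrow> ennreal"
  shows "(\<integral>\<^sup>+z. (\<Prod>i\<in>UNIV. f i (z $ i)) \<partial>count_space (UNIV :: (int ^ 'd) set)) =
    (\<Prod>i\<in>UNIV. \<integral>\<^sup>+j. f i j \<partial>count_space UNIV)"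
proof -
  interpret product_sigma_finite "\<lambda>_::'d. count_space (UNIV :: int set)"
    by (intro product_sigma_finite.intro sigma_finite_measure_count_space_countable) simp
  have P: "PiM (UNIV :: 'd set) (\<lambda>_. count_space (UNIV :: int set)) = count_space UNIV"
    by (subst count_space_PiM_finite) auto
  have "bij_betw vec_nth (UNIV :: (int ^ 'd) set) UNIV"
    by (rule bij_betw_byWitness[where f' = vec_lambda]) auto
  from nn_integral_bij_count_space[OF this, of "\<lambda>g. \<Prod>i\<in>UNIV. f i (g i)"]
  show ?thesis
    using product_nn_integral_prod[of UNIV f] by (simp add: P)
qed

lemma nn_integral_int_le:
  fixes f :: "int \<Rightarrow> ennreal"
  shows "(\<integral>\<^sup>+j. f j \<partial>count_space UNIV) \<le> (\<Sum>n. f (int n)) + (\<Sum>n. f (- int n))"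
proof -
  have b: "bij_betw int UNIV {0..}" "bij_betw (\<lambda>n. - int n) UNIV {..0}"
    by (rule bij_betw_byWitness[where f' = nat], auto)
       (rule bij_betw_byWitness[where f' = "\<lambda>k. nat (- k)"], auto)
  have "(\<integral>\<^sup>+j. f j \<partial>count_space UNIV) \<le> (\<integral>\<^sup>+j. f j * indicator {0..} j + f j * indicator {..0} j \<partial>count_space UNIV)"
    by (intro nn_integral_mono) (auto split: split_indicator)
  also have "\<dots> = (\<integral>\<^sup>+j. f j \<partial>count_space {0..}) + (\<integral>\<^sup>+j. f j \<partial>count_space {..0})"
    by (simp add: nn_integral_add nn_integral_count_space_indicator)
  also have "\<dots> = (\<Sum>n. f (int n)) + (\<Sum>n. f (- int n))"
    by (simp add: nn_integral_bij_count_space[OF b(1), symmetric] nn_integral_bij_count_space[OF b(2), symmetric]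
          nn_integral_count_space_nat)
  finally show ?thesis .
qed

lemma nn_integral_exp_abs_int:
  assumes a: "0 < a"
  shows "(\<integral>\<^sup>+j. ennreal (exp (- (a * \<bar>real_of_int j\<bar>))) \<partial>count_space UNIV) \<le> ennreal (2 * (1 + a) / a)"
proof -
  let ?q = "exp (- a)"
  have q: "0 < ?q" "?q < 1" using a by auto
  have "(\<Sum>n. ennreal (exp (- (a * real n)))) = (\<Sum>n. ennreal (?q ^ n))"
    by (intro suminf_cong) (simp add: exp_of_nat_mult[symmetric] mult_ac)
  also have "\<dots> = ennreal (1 / (1 - ?q))"
    using q by (subst suminf_ennreal2) (auto simp: suminf_geometric summable_geometric)
  also have "\<dots> \<le> ennreal ((1 + a) / a)"
  proof (rule ennreal_leI)
    have "?q \<le> 1 / (1 + a)"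
      using exp_ge_add_one_self[of a] a by (simp add: exp_minus field_simps)
    then have "a / (1 + a) \<le> 1 - ?q" using a by (simp add: field_simps)
    then have "1 / (1 - ?q) \<le> 1 / (a / (1 + a))" using a by (intro divide_left_mono) auto
    then show "1 / (1 - ?q) \<le> (1 + a) / a" by simp
  qed
  finally have S: "(\<Sum>n. ennreal (exp (- (a * real n)))) \<le> ennreal ((1 + a) / a)" .
  have "(\<integral>\<^sup>+j. ennreal (exp (- (a * \<bar>real_of_int j\<bar>))) \<partial>count_space UNIV) \<le>
      (\<Sum>n. ennreal (exp (- (a * real n)))) + (\<Sum>n. ennreal (exp (- (a * real n))))"
    using nn_integral_int_le[of "\<lambda>j. ennreal (exp (- (a * \<bar>real_of_int j\<bar>)))"] by simp
  also have "\<dots> \<le> ennreal ((1 + a) / a) + ennreal ((1 + a) / a)"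
    by (intro add_mono S)
  also have "\<dots> = ennreal (2 * (1 + a) / a)"
    using a by (subst ennreal_plus[symmetric]) (auto simp: field_simps)
  finally show ?thesis .
qed

lemma l1_le_norm:
  fixes x :: "real ^ 'd::finite"
  shows "(\<Sum>i\<in>UNIV. \<bar>x $ i\<bar>) \<le> real CARD('d) * norm x"
proof -
  have "(\<Sum>i\<in>UNIV. \<bar>x $ i\<bar>) \<le> (\<Sum>i\<in>(UNIV::'d set). norm x)"
    by (intro sum_mono component_le_norm_cart)
  then show ?thesis by simp
qed

text \<open>The l1 norm is at most d times the Euclidean norm, which leaves a product of two-sided
  geometric series with rate \<open>a / d\<close>. For small \<open>a\<close> the bound grows like
  \<open>a\<close> to the power -d; with \<open>a\<close> of order \<open>1 / sqrt t\<close> this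
  matches the factor \<open>t powr (- d / 2)\<close> of the heat kernel.\<close>

lemma nn_integral_exp_ldist:
  fixes y :: "int ^ 'd::finite"
  assumes a: "0 < a"
  shows "(\<integral>\<^sup>+z. ennreal (exp (- (a * ldist y z))) \<partial>count_space UNIV) \<le>
    ennreal ((2 * (real CARD('d) + a) / a) ^ CARD('d))"
proof -
  let ?d = "real CARD('d)"
  have d: "0 < ?d" by simp
  have "(\<integral>\<^sup>+z. ennreal (exp (- (a * ldist y z))) \<partial>count_space UNIV) \<le>
     (\<integral>\<^sup>+z. (\<Prod>i\<in>UNIV. ennreal (exp (- (a / ?d * \<bar>real_of_int ((z + - y) $ i)\<bar>)))) \<partial>count_space UNIV)"
  proof (rule nn_integral_mono)
    fix z :: "int ^ 'd"
    have "(\<Sum>i\<in>UNIV. \<bar>real_of_int ((z + - y) $ i)\<bar>) = (\<Sum>i\<in>UNIV. \<bar>(emb y - emb z) $ i\<bar>)"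
      by (intro sum.cong) (auto simp: emb_def)
    also have "\<dots> \<le> ?d * ldist y z"
      unfolding ldist_def by (rule l1_le_norm)
    finally have "a / ?d * (\<Sum>i\<in>UNIV. \<bar>real_of_int ((z + - y) $ i)\<bar>) \<le> a / ?d * (?d * ldist y z)"
      using a by (intro mult_left_mono) auto
    then have "exp (- (a * ldist y z)) \<le> exp (\<Sum>i\<in>UNIV. - (a / ?d * \<bar>real_of_int ((z + - y) $ i)\<bar>))"
      by (simp add: sum_negf sum_distrib_left)
    also have "\<dots> = (\<Prod>i\<in>UNIV. exp (- (a / ?d * \<bar>real_of_int ((z + - y) $ i)\<bar>)))"
      by (rule exp_sum) simp
    finally show "ennreal (exp (- (a * ldist y z))) \<le> (\<Prod>i\<in>UNIV. ennreal (exp (- (a / ?d * \<bar>real_of_int ((z + - y) $ i)\<bar>))))"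
      by (subst prod_ennreal) (auto intro: ennreal_leI)
  qed
  also have "\<dots> = (\<integral>\<^sup>+z. (\<Prod>i\<in>(UNIV::'d set). ennreal (exp (- (a / ?d * \<bar>real_of_int (z $ i)\<bar>)))) \<partial>count_space UNIV)"
    by (rule nn_integral_count_space_shift)
  also have "\<dots> = (\<Prod>i\<in>(UNIV::'d set). \<integral>\<^sup>+j. ennreal (exp (- (a / ?d * \<bar>real_of_int j\<bar>))) \<partial>count_space UNIV)"
    by (rule nn_integral_prod_lattice)
  also have "\<dots> \<le> (\<Prod>i\<in>(UNIV::'d set). ennreal (2 * (1 + a / ?d) / (a / ?d)))"
    using a by (intro prod_mono_ennreal nn_integral_exp_abs_int) auto
  also have "\<dots> = ennreal ((2 * (?d + a) / a) ^ CARD('d))"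
  proof -
    have "2 * (1 + a / ?d) / (a / ?d) = 2 * (?d + a) / a" using a d by (simp add: field_simps)
    then show ?thesis using a by (simp add: ennreal_power)
  qed
  finally show ?thesis .
qed

section \<open>Tails and fluctuations of the random scales\<close>

text \<open>The Gaussian is traded for an exponential of rate \<open>2 * a\<close> in the distance,
  with \<open>a = c4 / sqrt t\<close>. Half of the rate pays for the distance \<rho>, the other half
  is summed over the lattice; that sum is of order \<open>t powr (d / 2)\<close> and cancels the
  on-diagonal factor. The condition \<open>1 \<le> t\<close> gives \<open>a \<le> c4\<close>, so
  that one constant \<open>K\<close> serves both terms.\<close>

lemma nn_integral_heat_kernel_tail:
  fixes q :: "int ^ 'd::finite \<Rightarrow> real" and c3 c4 t \<rho> :: real
  defines "K \<equiv> c3 * exp c4 * (4 * (real CARD('d) + c4) / c4) ^ CARD('d)"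
  assumes c: "0 < c3" "0 < c4" and t: "1 \<le> t" and \<rho>: "0 \<le> \<rho>"
    and q: "\<And>z. \<rho> \<le> ldist y z \<Longrightarrow> q z \<le> c3 * t powr (- real CARD('d) / 2) * exp (- c4 * (ldist y z)\<^sup>2 / t)
        + c3 * exp (- c4 * ldist y z)"
  shows "(\<integral>\<^sup>+z. ennreal (q z) * indicator {z. \<rho> \<le> ldist y z} z \<partial>count_space UNIV) \<le>
    ennreal (K * (exp (- (c4 * \<rho> / sqrt t)) + exp (- (c4 * \<rho> / 2))))"
proof -
  let ?d = "real CARD('d)"
  define a where "a = c4 / sqrt t"
  define D where "D = t powr (- ?d / 2)"
  have st: "1 \<le> sqrt t" using t by simp
  have a: "0 < a" "a \<le> c4" using c st by (auto simp: a_def divide_le_eq)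
  define A where "A = c3 * exp c4 * D * exp (- (a * \<rho>))"
  define B where "B = c3 * exp (- (c4 * \<rho> / 2))"
  have nn: "0 \<le> A" "0 \<le> B" "0 < D" using c t by (auto simp: A_def B_def D_def)
  have "(\<integral>\<^sup>+z. ennreal (q z) * indicator {z. \<rho> \<le> ldist y z} z \<partial>count_space UNIV) \<le>
    (\<integral>\<^sup>+z. ennreal A * ennreal (exp (- (a * ldist y z))) + ennreal B * ennreal (exp (- (c4 / 2 * ldist y z))) \<partial>count_space UNIV)"
  proof (rule nn_integral_mono)
    fix z
    let ?r = "ldist y z"
    show "ennreal (q z) * indicator {z. \<rho> \<le> ldist y z} z \<le>
      ennreal A * ennreal (exp (- (a * ?r))) + ennreal B * ennreal (exp (- (c4 / 2 * ?r)))"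
    proof (cases "\<rho> \<le> ?r")
      case True
      \<comment> \<open>Completing the square gives \<open>r^2 / t \<ge> 2 * r / sqrt t - 1\<close>;
        the -1 is the source of the factor \<open>exp c4\<close> in \<open>K\<close>.\<close>
      have "0 \<le> (?r / sqrt t - 1)\<^sup>2" by simp
      then have "2 * (?r / sqrt t) - 1 \<le> ?r\<^sup>2 / t"
        using t by (simp add: power2_diff power_divide)
      from mult_left_mono[OF this, of c4] c have "2 * (a * ?r) - c4 \<le> c4 * ?r\<^sup>2 / t"
        by (simp add: a_def algebra_simps)
      moreover have "a * \<rho> \<le> a * ?r" using a True by simp
      ultimately have "- c4 * ?r\<^sup>2 / t \<le> c4 + - (a * \<rho>) + - (a * ?r)" by simp
      then have "exp (- c4 * ?r\<^sup>2 / t) \<le> exp c4 * exp (- (a * \<rho>)) * exp (- (a * ?r))"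
        by (simp only: exp_le_cancel_iff exp_add[symmetric])
      then have 1: "c3 * D * exp (- c4 * ?r\<^sup>2 / t) \<le> A * exp (- (a * ?r))"
        using mult_left_mono[of "exp (- c4 * ?r\<^sup>2 / t)" _ "c3 * D"] c nn by (simp add: A_def mult_ac)
      have "c4 * \<rho> \<le> c4 * ?r" using c True by simp
      then have "- c4 * ?r \<le> - (c4 * \<rho> / 2) + - (c4 / 2 * ?r)" by simp
      then have "exp (- c4 * ?r) \<le> exp (- (c4 * \<rho> / 2)) * exp (- (c4 / 2 * ?r))"
        by (simp only: exp_le_cancel_iff exp_add[symmetric])
      then have 2: "c3 * exp (- c4 * ?r) \<le> B * exp (- (c4 / 2 * ?r))"
        using c by (simp add: B_def)
      have "q z \<le> A * exp (- (a * ?r)) + B * exp (- (c4 / 2 * ?r))"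
        using q[OF True] 1 2 unfolding D_def by linarith
      then have "ennreal (q z) \<le> ennreal (A * exp (- (a * ?r)) + B * exp (- (c4 / 2 * ?r)))"
        by (rule ennreal_leI)
      then show ?thesis using True nn by (simp add: ennreal_plus ennreal_mult)
    qed simp
  qed
  also have "\<dots> = ennreal A * (\<integral>\<^sup>+z. ennreal (exp (- (a * ldist y z))) \<partial>count_space UNIV) +
      ennreal B * (\<integral>\<^sup>+z. ennreal (exp (- (c4 / 2 * ldist y z))) \<partial>count_space UNIV)"
    by (simp add: nn_integral_add nn_integral_cmult)
  also have "\<dots> \<le> ennreal A * ennreal ((2 * (?d + a) / a) ^ CARD('d)) +
      ennreal B * ennreal ((2 * (?d + c4 / 2) / (c4 / 2)) ^ CARD('d))"
    using a c by (intro add_mono mult_left_mono nn_integral_exp_ldist) auto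
  also have "\<dots> = ennreal (A * (2 * (?d + a) / a) ^ CARD('d) + B * (2 * (?d + c4 / 2) / (c4 / 2)) ^ CARD('d))"
    using nn a c by (subst ennreal_plus) (auto simp: ennreal_mult)
  also have "\<dots> \<le> ennreal (K * (exp (- (c4 * \<rho> / sqrt t)) + exp (- (c4 * \<rho> / 2))))"
  proof (rule ennreal_leI)
    let ?H = "4 * (?d + c4) / c4"
    have H: "0 \<le> ?H" using c by simp
    have "2 * (?d + a) / a \<le> 2 * (?d + c4) / a"
      using a by (intro divide_right_mono) auto
    also have "\<dots> = 2 * (?d + c4) / c4 * sqrt t" by (simp add: a_def)
    also have "\<dots> \<le> ?H * sqrt t"
      using c st by (intro mult_right_mono divide_right_mono) auto
    finally have "(2 * (?d + a) / a) ^ CARD('d) \<le> (?H * sqrt t) ^ CARD('d)"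
      using a by (intro power_mono) auto
    also have "(?H * sqrt t) ^ CARD('d) = ?H ^ CARD('d) * t powr (?d / 2)"
    proof -
      have "sqrt t ^ CARD('d) = t powr (?d / 2)"
        using t by (simp add: powr_half_sqrt[symmetric] powr_power)
      then show ?thesis by (simp only: power_mult_distrib)
    qed
    finally have "A * (2 * (?d + a) / a) ^ CARD('d) \<le> A * (?H ^ CARD('d) * t powr (?d / 2))"
      using nn by (intro mult_left_mono) auto
    also have "\<dots> = K * exp (- (a * \<rho>)) * (D * t powr (?d / 2))"
      by (simp add: A_def K_def mult_ac)
    also have "D * t powr (?d / 2) = 1"
      using t by (simp add: D_def powr_add[symmetric])
    finally have 1: "A * (2 * (?d + a) / a) ^ CARD('d) \<le> K * exp (- (c4 * \<rho> / sqrt t))"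
      by (simp add: a_def)
    have "2 * (?d + c4 / 2) / (c4 / 2) \<le> ?H"
      using c by (simp add: field_simps)
    then have "B * (2 * (?d + c4 / 2) / (c4 / 2)) ^ CARD('d) \<le> B * ?H ^ CARD('d)"
      using nn c by (intro mult_left_mono power_mono) auto
    also have "\<dots> = exp (- (c4 * \<rho> / 2)) * ?H ^ CARD('d) * c3 * 1"
      by (simp add: B_def)
    also have "\<dots> \<le> exp (- (c4 * \<rho> / 2)) * ?H ^ CARD('d) * c3 * exp c4"
      using c H by (intro mult_left_mono) auto
    finally have 2: "B * (2 * (?d + c4 / 2) / (c4 / 2)) ^ CARD('d) \<le> K * exp (- (c4 * \<rho> / 2))"
      by (simp add: K_def mult_ac)
    show "A * (2 * (?d + a) / a) ^ CARD('d) + B * (2 * (?d + c4 / 2) / (c4 / 2)) ^ CARD('d)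
      \<le> K * (exp (- (c4 * \<rho> / sqrt t)) + exp (- (c4 * \<rho> / 2)))"
      using 1 2 by (simp add: distrib_left)
  qed
  finally show ?thesis .
qed

lemma exp_neg_le_inverse_power:
  fixes x :: real
  assumes "0 < x"
  shows "exp (- x) \<le> fact m / x ^ m"
proof -
  have "x ^ m / fact m \<le> exp x"
  proof -
    have "(\<Sum>n\<in>{m}. x ^ n /\<^sub>R fact n) \<le> (\<Sum>n. x ^ n /\<^sub>R fact n)"
      using assms summable_exp_generic[of x] by (intro sum_le_suminf) auto
    then show ?thesis by (simp add: exp_def divide_inverse mult_ac)
  qed
  then show ?thesis using assms by (simp add: exp_minus field_simps)
qed

lemma nn_integral_inverse_square_int:
  "(\<integral>\<^sup>+j. ennreal (1 / (1 + (real_of_int j)\<^sup>2)) \<partial>count_space UNIV) < \<infinity>"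
proof -
  have "summable (\<lambda>n. 1 / (1 + (real n)\<^sup>2))"
  proof (rule summable_comparison_test'[where N = 1 and g = "\<lambda>n. inverse (real n ^ 2)"])
    show "summable (\<lambda>n. inverse (real n ^ 2))" by (rule inverse_power_summable) simp
  qed (auto simp: inverse_eq_divide intro!: divide_left_mono mult_pos_pos add_pos_nonneg)
  then have S: "(\<Sum>n. ennreal (1 / (1 + (real n)\<^sup>2))) = ennreal (\<Sum>n. 1 / (1 + (real n)\<^sup>2))"
    by (intro suminf_ennreal2) auto
  have "(\<integral>\<^sup>+j. ennreal (1 / (1 + (real_of_int j)\<^sup>2)) \<partial>count_space UNIV) \<le>
      ennreal (\<Sum>n. 1 / (1 + (real n)\<^sup>2)) + ennreal (\<Sum>n. 1 / (1 + (real n)\<^sup>2))"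
    using nn_integral_int_le[of "\<lambda>j. ennreal (1 / (1 + (real_of_int j)\<^sup>2))"] by (simp add: S)
  also have "\<dots> < \<infinity>" by simp
  finally show ?thesis .
qed

text \<open>The d-th power is distributed over the d coordinates: each factor
  \<open>1 + |x|^2\<close> is at least \<open>1 + x_i^2\<close>, which leaves a product of
  convergent series.\<close>

lemma nn_integral_lattice_finite:
  "(\<integral>\<^sup>+x. ennreal (1 / (1 + (norm (emb x))\<^sup>2) ^ CARD('d)) \<partial>count_space (UNIV :: (int ^ 'd::finite) set)) < \<infinity>"
proof -
  have "(\<integral>\<^sup>+x. ennreal (1 / (1 + (norm (emb x))\<^sup>2) ^ CARD('d)) \<partial>count_space (UNIV :: (int ^ 'd) set)) \<le>
    (\<integral>\<^sup>+x. (\<Prod>i\<in>UNIV. ennreal (1 / (1 + (real_of_int (x $ i))\<^sup>2))) \<partial>count_space (UNIV :: (int ^ 'd) set))"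
  proof (rule nn_integral_mono)
    fix x :: "int ^ 'd"
    have "(real_of_int (x $ i))\<^sup>2 \<le> (norm (emb x))\<^sup>2" for i
      using component_le_norm_cart[of "emb x" i] power_mono[of "\<bar>emb x $ i\<bar>" "norm (emb x)" 2]
      by (simp add: emb_def)
    then have "(\<Prod>i\<in>(UNIV::'d set). 1 + (real_of_int (x $ i))\<^sup>2) \<le> (\<Prod>i\<in>(UNIV::'d set). 1 + (norm (emb x))\<^sup>2)"
      by (intro prod_mono) auto
    then have "1 / (1 + (norm (emb x))\<^sup>2) ^ CARD('d) \<le> 1 / (\<Prod>i\<in>(UNIV::'d set). 1 + (real_of_int (x $ i))\<^sup>2)"
      by (intro divide_left_mono) (auto intro!: prod_pos mult_pos_pos zero_less_power add_pos_nonneg)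
    also have "\<dots> = (\<Prod>i\<in>(UNIV::'d set). 1 / (1 + (real_of_int (x $ i))\<^sup>2))"
      by (simp add: prod_dividef)
    finally show "ennreal (1 / (1 + (norm (emb x))\<^sup>2) ^ CARD('d)) \<le> (\<Prod>i\<in>UNIV. ennreal (1 / (1 + (real_of_int (x $ i))\<^sup>2)))"
      by (subst prod_ennreal) (auto intro: ennreal_leI)
  qed
  also have "\<dots> = (\<Prod>i\<in>(UNIV::'d set). \<integral>\<^sup>+j. ennreal (1 / (1 + (real_of_int j)\<^sup>2)) \<partial>count_space UNIV)"
    by (rule nn_integral_prod_lattice)
  also have "\<dots> < \<infinity>"
    using nn_integral_inverse_square_int by (simp add: power_less_top_ennreal)
  finally show ?thesis .
qed

text \<open>Borel--Cantelli: the stretched exponential tails beat the polynomial growth of the lattice.\<close>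

lemma AE_sublinear_growth:
  fixes U :: "int ^ 'd::finite \<Rightarrow> 'w \<Rightarrow> real"
  assumes "prob_space M"
    and U: "\<And>x. U x \<in> borel_measurable M"
    and c2: "0 < c2"
    and tail: "\<And>x (n::nat). measure M {\<omega> \<in> space M. real n \<le> U x \<omega>} \<le> c1 * exp (- c2 * real n powr (1 / 2))"
  shows "AE \<omega> in M. \<forall>\<kappa>>0. \<exists>C. \<forall>x. U x \<omega> \<le> \<kappa> * norm (emb x) + C"
proof -
  interpret prob_space M by fact
  note U[measurable]
  define d where "d = CARD('d)"
  have c1: "0 \<le> c1"
    using order.trans[OF measure_nonneg tail[of 0 0]] by simp
  \<comment> \<open>The slopes \<open>1 / Suc k\<close> are countably many, so their exceptional
    null sets can be united; they are also arbitrarily small.\<close>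
  have k: "AE \<omega> in M. \<exists>C. \<forall>x. U x \<omega> \<le> norm (emb x) / real (Suc k) + C" for k
  proof -
    define K where "K = real (Suc k)"
    have K: "0 < K" by (simp add: K_def)
    define N where "N x = nat \<lfloor>norm (emb x) / K\<rfloor>" for x :: "int ^ 'd"
    have N: "real (N x) \<le> norm (emb x) / K" "norm (emb x) / K < real (N x) + 1" for x
    proof -
      have "real (N x) = of_int \<lfloor>norm (emb x) / K\<rfloor>" using K by (simp add: N_def)
      then show "real (N x) \<le> norm (emb x) / K" "norm (emb x) / K < real (N x) + 1" by linarith+
    qed
    \<comment> \<open>The term of degree \<open>4 * d\<close> in the exponential series at
      \<open>c2 * sqrt N\<close> supplies \<open>N ^ (2 * d)\<close>, which dominates the d-th power
      of \<open>1 + |x|^2\<close> up to the last factor. The maximum with 1 covers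
      \<open>N x = 0\<close>.\<close>
    define L where "L = max 1 (fact (4 * d) / c2 ^ (4 * d)) * (4 * (1 + K\<^sup>2)) ^ d"
    have L: "0 \<le> L" by (simp add: L_def)
    have bound: "exp (- c2 * real (N x) powr (1 / 2)) \<le> L * (1 / (1 + (norm (emb x))\<^sup>2) ^ d)" for x
    proof -
      define m where "m = max 1 (real (N x))"
      have m: "1 \<le> m" by (simp add: m_def)
      have "norm (emb x) \<le> K * (2 * m)"
      proof -
        have "norm (emb x) / K \<le> 2 * m" 
        proof -
          have "real (N x) \<le> m" by (simp add: m_def)
          then show ?thesis using N(2)[of x] m by linarith
        qed
        then show ?thesis using K by (simp add: pos_divide_le_eq mult_ac)
      qed
      then have "(norm (emb x))\<^sup>2 \<le> (K * (2 * m))\<^sup>2" by (rule power_mono) simp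
      then have "(norm (emb x))\<^sup>2 \<le> 4 * (K\<^sup>2 * m\<^sup>2)" by (simp add: power_mult_distrib mult_ac)
      moreover have "1 \<le> m\<^sup>2" using m by (simp add: one_le_power)
      ultimately have "1 + (norm (emb x))\<^sup>2 \<le> 4 * m\<^sup>2 + 4 * (K\<^sup>2 * m\<^sup>2)" by linarith
      also have "\<dots> = 4 * (1 + K\<^sup>2) * m\<^sup>2" by (simp add: distrib_left distrib_right)
      finally have "1 + (norm (emb x))\<^sup>2 \<le> 4 * (1 + K\<^sup>2) * m\<^sup>2" .
      then have "(1 + (norm (emb x))\<^sup>2) ^ d \<le> (4 * (1 + K\<^sup>2) * m\<^sup>2) ^ d"
        by (rule power_mono) simp
      then have 1: "(1 + (norm (emb x))\<^sup>2) ^ d \<le> (4 * (1 + K\<^sup>2)) ^ d * m ^ (2 * d)"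
        by (simp add: power_mult_distrib power_mult[symmetric])
      have 2: "exp (- c2 * real (N x) powr (1 / 2)) * m ^ (2 * d) \<le> max 1 (fact (4 * d) / c2 ^ (4 * d))"
      proof (cases "N x = 0")
        case True
        then have "m = 1" by (simp add: m_def)
        then show ?thesis using True by simp
      next
        case False
        then have Nm: "m = real (N x)" by (simp add: m_def)
        have p: "(real (N x) powr (1 / 2)) ^ (4 * d) = real (N x) ^ (2 * d)"
        proof -
          have "(sqrt (real (N x))) ^ (2 * (2 * d)) = real (N x) ^ (2 * d)"
            unfolding power_mult[of _ 2] by simp
          then show ?thesis by (simp add: powr_half_sqrt)
        qed
        have "exp (- (c2 * real (N x) powr (1 / 2))) \<le> fact (4 * d) / (c2 * real (N x) powr (1 / 2)) ^ (4 * d)"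
          using c2 False by (intro exp_neg_le_inverse_power) auto
        also have "\<dots> = fact (4 * d) / c2 ^ (4 * d) / m ^ (2 * d)"
          unfolding power_mult_distrib p Nm by simp
        finally have "exp (- (c2 * real (N x) powr (1 / 2))) * m ^ (2 * d) \<le> fact (4 * d) / c2 ^ (4 * d)"
          by (rule pos_le_divide_eq[THEN iffD1, rotated]) (use m in simp)
        then show ?thesis unfolding mult_minus_left by (rule order.trans) simp
      qed
      define D where "D = (1 + (norm (emb x))\<^sup>2) ^ d"
      define w where "w = exp (- c2 * real (N x) powr (1 / 2))"
      have D: "0 < D" by (simp add: D_def add_pos_nonneg)
      have "w * D \<le> w * ((4 * (1 + K\<^sup>2)) ^ d * m ^ (2 * d))"
        unfolding D_def by (intro mult_left_mono 1) (simp add: w_def)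
      also have "\<dots> = (w * m ^ (2 * d)) * (4 * (1 + K\<^sup>2)) ^ d"
        by (simp add: mult_ac)
      also have "\<dots> \<le> L"
        unfolding L_def w_def by (intro mult_right_mono 2) simp
      finally have "w \<le> L / D"
        by (rule pos_le_divide_eq[THEN iffD2, OF D])
      then show ?thesis
        unfolding w_def D_def by simp
    qed
    let ?A = "\<lambda>x. {\<omega> \<in> space M. real (N x) \<le> U x \<omega>}"
    \<comment> \<open>The expected number of exceptional sites is finite, so almost surely there are
      finitely many; the sum of \<open>|U x|\<close> over them then serves as the additive
      constant.\<close>
    have "(\<integral>\<^sup>+\<omega>. (\<integral>\<^sup>+x. indicator (?A x) \<omega> \<partial>count_space UNIV) \<partial>M) =
       (\<integral>\<^sup>+x. (\<integral>\<^sup>+\<omega>. indicator (?A x) \<omega> \<partial>M) \<partial>count_space UNIV)"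
      by (rule nn_integral_count_space_nn_integral) auto
    also have "\<dots> \<le> (\<integral>\<^sup>+x. ennreal (c1 * L) * ennreal (1 / (1 + (norm (emb (x :: int ^ 'd)))\<^sup>2) ^ d) \<partial>count_space UNIV)"
    proof (rule nn_integral_mono)
      fix x :: "int ^ 'd"
      have "(\<integral>\<^sup>+\<omega>. indicator (?A x) \<omega> \<partial>M) = ennreal (measure M (?A x))"
        by (simp add: emeasure_eq_measure)
      also have "\<dots> \<le> ennreal (c1 * (L * (1 / (1 + (norm (emb x))\<^sup>2) ^ d)))"
        using tail[of "N x" x] mult_left_mono[OF bound[of x] c1] by (intro ennreal_leI) linarith
      also have "\<dots> = ennreal (c1 * L) * ennreal (1 / (1 + (norm (emb x))\<^sup>2) ^ d)"
        using c1 L by (simp add: ennreal_mult[symmetric] mult.assoc)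
      finally show "(\<integral>\<^sup>+\<omega>. indicator (?A x) \<omega> \<partial>M) \<le>
        ennreal (c1 * L) * ennreal (1 / (1 + (norm (emb x))\<^sup>2) ^ d)" .
    qed
    also have "\<dots> = ennreal (c1 * L) * (\<integral>\<^sup>+x. ennreal (1 / (1 + (norm (emb (x :: int ^ 'd)))\<^sup>2) ^ d) \<partial>count_space UNIV)"
      by (rule nn_integral_cmult) simp
    also have "\<dots> < \<infinity>"
      using nn_integral_lattice_finite[where 'd='d] unfolding d_def
      by (simp add: ennreal_mult_less_top)
    finally have "AE \<omega> in M. (\<integral>\<^sup>+x. indicator (?A x) \<omega> \<partial>count_space UNIV) \<noteq> \<infinity>"
      by (intro nn_integral_PInf_AE borel_measurable_nn_integral_count_space) auto
    then show ?thesis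
    proof (rule AE_mp, intro AE_I2 impI)
      fix \<omega> assume \<omega>: "\<omega> \<in> space M" and fin: "(\<integral>\<^sup>+x. indicator (?A x) \<omega> \<partial>count_space UNIV) \<noteq> \<infinity>"
      let ?B = "{x. real (N x) \<le> U x \<omega>}"
      have "(\<integral>\<^sup>+x. indicator (?A x) \<omega> \<partial>count_space UNIV) = (\<integral>\<^sup>+x. indicator ?B x \<partial>count_space UNIV)"
        using \<omega> by (intro nn_integral_cong) (auto split: split_indicator)
      also have "\<dots> = emeasure (count_space UNIV) ?B" by simp
      finally have "finite ?B" using fin by (auto simp: emeasure_count_space split: if_splits)
      then have C: "U x \<omega> \<le> (\<Sum>x\<in>?B. \<bar>U x \<omega>\<bar>)" if "x \<in> ?B" for x
        using member_le_sum[of x ?B "\<lambda>x. \<bar>U x \<omega>\<bar>"] that by simp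
      have "U x \<omega> \<le> norm (emb x) / K + (\<Sum>x\<in>?B. \<bar>U x \<omega>\<bar>)" for x
      proof (cases "x \<in> ?B")
        case True
        have "0 \<le> norm (emb x) / K" using K by simp
        then show ?thesis using C[OF True] by linarith
      next
        case False
        have "0 \<le> (\<Sum>x\<in>?B. \<bar>U x \<omega>\<bar>)" by (rule sum_nonneg) simp
        moreover have "U x \<omega> < real (N x)" using False by simp
        ultimately show ?thesis using N(1)[of x] by linarith
      qed
      then show "\<exists>C. \<forall>x. U x \<omega> \<le> norm (emb x) / real (Suc k) + C"
        unfolding K_def by (intro exI allI)
    qed
  qed
  have "AE \<omega> in M. \<forall>k. \<exists>C. \<forall>x. U x \<omega> \<le> norm (emb x) / real (Suc k) + C"
    unfolding AE_all_countable by (intro allI k)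
  then show ?thesis
  proof (rule AE_mp, intro AE_I2 impI allI)
    fix \<omega> and \<kappa> :: real
    assume H: "\<forall>k. \<exists>C. \<forall>x. U x \<omega> \<le> norm (emb x) / real (Suc k) + C" and "0 < \<kappa>"
    then obtain k where k: "1 / real (Suc k) < \<kappa>" using nat_approx_posE by metis
    obtain C where C: "\<forall>x. U x \<omega> \<le> norm (emb x) / real (Suc k) + C" using H by blast
    have "U x \<omega> \<le> \<kappa> * norm (emb x) + C" for x
    proof -
      have "1 / real (Suc k) * norm (emb x) \<le> \<kappa> * norm (emb x)"
        using k by (intro mult_right_mono) auto
      then show ?thesis using C[THEN spec, of x] by simp
    qed
    then show "\<exists>C. \<forall>x. U x \<omega> \<le> \<kappa> * norm (emb x) + C" by (intro exI allI)
  qed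
qed

section \<open>Convergence in law at a fixed time\<close>

text \<open>Evaluation at a fixed time is not continuous in the Skorokhod topology. The penalised infimum
  \<open>soft_min\<close> is, it lies below evaluation, and it approximates evaluation along
  continuous paths.\<close>

definition soft_min :: "('v::metric_space \<Rightarrow> real) \<Rightarrow> real \<Rightarrow> real \<Rightarrow> (real \<Rightarrow> 'v) \<Rightarrow> real" where
  "soft_min \<phi> K t f = (INF s\<in>{0..}. \<phi> (f s) + K * \<bar>s - t\<bar>)"

text \<open>Paths are cadlag only almost surely, so path functionals agree with measurable ones only
  off a null set; measurability then survives in the completion.\<close>

lemma borel_measurable_completion_AE:
  assumes f: "f \<in> borel_measurable M" and "AE x in M. f x = g x"
  shows "g \<in> borel_measurable (completion M)"
proof -
  from assms(2) obtain N where N: "{x \<in> space M. f x \<noteq> g x} \<subseteq> N" "N \<in> null_sets M"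
    by (auto simp: eventually_ae_filter)
  show ?thesis
  proof (rule measurableI)
    fix A :: "'b set" assume A: "A \<in> sets borel"
    have eq: "g -` A \<inter> space M = (f -` A \<inter> space M - N) \<union> (N \<inter> (g -` A \<inter> space M))"
      using N(1) by auto
    have 1: "f -` A \<inter> space M - N \<in> sets (completion M)"
      using measurable_sets[OF f A] N(2) by auto
    have 2: "N \<inter> (g -` A \<inter> space M) \<in> sets (completion M)"
      by (rule sets_completionI_sub[OF N(2)]) auto
    show "g -` A \<inter> space (completion M) \<in> sets (completion M)"
      unfolding space_completion by (subst eq) (rule sets.Un[OF 1 2])
  qed simp
qed

locale bounded_Lipschitz =
  fixes \<phi> :: "'v::metric_space \<Rightarrow> real" and b L :: real
  assumes bounded: "\<bar>\<phi> x\<bar> \<le> b" and Lipschitz: "\<bar>\<phi> x - \<phi> y\<bar> \<le> L * dist x y" and L: "0 \<le> L"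
begin

lemma phi_bounds: "- b \<le> \<phi> x" "\<phi> x \<le> b"
  using bounded[of x] by linarith+

lemma continuous_phi: "continuous_on A \<phi>"
  unfolding continuous_on_iff
proof (intro ballI allI impI)
  fix x e :: real and y assume "0 < e"
  show "\<exists>d>0. \<forall>x'\<in>A. dist x' y < d \<longrightarrow> dist (\<phi> x') (\<phi> y) < e"
  proof (intro exI conjI ballI impI)
    show "0 < e / (L + 1)" using \<open>0 < e\<close> L by simp
    fix x' assume "dist x' y < e / (L + 1)"
    then have "(L + 1) * dist x' y < e" using L by (simp add: pos_less_divide_eq mult_ac)
    then show "dist (\<phi> x') (\<phi> y) < e"
      using Lipschitz[of x' y] zero_le_dist[of x' y] unfolding dist_real_def distrib_right by linarith
  qed
qed

lemma measurable_phi[measurable]: "\<phi> \<in> borel_measurable borel"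
  by (rule borel_measurable_continuous_onI[OF continuous_phi])

context
  fixes K t :: real
  assumes K: "0 < K" and t: "0 \<le> t"
begin

lemma bdd_below_soft_min: "bdd_below ((\<lambda>s. \<phi> (f s) + K * \<bar>s - t\<bar>) ` S)"
proof (rule bdd_belowI2)
  fix s
  have "0 \<le> K * \<bar>s - t\<bar>" using K by simp
  then show "- b \<le> \<phi> (f s) + K * \<bar>s - t\<bar>" using phi_bounds(1)[of "f s"] by linarith
qed

lemma soft_min_le: "0 \<le> s \<Longrightarrow> soft_min \<phi> K t f \<le> \<phi> (f s) + K * \<bar>s - t\<bar>"
  unfolding soft_min_def by (rule cINF_lower[OF bdd_below_soft_min]) simp

lemma soft_min_greatest: "(\<And>s. 0 \<le> s \<Longrightarrow> m \<le> \<phi> (f s) + K * \<bar>s - t\<bar>) \<Longrightarrow> m \<le> soft_min \<phi> K t f"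
  unfolding soft_min_def by (rule cINF_greatest) auto

lemma soft_min_bounds: "- b \<le> soft_min \<phi> K t f" "soft_min \<phi> K t f \<le> b"
proof -
  show "- b \<le> soft_min \<phi> K t f"
  proof (rule soft_min_greatest)
    fix s
    have "0 \<le> K * \<bar>s - t\<bar>" using K by simp
    then show "- b \<le> \<phi> (f s) + K * \<bar>s - t\<bar>" using phi_bounds(1)[of "f s"] by linarith
  qed
  show "soft_min \<phi> K t f \<le> b"
    using soft_min_le[of t f] t phi_bounds(2)[of "f t"] by simp
qed

text \<open>From \<open>t + 2 * b / K\<close> on the penalty is at least \<open>2 * b\<close>, so
  such times cannot beat the upper bound \<open>b\<close> of the infimum; the extra 1 in the horizon
  leaves room for a time change that moves points by less than \<delta>, at most 1. Within the
  horizon the value moves by at most \<open>L * \<delta>\<close> and the penalty by at most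
  \<open>K * \<delta>\<close>.\<close>

lemma soft_min_skorokhod_nhd:
  assumes g: "g \<in> skorokhod_nhd f (t + 1 + 2 * b / K) \<delta>" and \<delta>: "\<delta> \<le> 1"
  shows "\<bar>soft_min \<phi> K t g - soft_min \<phi> K t f\<bar> \<le> (L + K) * \<delta>"
proof -
  let ?N = "t + 1 + 2 * b / K"
  from g obtain \<theta> where \<theta>: "bij_betw \<theta> {0..} {0..}"
    and d1: "\<And>s. 0 \<le> s \<Longrightarrow> \<bar>\<theta> s - s\<bar> < \<delta>" and d2: "\<And>s. s \<in> {0..?N} \<Longrightarrow> dist (g (\<theta> s)) (f s) < \<delta>"
    unfolding skorokhod_nhd_def time_change_def by blast
  have \<delta>0: "0 < \<delta>" using d1[of 0] by linarith
  have far: "b \<le> \<phi> x + K * \<bar>s - t\<bar>" if "?N - 1 \<le> s" for s x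
  proof -
    have "2 * b / K \<le> s - t" using that by simp
    then have "2 * b \<le> K * (s - t)" using K by (simp add: pos_divide_le_eq mult_ac)
    also have "\<dots> \<le> K * \<bar>s - t\<bar>" using K by (intro mult_left_mono) auto
    finally show ?thesis using phi_bounds(1)[of x] by linarith
  qed
  have near: "\<bar>(\<phi> (g (\<theta> s)) + K * \<bar>\<theta> s - t\<bar>) - (\<phi> (f s) + K * \<bar>s - t\<bar>)\<bar> \<le> (L + K) * \<delta>"
    if "s \<in> {0..?N}" for s
  proof -
    have "\<bar>\<phi> (g (\<theta> s)) - \<phi> (f s)\<bar> \<le> L * \<delta>"
      using Lipschitz[of "g (\<theta> s)" "f s"] mult_left_mono[OF less_imp_le[OF d2[OF that]] L] by linarith
    moreover have "\<bar>K * \<bar>\<theta> s - t\<bar> - K * \<bar>s - t\<bar>\<bar> \<le> K * \<delta>"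
    proof -
      have "\<bar>K * \<bar>\<theta> s - t\<bar> - K * \<bar>s - t\<bar>\<bar> = K * \<bar>\<bar>\<theta> s - t\<bar> - \<bar>s - t\<bar>\<bar>"
        using K by (simp add: right_diff_distrib[symmetric] abs_mult)
      also have "\<dots> \<le> K * \<delta>"
        using d1[of s] that K by (intro mult_left_mono) auto
      finally show ?thesis .
    qed
    ultimately show ?thesis unfolding distrib_right by linarith
  qed
  have LK: "0 \<le> (L + K) * \<delta>" using L K \<delta>0 by simp
  have "soft_min \<phi> K t g - (L + K) * \<delta> \<le> soft_min \<phi> K t f"
  proof (rule soft_min_greatest)
    fix s :: real assume s: "0 \<le> s"
    show "soft_min \<phi> K t g - (L + K) * \<delta> \<le> \<phi> (f s) + K * \<bar>s - t\<bar>"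
    proof (cases "s \<le> ?N")
      case True
      have "0 \<le> \<theta> s" using \<theta> s bij_betwE by fastforce
      from soft_min_le[OF this, of g] near[of s] True s show ?thesis by simp
    next
      case False
      then show ?thesis using far[of s "f s"] soft_min_bounds(2)[of g] LK by linarith
    qed
  qed
  moreover have "soft_min \<phi> K t f - (L + K) * \<delta> \<le> soft_min \<phi> K t g"
  proof (rule soft_min_greatest)
    fix r :: real assume "0 \<le> r"
    then obtain s where s: "0 \<le> s" "\<theta> s = r"
      using \<theta> unfolding bij_betw_def by (metis atLeast_iff imageE)
    show "soft_min \<phi> K t f - (L + K) * \<delta> \<le> \<phi> (g r) + K * \<bar>r - t\<bar>"
    proof (cases "s \<le> ?N")
      case True
      from soft_min_le[OF s(1), of f] near[of s] True s show ?thesis by simp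
    next
      case False
      then have "?N - 1 \<le> r" using d1[OF s(1)] s(2) \<delta> by linarith
      then show ?thesis using far[of r "g r"] soft_min_bounds(2)[of f] LK by linarith
    qed
  qed
  ultimately show ?thesis by linarith
qed

lemma continuous_map_soft_min: "continuous_map skorokhod euclideanreal (soft_min \<phi> K t)"
  unfolding continuous_map_def
proof (intro conjI allI impI)
  fix U :: "real set" assume "openin euclideanreal U"
  then have U: "open U" by simp
  show "openin skorokhod {f \<in> topspace skorokhod. soft_min \<phi> K t f \<in> U}"
    unfolding openin_skorokhod topspace_skorokhod
  proof (intro conjI ballI)
    fix f assume "f \<in> {f \<in> cadlag. soft_min \<phi> K t f \<in> U}"
    then obtain e where e: "0 < e" "\<And>y. \<bar>y - soft_min \<phi> K t f\<bar> < e \<Longrightarrow> y \<in> U"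
      using U unfolding open_dist dist_real_def by blast
    define S where "S = L + K"
    have S: "0 < S" using K L by (simp add: S_def)
    define \<delta> where "\<delta> = min 1 (e / (2 * S))"
    have \<delta>: "0 < \<delta>" "\<delta> \<le> 1" using e S by (auto simp: \<delta>_def)
    have "S * \<delta> \<le> S * (e / (2 * S))"
      using S by (intro mult_left_mono) (auto simp: \<delta>_def)
    also have "\<dots> = e / 2" using S by simp
    finally have "(L + K) * \<delta> < e" using e by (simp add: S_def)
    then have "skorokhod_nhd f (t + 1 + 2 * b / K) \<delta> \<subseteq> {f \<in> cadlag. soft_min \<phi> K t f \<in> U}"
      using soft_min_skorokhod_nhd[OF _ \<delta>(2), of _ f] e(2) by (force simp: skorokhod_nhd_def)
    with \<delta>(1) show "\<exists>N. \<exists>\<delta>>0. skorokhod_nhd f N \<delta> \<subseteq> {f \<in> cadlag. soft_min \<phi> K t f \<in> U}"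
      by blast
  qed auto
qed auto

text \<open>By right continuity rational times just after \<open>s\<close> do almost as well as
  \<open>s\<close>. The countable infimum is what makes the functional measurable.\<close>

lemma soft_min_eq_rational:
  assumes f: "f \<in> cadlag"
  shows "soft_min \<phi> K t f = (INF s\<in>\<rat> \<inter> {0..}. \<phi> (f s) + K * \<bar>s - t\<bar>)"
proof (rule antisym)
  have ne: "\<rat> \<inter> {0::real..} \<noteq> {}" using Rats_0 by force
  show "soft_min \<phi> K t f \<le> (INF s\<in>\<rat> \<inter> {0..}. \<phi> (f s) + K * \<bar>s - t\<bar>)"
    by (rule cINF_greatest[OF ne]) (simp add: soft_min_le)
  show "(INF s\<in>\<rat> \<inter> {0..}. \<phi> (f s) + K * \<bar>s - t\<bar>) \<le> soft_min \<phi> K t f" (is "?m \<le> _")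
  proof (rule soft_min_greatest, rule ccontr)
    fix s :: real assume s: "0 \<le> s" and "\<not> ?m \<le> \<phi> (f s) + K * \<bar>s - t\<bar>"
    moreover have "((\<lambda>r. \<phi> (f r) + K * \<bar>r - t\<bar>) \<longlongrightarrow> \<phi> (f s) + K * \<bar>s - t\<bar>) (at_right s)"
    proof (intro tendsto_intros)
      have "(f \<longlongrightarrow> f s) (at_right s)" using f s unfolding cadlag_def by simp
      moreover have "isCont \<phi> (f s)"
        using continuous_phi[of UNIV] by (simp add: continuous_on_eq_continuous_at)
      ultimately show "((\<lambda>r. \<phi> (f r)) \<longlongrightarrow> \<phi> (f s)) (at_right s)"
        by (rule isCont_tendsto_compose[rotated])
    qed
    ultimately have "eventually (\<lambda>r. \<phi> (f r) + K * \<bar>r - t\<bar> < ?m) (at_right s)"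
      by (intro order_tendstoD(2)) auto
    then obtain u where u: "s < u" "\<And>r. s < r \<Longrightarrow> r < u \<Longrightarrow> \<phi> (f r) + K * \<bar>r - t\<bar> < ?m"
      unfolding eventually_at_right_field by blast
    obtain r where "r \<in> \<rat>" "s < r" "r < u" using Rats_dense_in_real[OF u(1)] by blast
    then show False
      using u(2)[of r] s cINF_lower[OF bdd_below_soft_min[of f "\<rat> \<inter> {0..}"], of r] by force
  qed
qed

lemma soft_min_completion:
  assumes meas: "\<And>s. 0 \<le> s \<Longrightarrow> Y s \<in> borel_measurable P"
    and cadlag: "AE p in P. (\<lambda>s. Y s p) \<in> cadlag"
  shows "(\<lambda>p. soft_min \<phi> K t (\<lambda>s. Y s p)) \<in> borel_measurable (completion P)"
proof (rule borel_measurable_completion_AE)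
  have [measurable]: "Y s \<in> borel_measurable P" if "s \<in> \<rat> \<inter> {0..}" for s
    using meas that by simp
  show "(\<lambda>p. INF s\<in>\<rat> \<inter> {0..}. \<phi> (Y s p) + K * \<bar>s - t\<bar>) \<in> borel_measurable P"
    by (rule borel_measurable_cINF) (auto intro: countable_rat bdd_below_soft_min)
  show "AE p in P. (INF s\<in>\<rat> \<inter> {0..}. \<phi> (Y s p) + K * \<bar>s - t\<bar>) = soft_min \<phi> K t (\<lambda>s. Y s p)"
    using cadlag by eventually_elim (simp add: soft_min_eq_rational)
qed

lemma integrable_soft_min_completion:
  assumes "prob_space P" and "\<And>s. 0 \<le> s \<Longrightarrow> Y s \<in> borel_measurable P"
    and "AE p in P. (\<lambda>s. Y s p) \<in> cadlag"
  shows "integrable (completion P) (\<lambda>p. soft_min \<phi> K t (\<lambda>s. Y s p))"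
proof -
  interpret P: prob_space "completion P" using assms(1) by (rule prob_space.prob_space_completion)
  show ?thesis
    using soft_min_bounds soft_min_completion[OF assms(2,3)]
    by (intro P.integrable_const_bound[where B = b] AE_I2) (auto simp: abs_le_iff minus_le_iff)
qed

end

text \<open>For a large penalty only times close to \<open>t\<close> compete, and there continuity
  of the path keeps \<phi> near its value at \<open>t\<close>.\<close>

lemma soft_min_tendsto:
  assumes t: "0 \<le> t" and f: "continuous_on {0..} f"
  shows "(\<lambda>n. soft_min \<phi> (real (Suc n)) t f) \<longlonglongrightarrow> \<phi> (f t)"
proof (rule LIMSEQ_I)
  fix e :: real assume e: "0 < e"
  have "continuous_on {0..} (\<lambda>s. \<phi> (f s))"
    by (rule continuous_on_compose2[OF continuous_phi[of UNIV] f]) auto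
  then obtain d where d: "0 < d" "\<And>s. 0 \<le> s \<Longrightarrow> \<bar>s - t\<bar> < d \<Longrightarrow> \<bar>\<phi> (f s) - \<phi> (f t)\<bar> < e / 2"
    using t e unfolding continuous_on_iff dist_real_def
    by (metis atLeast_iff half_gt_zero)
  obtain N where N: "2 * b / d < real N" using reals_Archimedean2 by blast
  show "\<exists>no. \<forall>n\<ge>no. norm (soft_min \<phi> (real (Suc n)) t f - \<phi> (f t)) < e"
  proof (intro exI allI impI)
    fix n assume n: "N \<le> n"
    have K: "0 < real (Suc n)" by simp
    have "soft_min \<phi> (real (Suc n)) t f \<le> \<phi> (f t)"
      using soft_min_le[OF K t t, of f] by simp
    moreover have "\<phi> (f t) - e / 2 \<le> soft_min \<phi> (real (Suc n)) t f"
    proof (rule soft_min_greatest[OF K t])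
      fix s :: real assume s: "0 \<le> s"
      show "\<phi> (f t) - e / 2 \<le> \<phi> (f s) + real (Suc n) * \<bar>s - t\<bar>"
      proof (cases "\<bar>s - t\<bar> < d")
        case True
        have "0 \<le> real (Suc n) * \<bar>s - t\<bar>" by simp
        then show ?thesis using d(2)[OF s True] by linarith
      next
        case False
        have "2 * b / d \<le> real (Suc n)" using N n by linarith
        then have "2 * b \<le> real (Suc n) * d" using d by (simp add: pos_divide_le_eq)
        also have "\<dots> \<le> real (Suc n) * \<bar>s - t\<bar>" using False by (intro mult_left_mono) auto
        finally show ?thesis using phi_bounds(2)[of "f t"] phi_bounds(1)[of "f s"] e by linarith
      qed
    qed
    ultimately show "norm (soft_min \<phi> (real (Suc n)) t f - \<phi> (f t)) < e"
      using e by simp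
  qed
qed

text \<open>The penalised infimum is compared with evaluation differently on the two sides. For the
  prelimit only \<open>soft_min \<le> \<phi> (X s) + K * |s - t|\<close> is used, which holds for
  every path, jumps included. For the limit process continuity of paths makes the infimum nearly
  equal to evaluation. The three thirds of \<open>e\<close> pay for the choice of \<open>K\<close>,
  the convergence in law, and the displacement of \<open>s n\<close> from \<open>t\<close>.\<close>

lemma converges_in_law_liminf:
  fixes X :: "real \<Rightarrow> real \<Rightarrow> 'p \<Rightarrow> 'v" and B :: "real \<Rightarrow> 'b \<Rightarrow> 'v"
  assumes conv: "converges_in_law P X W B"
    and P: "prob_space P" and W: "prob_space W"
    and X: "\<And>\<epsilon> s. 0 < \<epsilon> \<Longrightarrow> 0 \<le> s \<Longrightarrow> X \<epsilon> s \<in> borel_measurable P"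
    and B: "\<And>s. 0 \<le> s \<Longrightarrow> B s \<in> borel_measurable W"
    and cont: "AE w in W. continuous_on {0..} (\<lambda>s. B s w)"
    and \<epsilon>: "\<And>n. 0 < \<epsilon> n" "\<epsilon> \<longlonglongrightarrow> 0" and s: "\<And>n. 0 \<le> s n" "s \<longlonglongrightarrow> t"
    and e: "0 < e"
  shows "eventually (\<lambda>n. (\<integral>w. \<phi> (B t w) \<partial>W) - e < (\<integral>p. \<phi> (X (\<epsilon> n) (s n) p) \<partial>P)) sequentially"
proof -
  interpret P: prob_space P by fact
  interpret W: prob_space W by fact
  interpret PC: prob_space "completion P" by (rule P.prob_space_completion)
  interpret WC: prob_space "completion W" by (rule W.prob_space_completion)
  have t: "0 \<le> t" using s by (intro LIMSEQ_le_const[OF s(2)]) auto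
  note [measurable] = B[OF t]
  have cadX: "AE p in P. (\<lambda>t. X \<epsilon> t p) \<in> cadlag" if "0 < \<epsilon>" for \<epsilon>
    using conv that unfolding converges_in_law_def by blast
  have cadB: "AE w in W. (\<lambda>t. B t w) \<in> cadlag"
    using conv unfolding converges_in_law_def by blast
  have "(\<lambda>n. \<integral>w. soft_min \<phi> (real (Suc n)) t (\<lambda>s. B s w) \<partial>completion W) \<longlonglongrightarrow>
      (\<integral>w. \<phi> (B t w) \<partial>completion W)"
  proof (rule integral_dominated_convergence[where w = "\<lambda>_. b"])
    show "(\<lambda>w. \<phi> (B t w)) \<in> borel_measurable (completion W)"
      by (intro measurable_completion) measurable
    show "(\<lambda>w. soft_min \<phi> (real (Suc n)) t (\<lambda>s. B s w)) \<in> borel_measurable (completion W)" for n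
      by (rule soft_min_completion[OF _ t _ cadB]) (use B in auto)
    show "AE w in completion W. (\<lambda>n. soft_min \<phi> (real (Suc n)) t (\<lambda>s. B s w)) \<longlonglongrightarrow> \<phi> (B t w)"
    proof (rule AE_completion)
      show "AE w in W. (\<lambda>n. soft_min \<phi> (real (Suc n)) t (\<lambda>s. B s w)) \<longlonglongrightarrow> \<phi> (B t w)"
        using cont by eventually_elim (rule soft_min_tendsto[OF t])
    qed
    show "AE w in completion W. norm (soft_min \<phi> (real (Suc n)) t (\<lambda>s. B s w)) \<le> b" for n
      using soft_min_bounds[of "real (Suc n)" t] t by (auto simp: abs_le_iff minus_le_iff)
  qed auto
  also have "(\<integral>w. \<phi> (B t w) \<partial>completion W) = (\<integral>w. \<phi> (B t w) \<partial>W)"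
    by (rule integral_completion) measurable
  finally have "eventually (\<lambda>n. (\<integral>w. \<phi> (B t w) \<partial>W) - e / 3 <
      (\<integral>w. soft_min \<phi> (real (Suc n)) t (\<lambda>s. B s w) \<partial>completion W)) sequentially"
    using e by (intro order_tendstoD(1)) auto
  \<comment> \<open>The penalty is fixed here, from the limit process alone, before \<open>n\<close>
    grows.\<close>
  then obtain m where "(\<integral>w. \<phi> (B t w) \<partial>W) - e / 3 <
      (\<integral>w. soft_min \<phi> (real (Suc m)) t (\<lambda>s. B s w) \<partial>completion W)"
    unfolding eventually_sequentially by blast
  moreover define K where "K = real (Suc m)"
  ultimately have K: "0 < K" and 1: "(\<integral>w. \<phi> (B t w) \<partial>W) - e / 3 <
      (\<integral>w. soft_min \<phi> K t (\<lambda>s. B s w) \<partial>completion W)"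
    by auto
  let ?F = "soft_min \<phi> K t"
  have "bounded (?F ` cadlag)"
    using soft_min_bounds[OF K t] by (intro boundedI[of _ b]) (auto simp: abs_le_iff minus_le_iff)
  then have "((\<lambda>\<epsilon>. \<integral>p. ?F (\<lambda>t. X \<epsilon> t p) \<partial>completion P) \<longlongrightarrow> (\<integral>w. ?F (\<lambda>t. B t w) \<partial>completion W)) (at_right 0)"
    using conv continuous_map_soft_min[OF K t] unfolding converges_in_law_def by blast
  moreover have "filterlim \<epsilon> (at_right 0) sequentially"
    using \<epsilon>(2) by (simp add: filterlim_at \<epsilon>(1) less_imp_neq[OF \<epsilon>(1), symmetric])
  ultimately have "(\<lambda>n. \<integral>p. ?F (\<lambda>t. X (\<epsilon> n) t p) \<partial>completion P) \<longlonglongrightarrow> (\<integral>w. ?F (\<lambda>t. B t w) \<partial>completion W)"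
    by (rule filterlim_compose)
  then have 2: "eventually (\<lambda>n. (\<integral>w. ?F (\<lambda>t. B t w) \<partial>completion W) - e / 3 <
      (\<integral>p. ?F (\<lambda>t. X (\<epsilon> n) t p) \<partial>completion P)) sequentially"
    using e by (intro order_tendstoD(1)) auto
  have "(\<lambda>n. K * \<bar>s n - t\<bar>) \<longlonglongrightarrow> K * \<bar>t - t\<bar>"
    by (intro tendsto_intros s)
  then have 3: "eventually (\<lambda>n. K * \<bar>s n - t\<bar> < e / 3) sequentially"
    using e by (intro order_tendstoD(2)) auto
  show ?thesis
    using 2 3
  proof eventually_elim
    case (elim n)
    have [measurable]: "X (\<epsilon> n) (s n) \<in> borel_measurable P" by (rule X[OF \<epsilon>(1) s(1)])
    have int: "integrable P (\<lambda>p. \<phi> (X (\<epsilon> n) (s n) p))"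
      using bounded by (intro P.integrable_const_bound[where B = b]) auto
    have "(\<integral>p. ?F (\<lambda>t. X (\<epsilon> n) t p) \<partial>completion P) \<le> (\<integral>p. \<phi> (X (\<epsilon> n) (s n) p) + K * \<bar>s n - t\<bar> \<partial>completion P)"
    proof (rule integral_mono)
      show "integrable (completion P) (\<lambda>p. ?F (\<lambda>t. X (\<epsilon> n) t p))"
        by (rule integrable_soft_min_completion[OF K t P _ cadX[OF \<epsilon>(1)]]) (rule X[OF \<epsilon>(1)])
      show "integrable (completion P) (\<lambda>p. \<phi> (X (\<epsilon> n) (s n) p) + K * \<bar>s n - t\<bar>)"
        using int by (intro Bochner_Integration.integrable_add PC.integrable_const integrable_completion[THEN iffD2]) auto
    qed (rule soft_min_le[OF K t s(1)])
    also have "\<dots> = (\<integral>p. \<phi> (X (\<epsilon> n) (s n) p) + K * \<bar>s n - t\<bar> \<partial>P)"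
      by (rule integral_completion) measurable
    also have "\<dots> = (\<integral>p. \<phi> (X (\<epsilon> n) (s n) p) \<partial>P) + K * \<bar>s n - t\<bar>"
      using int by (simp add: P.prob_space)
    finally show ?case using elim 1 by linarith
  qed
qed

end

text \<open>The lower bound is applied to \<phi> and to its negative. The times \<open>s n\<close>
  may vary because the scale used later turns the times of the walk only asymptotically into a fixed
  macroscopic time.\<close>

lemma converges_in_law_marginal:
  fixes X :: "real \<Rightarrow> real \<Rightarrow> 'p \<Rightarrow> 'v::metric_space" and B :: "real \<Rightarrow> 'b \<Rightarrow> 'v"
  assumes conv: "converges_in_law P X W B"
    and P: "prob_space P" and W: "prob_space W"
    and X: "\<And>\<epsilon> s. 0 < \<epsilon> \<Longrightarrow> 0 \<le> s \<Longrightarrow> X \<epsilon> s \<in> borel_measurable P"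
    and B: "\<And>s. 0 \<le> s \<Longrightarrow> B s \<in> borel_measurable W"
    and cont: "AE w in W. continuous_on {0..} (\<lambda>s. B s w)"
    and \<epsilon>: "\<And>n. 0 < \<epsilon> n" "\<epsilon> \<longlonglongrightarrow> 0" and s: "\<And>n. 0 \<le> s n" "s \<longlonglongrightarrow> t"
    and \<phi>: "bounded_Lipschitz \<phi> b L"
  shows "(\<lambda>n. \<integral>p. \<phi> (X (\<epsilon> n) (s n) p) \<partial>P) \<longlonglongrightarrow> (\<integral>w. \<phi> (B t w) \<partial>W)"
proof (rule LIMSEQ_I)
  fix e :: real assume e: "0 < e"
  interpret pl: bounded_Lipschitz \<phi> b L by fact
  interpret mi: bounded_Lipschitz "\<lambda>x. - \<phi> x" b L
    by standard (use pl.bounded pl.Lipschitz pl.L in \<open>auto simp: abs_minus_commute\<close>)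
  have "eventually (\<lambda>n. norm ((\<integral>p. \<phi> (X (\<epsilon> n) (s n) p) \<partial>P) - (\<integral>w. \<phi> (B t w) \<partial>W)) < e) sequentially"
  proof -
    have "eventually (\<lambda>n. (\<integral>w. \<phi> (B t w) \<partial>W) - e < (\<integral>p. \<phi> (X (\<epsilon> n) (s n) p) \<partial>P)) sequentially"
      by (rule pl.converges_in_law_liminf[OF conv P W _ _ cont \<epsilon> s e]) (use X B in auto)
    moreover have "eventually (\<lambda>n. (\<integral>w. - \<phi> (B t w) \<partial>W) - e < (\<integral>p. - \<phi> (X (\<epsilon> n) (s n) p) \<partial>P)) sequentially"
      by (rule mi.converges_in_law_liminf[OF conv P W _ _ cont \<epsilon> s e]) (use X B in auto)
    ultimately show ?thesis by eventually_elim auto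
  qed
  then show "\<exists>no. \<forall>n\<ge>no. norm ((\<integral>p. \<phi> (X (\<epsilon> n) (s n) p) \<partial>P) - (\<integral>w. \<phi> (B t w) \<partial>W)) < e"
    unfolding eventually_sequentially .
qed

section \<open>Tent functions and the Gaussian kernel\<close>

text \<open>A product of triangles is Lipschitz with compact support, and its total is exactly the
  d-th power of the width, both as an integral over space and, for integer width, as a sum over the
  lattice.\<close>

definition tent :: "real \<Rightarrow> real ^ 'd::finite \<Rightarrow> real" where
  "tent \<delta> x = (\<Prod>i\<in>UNIV. max 0 (1 - \<bar>x $ i\<bar> / \<delta>))"

lemma tent_nonneg: "0 \<le> tent \<delta> x"
  unfolding tent_def by (rule prod_nonneg) simp

lemma tent_le_1: "0 < \<delta> \<Longrightarrow> tent \<delta> x \<le> 1"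
  unfolding tent_def by (rule prod_le_1) simp

lemma tent_eq_0: "0 < \<delta> \<Longrightarrow> \<delta> \<le> \<bar>x $ i\<bar> \<Longrightarrow> tent \<delta> x = 0"
  unfolding tent_def by (rule prod_zero[OF _ bexI[of _ i]]) (auto simp: le_divide_eq)

lemma ennreal_tent: "ennreal (tent \<delta> x) = (\<Prod>i\<in>UNIV. ennreal (max 0 (1 - \<bar>x $ i\<bar> / \<delta>)))"
  unfolding tent_def by (rule prod_ennreal[symmetric]) simp

lemma tent_scale: "0 < a \<Longrightarrow> tent (a * \<delta>) (a *\<^sub>R x) = tent \<delta> x"
  by (simp add: tent_def abs_mult)

lemma tent_Lipschitz:
  fixes x y :: "real ^ 'd::finite"
  assumes \<delta>: "0 < \<delta>"
  shows "\<bar>tent \<delta> x - tent \<delta> y\<bar> \<le> real CARD('d) / \<delta> * dist x y"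
proof -
  have "\<bar>tent \<delta> x - tent \<delta> y\<bar> \<le>
      (\<Sum>i\<in>UNIV. norm (max 0 (1 - \<bar>x $ i\<bar> / \<delta>) - max 0 (1 - \<bar>y $ i\<bar> / \<delta>)))"
    unfolding tent_def real_norm_def[symmetric] by (rule norm_prod_diff) (use \<delta> in auto)
  also have "\<dots> \<le> (\<Sum>i\<in>(UNIV::'d set). dist x y / \<delta>)"
  proof (rule sum_mono)
    fix i
    have "\<bar>x $ i - y $ i\<bar> \<le> dist x y"
      using component_le_norm_cart[of "x - y" i] by (simp add: dist_norm)
    then have "\<bar>\<bar>x $ i\<bar> - \<bar>y $ i\<bar>\<bar> \<le> dist x y" by linarith
    then have "\<bar>\<bar>x $ i\<bar> - \<bar>y $ i\<bar>\<bar> / \<delta> \<le> dist x y / \<delta>" using \<delta> by (intro divide_right_mono) auto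
    then have "\<bar>\<bar>x $ i\<bar> / \<delta> - \<bar>y $ i\<bar> / \<delta>\<bar> \<le> dist x y / \<delta>"
      using \<delta> by (simp add: diff_divide_distrib[symmetric] abs_divide)
    then show "norm (max 0 (1 - \<bar>x $ i\<bar> / \<delta>) - max 0 (1 - \<bar>y $ i\<bar> / \<delta>)) \<le> dist x y / \<delta>"
      unfolding real_norm_def by linarith
  qed
  finally show ?thesis by simp
qed

lemma norm_le_of_tent:
  fixes x :: "real ^ 'd::finite"
  assumes "0 < \<delta>" "tent \<delta> x \<noteq> 0"
  shows "norm x \<le> real CARD('d) * \<delta>"
proof -
  have "\<bar>x $ i\<bar> \<le> \<delta>" for i using tent_eq_0[of \<delta> x i] assms by force
  then have "(\<Sum>i\<in>UNIV. \<bar>x $ i\<bar>) \<le> (\<Sum>i\<in>(UNIV::'d set). \<delta>)" by (intro sum_mono)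
  then show ?thesis using norm_le_l1_cart[of x] by simp
qed

lemma bounded_Lipschitz_tent:
  fixes z :: "real ^ 'd::finite"
  assumes "0 < \<delta>"
  shows "bounded_Lipschitz (\<lambda>x. tent \<delta> (z - x)) 1 (real CARD('d) / \<delta>)"
proof
  fix x y
  show "\<bar>tent \<delta> (z - x)\<bar> \<le> 1" using tent_nonneg[of \<delta> "z - x"] tent_le_1[OF assms, of "z - x"] by simp
  show "\<bar>tent \<delta> (z - x) - tent \<delta> (z - y)\<bar> \<le> real CARD('d) / \<delta> * dist x y"
    using tent_Lipschitz[OF assms, of "z - x" "z - y"] by (simp add: dist_norm norm_minus_commute)
qed (use assms in simp)

lemma sum_triangle_int: "(\<Sum>j\<in>{- int m..int m}. real m - \<bar>real_of_int j\<bar>) = (real m)\<^sup>2"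
proof (induction m)
  case (Suc m)
  have "{- int (Suc m)..int (Suc m)} = insert (int (Suc m)) (insert (- int (Suc m)) {- int m..int m})"
    by auto
  then have "(\<Sum>j\<in>{- int (Suc m)..int (Suc m)}. real (Suc m) - \<bar>real_of_int j\<bar>) =
      (\<Sum>j\<in>{- int m..int m}. (real m - \<bar>real_of_int j\<bar>) + 1)"
    by (simp add: algebra_simps)
  also have "\<dots> = (real m)\<^sup>2 + (2 * real m + 1)"
    by (simp only: sum.distrib Suc) (simp add: nat_add_distrib)
  finally show ?case by (simp add: power2_eq_square algebra_simps)
qed simp

text \<open>The sum of \<open>m - |j|\<close> over \<open>|j| \<le> m\<close> is \<open>m^2\<close>,
  so at integer width the normalised weights form a probability on shifts without any discretisation
  error.\<close>

lemma nn_integral_tent_lattice: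
  assumes m: "0 < m"
  shows "(\<integral>\<^sup>+h. ennreal (tent (real m) (emb h)) \<partial>count_space (UNIV :: (int ^ 'd::finite) set)) =
    ennreal (real m ^ CARD('d))"
proof -
  have "(\<integral>\<^sup>+j. ennreal (max 0 (1 - \<bar>real_of_int j\<bar> / real m)) \<partial>count_space UNIV) = ennreal (real m)"
  proof -
    have "(\<integral>\<^sup>+j. ennreal (max 0 (1 - \<bar>real_of_int j\<bar> / real m)) \<partial>count_space UNIV) =
      (\<Sum>j\<in>{- int m..int m}. ennreal (max 0 (1 - \<bar>real_of_int j\<bar> / real m)))"
    proof (rule nn_integral_count_space')
      fix j :: int assume "j \<notin> {- int m..int m}"
      then have "real m \<le> \<bar>real_of_int j\<bar>" by auto
      then show "ennreal (max 0 (1 - \<bar>real_of_int j\<bar> / real m)) = 0" using m by simp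
    qed auto
    also have "\<dots> = ennreal (\<Sum>j\<in>{- int m..int m}. max 0 (1 - \<bar>real_of_int j\<bar> / real m))"
      by (rule sum_ennreal) simp
    also have "(\<Sum>j\<in>{- int m..int m}. max 0 (1 - \<bar>real_of_int j\<bar> / real m)) =
       (\<Sum>j\<in>{- int m..int m}. (real m - \<bar>real_of_int j\<bar>) / real m)"
    proof (rule sum.cong)
      fix j assume "j \<in> {- int m..int m}"
      then have "\<bar>real_of_int j\<bar> \<le> real m" by auto
      then show "max 0 (1 - \<bar>real_of_int j\<bar> / real m) = (real m - \<bar>real_of_int j\<bar>) / real m"
        using m by (simp add: diff_divide_distrib)
    qed simp
    also have "\<dots> = real m"
      unfolding sum_divide_distrib[symmetric] sum_triangle_int using m by (simp add: power2_eq_square)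
    finally show ?thesis .
  qed
  then show ?thesis
    unfolding ennreal_tent emb_def
    using nn_integral_prod_lattice[of "\<lambda>(i::'d) j. ennreal (max 0 (1 - \<bar>real_of_int j\<bar> / real m))"]
    by (simp add: ennreal_power)
qed

lemma prod_Basis_cart: "(\<Prod>b\<in>(Basis :: (real ^ 'd::finite) set). g b) = (\<Prod>i\<in>UNIV. g (axis i 1))"
proof -
  have B: "(Basis :: (real ^ 'd) set) = (\<lambda>i. axis i 1) ` UNIV"
    by (auto simp: Basis_vec_def)
  have inj: "inj (\<lambda>i::'d. axis i (1::real))"
    by (auto simp: inj_on_def axis_eq_axis)
  show ?thesis unfolding B by (subst prod.reindex[OF inj]) simp
qed

lemma nn_integral_triangle:
  assumes \<delta>: "0 < \<delta>"
  shows "(\<integral>\<^sup>+x. ennreal (max 0 (1 - \<bar>a - x\<bar> / \<delta>)) \<partial>lborel) = ennreal \<delta>"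
proof -
  let ?f = "\<lambda>x. ennreal (1 - (a - x) / \<delta>) * indicator {a - \<delta>..a} x"
  let ?g = "\<lambda>x. ennreal (1 - (x - a) / \<delta>) * indicator {a..a + \<delta>} x"
  have "(\<integral>\<^sup>+x. ennreal (max 0 (1 - \<bar>a - x\<bar> / \<delta>)) \<partial>lborel) = (\<integral>\<^sup>+x. ?f x + ?g x \<partial>lborel)"
  proof (rule nn_integral_cong_AE)
    show "AE x in lborel. ennreal (max 0 (1 - \<bar>a - x\<bar> / \<delta>)) = ?f x + ?g x"
      using AE_lborel_singleton[of a]
    proof eventually_elim
      fix x assume "x \<noteq> a"
      have "1 - \<bar>a - x\<bar> / \<delta> \<le> 0" if "\<delta> \<le> \<bar>a - x\<bar>" using that \<delta> by (simp add: le_divide_eq)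
      moreover have "0 \<le> 1 - \<bar>a - x\<bar> / \<delta>" if "\<bar>a - x\<bar> \<le> \<delta>" using that \<delta> by (simp add: divide_le_eq)
      ultimately show "ennreal (max 0 (1 - \<bar>a - x\<bar> / \<delta>)) = ?f x + ?g x"
        using \<open>x \<noteq> a\<close> \<delta> by (cases "x < a") (auto split: split_indicator simp: max_def abs_minus_commute)
    qed
  qed
  also have "\<dots> = (\<integral>\<^sup>+x. ?f x \<partial>lborel) + (\<integral>\<^sup>+x. ?g x \<partial>lborel)"
    by (rule nn_integral_add) auto
  also have "(\<integral>\<^sup>+x. ?f x \<partial>lborel) = ennreal ((a + (a - a)\<^sup>2 / (2 * \<delta>)) - ((a - \<delta>) + (a - (a - \<delta>))\<^sup>2 / (2 * \<delta>)))"
    using \<delta> by (intro nn_integral_FTC_Icc[where F = "\<lambda>x. x + (a - x)\<^sup>2 / (2 * \<delta>)"])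
      (auto intro!: derivative_eq_intros simp: field_simps)
  also have "(\<integral>\<^sup>+x. ?g x \<partial>lborel) = ennreal (((a + \<delta>) - (a + \<delta> - a)\<^sup>2 / (2 * \<delta>)) - (a - (a - a)\<^sup>2 / (2 * \<delta>)))"
    using \<delta> by (intro nn_integral_FTC_Icc[where F = "\<lambda>x. x - (x - a)\<^sup>2 / (2 * \<delta>)"])
      (auto intro!: derivative_eq_intros simp: field_simps)
  also have "ennreal ((a + (a - a)\<^sup>2 / (2 * \<delta>)) - ((a - \<delta>) + (a - (a - \<delta>))\<^sup>2 / (2 * \<delta>))) +
      ennreal (((a + \<delta>) - (a + \<delta> - a)\<^sup>2 / (2 * \<delta>)) - (a - (a - a)\<^sup>2 / (2 * \<delta>))) = ennreal \<delta>"
    using \<delta> by (subst ennreal_plus[symmetric]) (auto simp: power2_eq_square)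
  finally show ?thesis .
qed

lemma measurable_tent[measurable]: "tent \<delta> \<in> borel_measurable borel"
  unfolding tent_def[abs_def] divide_inverse by (intro borel_measurable_continuous_onI continuous_intros)

lemma nn_integral_tent:
  fixes z :: "real ^ 'd::finite"
  assumes \<delta>: "0 < \<delta>"
  shows "(\<integral>\<^sup>+x. ennreal (tent \<delta> (z - x)) \<partial>lborel) = ennreal (\<delta> ^ CARD('d))"
proof -
  have "(\<integral>\<^sup>+x. ennreal (tent \<delta> (z - x)) \<partial>lborel) =
     (\<integral>\<^sup>+x. (\<Prod>b\<in>Basis. ennreal (max 0 (1 - \<bar>z \<bullet> b - x \<bullet> b\<bar> / \<delta>))) \<partial>lborel)"
    unfolding ennreal_tent prod_Basis_cart by (simp add: inner_axis)
  also have "\<dots> = (\<Prod>b\<in>(Basis :: (real ^ 'd) set). \<integral>\<^sup>+x. ennreal (max 0 (1 - \<bar>z \<bullet> b - x\<bar> / \<delta>)) \<partial>lborel)"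
    by (rule nn_integral_lborel_prod) auto
  also have "\<dots> = ennreal (\<delta> ^ CARD('d))"
    unfolding nn_integral_triangle[OF \<delta>] using \<delta> by (simp add: ennreal_power)
  finally show ?thesis .
qed

lemma prod_normal_density_eq_gauss_kernel:
  fixes x :: "real ^ 'd::finite"
  assumes \<sigma>: "0 < \<sigma>" and t: "0 < t"
  shows "(\<Prod>i\<in>UNIV. normal_density 0 (\<sigma> * sqrt t) (x $ i)) = gauss_kernel \<sigma> t x"
proof -
  let ?v = "2 * pi * t * \<sigma>\<^sup>2"
  have v: "0 < ?v" using \<sigma> t by simp
  have s2: "(\<sigma> * sqrt t)\<^sup>2 = \<sigma>\<^sup>2 * t" using t by (simp add: power_mult_distrib)
  have "(\<Prod>i\<in>UNIV. normal_density 0 (\<sigma> * sqrt t) (x $ i)) =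
      (\<Prod>i\<in>(UNIV::'d set). 1 / sqrt ?v) * (\<Prod>i\<in>UNIV. exp (- (x $ i)\<^sup>2 / (2 * \<sigma>\<^sup>2 * t)))"
    unfolding prod.distrib[symmetric] normal_density_def s2 by (simp add: mult_ac)
  also have "(\<Prod>i\<in>(UNIV::'d set). 1 / sqrt ?v) = ?v powr (- real CARD('d) / 2)"
  proof -
    have "(\<Prod>i\<in>(UNIV::'d set). 1 / sqrt ?v) = (?v powr (- (1 / 2))) ^ CARD('d)"
      using v by (simp add: powr_minus powr_half_sqrt inverse_eq_divide)
    also have "\<dots> = ?v powr (- (1 / 2) * real CARD('d))"
      using v by (subst powr_realpow[symmetric]) (auto simp: powr_powr)
    finally show ?thesis by simp
  qed
  also have "(\<Prod>i\<in>UNIV. exp (- (x $ i)\<^sup>2 / (2 * \<sigma>\<^sup>2 * t))) = exp (\<Sum>i\<in>UNIV. - (x $ i)\<^sup>2 / (2 * \<sigma>\<^sup>2 * t))"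
    by (rule exp_sum[symmetric]) simp
  also have "(\<Sum>i\<in>UNIV. - (x $ i)\<^sup>2 / (2 * \<sigma>\<^sup>2 * t)) = - (norm x)\<^sup>2 / (2 * \<sigma>\<^sup>2 * t)"
    unfolding power2_norm_eq_inner inner_vec_def
    by (simp add: sum_divide_distrib sum_negf power2_eq_square)
  finally show ?thesis unfolding gauss_kernel_def .
qed

lemma gauss_kernel_nonneg: "0 \<le> gauss_kernel \<sigma> t x"
  unfolding gauss_kernel_def by simp

text \<open>Densities are prescribed for increments; the start at 0 makes the value at
  \<open>t\<close> one of them.\<close>

lemma brownian_motion_expectation:
  fixes B :: "real \<Rightarrow> 'b \<Rightarrow> real ^ 'd::finite"
  assumes BM: "brownian_motion \<sigma> W B" and \<sigma>: "0 < \<sigma>" and t: "0 < t"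
    and g[measurable]: "g \<in> borel_measurable borel"
  shows "(\<integral>w. g (B t w) \<partial>W) = (\<integral>x. gauss_kernel \<sigma> t x * (g x :: real) \<partial>lborel)"
proof -
  have B[measurable]: "B s \<in> borel_measurable W" if "0 \<le> s" for s
    using BM that unfolding brownian_motion_def by blast
  have [measurable]: "B t \<in> borel_measurable W" "B 0 \<in> borel_measurable W" using t by (auto intro: B)
  have "distributed W lborel (\<lambda>w. B t w - B 0 w)
      (\<lambda>x. ennreal (\<Prod>i\<in>UNIV. normal_density 0 (\<sigma> * sqrt (t - 0)) (x $ i)))"
    using BM t unfolding brownian_motion_def by blast
  then have D: "distributed W lborel (\<lambda>w. B t w - B 0 w) (\<lambda>x. ennreal (gauss_kernel \<sigma> t x))"
    by (simp add: prod_normal_density_eq_gauss_kernel[OF \<sigma> t])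
  have "(\<integral>w. g (B t w) \<partial>W) = (\<integral>w. g (B t w - B 0 w) \<partial>W)"
  proof (rule integral_cong_AE)
    have "AE w in W. B 0 w = 0" using BM unfolding brownian_motion_def by blast
    then show "AE w in W. g (B t w) = g (B t w - B 0 w)" by eventually_elim simp
  qed measurable
  also have "\<dots> = (\<integral>x. gauss_kernel \<sigma> t x * g x \<partial>lborel)"
    by (rule distributed_integral[OF D, symmetric]) (auto simp: gauss_kernel_nonneg)
  finally show ?thesis .
qed

text \<open>The tent has total mass \<open>\<delta> ^ d\<close> and is supported within distance
  \<open>d * \<delta>\<close> of its centre, where the Gaussian is nearly the constant
  \<open>k0\<close>.\<close>

lemma brownian_tent_estimate:
  fixes B :: "real \<Rightarrow> 'b \<Rightarrow> real ^ 'd::finite"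
  assumes BM: "brownian_motion \<sigma> W B" and \<sigma>: "0 < \<sigma>" and t: "0 < t" and \<delta>: "0 < \<delta>"
    and near: "\<And>\<xi>. dist \<zeta> \<xi> \<le> real CARD('d) * \<delta> \<Longrightarrow> \<bar>gauss_kernel \<sigma> t \<xi> - k0\<bar> \<le> \<kappa>"
  shows "\<bar>(\<integral>w. tent \<delta> (\<zeta> - B t w) \<partial>W) - \<delta> ^ CARD('d) * k0\<bar> \<le> \<kappa> * \<delta> ^ CARD('d)"
proof -
  let ?T = "\<lambda>\<xi>. tent \<delta> (\<zeta> - \<xi>)"
  have [measurable]: "(\<lambda>\<xi>. gauss_kernel \<sigma> t \<xi>) \<in> borel_measurable borel"
    unfolding gauss_kernel_def by measurable
  have T: "integrable lborel ?T" and T1: "(\<integral>\<xi>. ?T \<xi> \<partial>lborel) = \<delta> ^ CARD('d)"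
    using nn_integral_tent[OF \<delta>, of \<zeta>] \<delta>
    by (auto intro!: integrableI_nn_integral_finite integral_eq_nn_integral[THEN trans] simp: tent_nonneg)
  have pt: "\<bar>gauss_kernel \<sigma> t \<xi> * ?T \<xi> - k0 * ?T \<xi>\<bar> \<le> \<kappa> * ?T \<xi>" for \<xi>
  proof (cases "?T \<xi> = 0")
    case False
    then have "dist \<zeta> \<xi> \<le> real CARD('d) * \<delta>" using norm_le_of_tent[OF \<delta>] by (simp add: dist_norm)
    then have "\<bar>gauss_kernel \<sigma> t \<xi> - k0\<bar> * ?T \<xi> \<le> \<kappa> * ?T \<xi>"
      by (intro mult_right_mono near tent_nonneg)
    moreover have "\<bar>gauss_kernel \<sigma> t \<xi> * ?T \<xi> - k0 * ?T \<xi>\<bar> = \<bar>gauss_kernel \<sigma> t \<xi> - k0\<bar> * ?T \<xi>"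
      by (simp add: left_diff_distrib[symmetric] abs_mult tent_nonneg)
    ultimately show ?thesis by simp
  qed simp
  have G: "integrable lborel (\<lambda>\<xi>. gauss_kernel \<sigma> t \<xi> * ?T \<xi>)"
  proof (rule Bochner_Integration.integrable_bound[of lborel "\<lambda>\<xi>. (\<bar>k0\<bar> + \<bar>\<kappa>\<bar>) * ?T \<xi>"])
    show "AE \<xi> in lborel. norm (gauss_kernel \<sigma> t \<xi> * ?T \<xi>) \<le> norm ((\<bar>k0\<bar> + \<bar>\<kappa>\<bar>) * ?T \<xi>)"
    proof (rule AE_I2)
      fix \<xi>
      have "\<bar>k0 * ?T \<xi>\<bar> = \<bar>k0\<bar> * ?T \<xi>" by (simp add: abs_mult tent_nonneg)
      moreover have "\<kappa> * ?T \<xi> \<le> \<bar>\<kappa>\<bar> * ?T \<xi>" by (intro mult_right_mono tent_nonneg) simp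
      ultimately have "\<bar>gauss_kernel \<sigma> t \<xi> * ?T \<xi>\<bar> \<le> (\<bar>k0\<bar> + \<bar>\<kappa>\<bar>) * ?T \<xi>"
        using pt[of \<xi>] unfolding distrib_right by linarith
      then show "norm (gauss_kernel \<sigma> t \<xi> * ?T \<xi>) \<le> norm ((\<bar>k0\<bar> + \<bar>\<kappa>\<bar>) * ?T \<xi>)"
        by (simp add: abs_mult[of "\<bar>k0\<bar> + \<bar>\<kappa>\<bar>"] tent_nonneg)
    qed
  qed (use T in auto)
  have "\<bar>(\<integral>w. ?T (B t w) \<partial>W) - \<delta> ^ CARD('d) * k0\<bar> =
      \<bar>\<integral>\<xi>. gauss_kernel \<sigma> t \<xi> * ?T \<xi> - k0 * ?T \<xi> \<partial>lborel\<bar>"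
    using brownian_motion_expectation[OF BM \<sigma> t, of ?T] T G by (simp add: T1 mult.commute)
  also have "\<dots> \<le> (\<integral>\<xi>. \<kappa> * ?T \<xi> \<partial>lborel)"
    using T G pt by (intro integral_abs_bound_integral) auto
  also have "\<dots> = \<kappa> * \<delta> ^ CARD('d)" by (simp add: T1)
  finally show ?thesis .
qed

context conservative_walk
begin

lemma AE_vsrw_at:
  assumes t: "0 \<le> t"
  shows "AE p in vsrw_law c x. vsrw_at t p \<noteq> None"
proof -
  interpret prob_space "vsrw_law c x" by (rule prob_space_vsrw_law)
  let ?A = "{p \<in> space (vsrw_law c x). vsrw_at t p \<noteq> None}"
  have A: "?A \<in> sets (vsrw_law c x)" by measurable
  have "emeasure (vsrw_law c x) ?A = (\<integral>\<^sup>+p. (case vsrw_at t p of None \<Rightarrow> 0 | Some y \<Rightarrow> 1) \<partial>vsrw_law c x)"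
    unfolding nn_integral_indicator[OF A, symmetric]
    by (intro nn_integral_cong) (auto split: option.split split_indicator)
  also have "\<dots> = 1"
    using nn_integral_heat[OF t, of "\<lambda>_. 1" x] mass[OF t, of x] by simp
  finally have "prob ?A = 1" by (simp add: measure_def)
  from AE_prob_1[OF this] show ?thesis by eventually_elim simp
qed

text \<open>On the cemetery \<open>the None\<close> is some arbitrary site, but the walk is almost
  surely alive at time \<open>t\<close>.\<close>

lemma nn_integral_heat_eq_integral:
  fixes f :: "int ^ 'd \<Rightarrow> real"
  assumes t: "0 \<le> t" and f: "\<And>y. 0 \<le> f y" "\<And>y. f y \<le> b"
  shows "(\<integral>\<^sup>+y. ennreal (f y) * heat c t x y \<partial>count_space UNIV) = ennreal (\<integral>p. f (the (vsrw_at t p)) \<partial>vsrw_law c x)"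
proof -
  interpret prob_space "vsrw_law c x" by (rule prob_space_vsrw_law)
  have [measurable]: "(\<lambda>p. f (the (vsrw_at t p))) \<in> borel_measurable (vsrw_law c x)"
    by (rule measurable_compose[OF measurable_vsrw_at]) simp
  have "(\<integral>\<^sup>+y. ennreal (f y) * heat c t x y \<partial>count_space UNIV) = (\<integral>\<^sup>+p. ennreal (f (the (vsrw_at t p))) \<partial>vsrw_law c x)"
    unfolding nn_integral_heat[OF t]
  proof (rule nn_integral_cong_AE)
    show "AE p in vsrw_law c x. (case vsrw_at t p of None \<Rightarrow> 0 | Some y \<Rightarrow> ennreal (f y)) = ennreal (f (the (vsrw_at t p)))"
      using AE_vsrw_at[OF t, of x] by eventually_elim (auto split: option.split)
  qed
  also have "\<dots> = ennreal (\<integral>p. f (the (vsrw_at t p)) \<partial>vsrw_law c x)"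
    using f by (intro nn_integral_eq_integral integrable_const_bound[where B = b] AE_I2) auto
  finally show ?thesis .
qed

end

section \<open>The local limit theorem\<close>

lemma emb_diff: "emb (x - y) = emb x - emb y"
  by (simp add: emb_def vec_eq_iff)

context elliptic_walk
begin

text \<open>The heat kernel at time \<open>r + q\<close> is the overlap of the kernels from \<open>0\<close> at time \<open>r\<close> and from
  \<open>y\<close> at time \<open>q\<close>. Averaging the second one over shifts costs little by the gradient bound, and
  turns the first one into a smoothed law, for which the invariance principle can be used.\<close>

lemma overlap_estimate:
  fixes y :: "int ^ 'd" and m :: nat and r q g0 e Q \<theta> \<rho> :: real
  defines "E \<equiv> sqrt (hk c (2 * r) 0 0) * (real CARD('d) * real m * sqrt (2 * hk c q y y / q))"
    and "G \<equiv> (\<lambda>z. (\<integral>p. tent (real m) (emb z - emb (the (vsrw_at r p))) \<partial>vsrw_law c 0) / real m ^ CARD('d))"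
  assumes r: "0 < r" and q: "0 < q" and m: "0 < m"
    and nonneg: "0 \<le> g0" "0 \<le> e" "0 \<le> Q" "0 \<le> \<theta>"
    and near: "\<And>z. ldist y z < \<rho> \<Longrightarrow> \<bar>G z - g0\<bar> \<le> e"
    and sup: "\<And>z. hk c r 0 z \<le> Q"
    and tail: "(\<integral>\<^sup>+z. heat c q y z * indicator {z. \<rho> \<le> ldist y z} z \<partial>count_space UNIV) \<le> ennreal \<theta>"
  shows "\<bar>hk c (r + q) 0 y - g0\<bar> \<le> E + e + (Q + g0) * \<theta>"
proof -
  let ?C = "count_space UNIV :: (int ^ 'd) measure"
  define M where "M = real m ^ CARD('d)"
  have M: "0 < M" using m by (simp add: M_def)
  \<comment> \<open>A probability on the shifts \<open>h\<close>, supported on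
    \<open>|h_i| \<le> m\<close>.\<close>
  define w where "w h = ennreal (tent (real m) (emb h) / M)" for h :: "int ^ 'd"
  have E0: "0 \<le> E" using r q by (simp add: E_def hk_nonneg)
  have w1: "(\<integral>\<^sup>+h. w h \<partial>?C) = 1"
  proof -
    have "(\<integral>\<^sup>+h. w h \<partial>?C) = (\<integral>\<^sup>+h. ennreal (1 / M) * ennreal (tent (real m) (emb h)) \<partial>?C)"
      unfolding w_def using M by (intro nn_integral_cong) (simp add: ennreal_mult[symmetric] tent_nonneg)
    also have "\<dots> = ennreal (1 / M) * ennreal M"
      by (simp add: nn_integral_cmult nn_integral_tent_lattice[OF m] M_def)
    also have "\<dots> = 1" using M by (simp add: ennreal_mult[symmetric])
    finally show ?thesis .
  qed
  define I where "I = heat c (r + q) 0 y"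
  define Ih where "Ih h = (\<integral>\<^sup>+z. heat c r 0 z * heat c q y (z + h) \<partial>?C)" for h
  define J where "J = (\<integral>\<^sup>+h. w h * Ih h \<partial>?C)"
  have I: "I = (\<integral>\<^sup>+z. heat c r 0 z * heat c q y z \<partial>?C)"
    unfolding I_def using r q heat_Chapman_Kolmogorov[of r q c 0 y]
    by (simp add: heat_sym[of c q _ y])
  \<comment> \<open>A shift of nonzero weight has l1 norm at most \<open>d * m\<close>, which is the
    factor in \<open>E\<close>.\<close>
  have shift: "I \<le> Ih h + ennreal E" "Ih h \<le> I + ennreal E" if "w h \<noteq> 0" for h
  proof -
    have nz: "tent (real m) (emb h) \<noteq> 0" using that by (auto simp: w_def)
    have "\<bar>real_of_int (h $ i)\<bar> \<le> real m" for i
      using tent_eq_0[of "real m" "emb h" i] nz m by (force simp: emb_def)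
    then have "(\<Sum>i\<in>UNIV. \<bar>real_of_int (h $ i)\<bar>) \<le> (\<Sum>i\<in>(UNIV::'d set). real m)" by (intro sum_mono)
    then have le: "sqrt (hk c (2 * r) 0 0) * ((\<Sum>i\<in>UNIV. \<bar>real_of_int (h $ i)\<bar>) * sqrt (2 * hk c q y y / q)) \<le> E"
      unfolding E_def using r q by (intro mult_left_mono mult_right_mono) (auto simp: hk_nonneg)
    show "I \<le> Ih h + ennreal E" "Ih h \<le> I + ennreal E"
      unfolding I Ih_def
      by (rule order_trans[OF overlap_shift(1)[OF r q] add_left_mono[OF ennreal_leI[OF le]]],
          rule order_trans[OF overlap_shift(2)[OF r q] add_left_mono[OF ennreal_leI[OF le]]])
  qed
  have "I = (\<integral>\<^sup>+h. w h * I \<partial>?C)" by (simp add: nn_integral_multc w1)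
  also have "\<dots> \<le> (\<integral>\<^sup>+h. w h * Ih h + w h * ennreal E \<partial>?C)"
  proof (rule nn_integral_mono)
    fix h show "w h * I \<le> w h * Ih h + w h * ennreal E"
      using shift(1)[of h] by (cases "w h = 0") (auto simp: distrib_left[symmetric] intro: mult_left_mono)
  qed
  also have "\<dots> = J + ennreal E" by (simp add: nn_integral_add nn_integral_multc w1 J_def)
  finally have IJ: "I \<le> J + ennreal E" .
  have "J \<le> (\<integral>\<^sup>+h. w h * I + w h * ennreal E \<partial>?C)"
    unfolding J_def
  proof (rule nn_integral_mono)
    fix h show "w h * Ih h \<le> w h * I + w h * ennreal E"
      using shift(2)[of h] by (cases "w h = 0") (auto simp: distrib_left[symmetric] intro: mult_left_mono)
  qed
  also have "\<dots> = I + ennreal E" by (simp add: nn_integral_add nn_integral_multc w1)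
  finally have JI: "J \<le> I + ennreal E" .
  \<comment> \<open>With the substitution \<open>v = z + h\<close> the average over shifts acts on
    the kernel from 0 instead, and yields the smoothed law \<open>G\<close> of the walk.\<close>
  have G: "(\<integral>\<^sup>+z. w (v - z) * heat c r 0 z \<partial>?C) = ennreal (G v)" for v
  proof -
    have "(\<integral>\<^sup>+z. w (v - z) * heat c r 0 z \<partial>?C) =
        ennreal (\<integral>p. tent (real m) (emb (v - the (vsrw_at r p))) / M \<partial>vsrw_law c 0)"
      unfolding w_def using r m M
      by (intro nn_integral_heat_eq_integral[where b = "1 / M"])
         (auto intro!: divide_right_mono tent_le_1 divide_nonneg_pos tent_nonneg)
    then show ?thesis by (simp add: G_def emb_diff M_def)
  qed
  \<comment> \<open>Far from \<open>y\<close> there is no comparison with \<open>g0\<close>, only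
    the crude bound by \<open>Q\<close>; the small mass \<theta> of the kernel from \<open>y\<close>
    there makes it sufficient.\<close>
  have far: "G v \<le> Q" for v
  proof -
    have "ennreal (G v) \<le> (\<integral>\<^sup>+z. w (v - z) * ennreal Q \<partial>?C)"
      unfolding G[symmetric] using r sup
      by (intro nn_integral_mono mult_left_mono) (auto simp: ennreal_hk[symmetric] ennreal_leI)
    also have "\<dots> = (\<integral>\<^sup>+h. w h \<partial>?C) * ennreal Q"
    proof -
      have "bij (\<lambda>z. v - z)" by (rule bij_betw_byWitness[where f' = "\<lambda>z. v - z"]) auto
      from nn_integral_bij_count_space[OF this, of w] show ?thesis by (simp add: nn_integral_multc)
    qed
    finally show ?thesis using nonneg by (simp add: w1)
  qed
  have "J = (\<integral>\<^sup>+h. \<integral>\<^sup>+z. w h * (heat c r 0 z * heat c q y (z + h)) \<partial>?C \<partial>?C)"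
    unfolding J_def Ih_def by (simp add: nn_integral_cmult)
  also have "\<dots> = (\<integral>\<^sup>+z. \<integral>\<^sup>+h. w h * (heat c r 0 z * heat c q y (z + h)) \<partial>?C \<partial>?C)"
    by (rule nn_integral_count_space_nn_integral) auto
  also have "\<dots> = (\<integral>\<^sup>+z. \<integral>\<^sup>+v. w (v - z) * (heat c r 0 z * heat c q y v) \<partial>?C \<partial>?C)"
  proof (rule nn_integral_cong)
    fix z
    show "(\<integral>\<^sup>+h. w h * (heat c r 0 z * heat c q y (z + h)) \<partial>?C) =
      (\<integral>\<^sup>+v. w (v - z) * (heat c r 0 z * heat c q y v) \<partial>?C)"
      using nn_integral_count_space_shift[of "\<lambda>v. w (v - z) * (heat c r 0 z * heat c q y v)" z]
      by (simp add: add.commute)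
  qed
  also have "\<dots> = (\<integral>\<^sup>+v. \<integral>\<^sup>+z. w (v - z) * (heat c r 0 z * heat c q y v) \<partial>?C \<partial>?C)"
    by (rule nn_integral_count_space_nn_integral) auto
  also have "\<dots> = (\<integral>\<^sup>+v. heat c q y v * ennreal (G v) \<partial>?C)"
    unfolding G[symmetric] by (simp add: nn_integral_cmult[symmetric] mult_ac)
  finally have J: "J = (\<integral>\<^sup>+v. heat c q y v * ennreal (G v) \<partial>?C)" .
  let ?i = "indicator {z. \<rho> \<le> ldist y z} :: int ^ 'd \<Rightarrow> ennreal"
  have q0: "0 \<le> q" using q by simp
  have "J \<le> (\<integral>\<^sup>+v. heat c q y v * ennreal (g0 + e) + heat c q y v * ?i v * ennreal Q \<partial>?C)"
    unfolding J
  proof (rule nn_integral_mono)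
    fix v
    show "heat c q y v * ennreal (G v) \<le> heat c q y v * ennreal (g0 + e) + heat c q y v * ?i v * ennreal Q"
    proof (cases "\<rho> \<le> ldist y v")
      case True
      then have "heat c q y v * ennreal (G v) \<le> heat c q y v * ?i v * ennreal Q"
        using far[of v] by (simp add: mult_left_mono ennreal_leI)
      then show ?thesis by (rule order_trans) simp
    next
      case False
      then have "G v \<le> g0 + e" using near[of v] by simp
      then have "heat c q y v * ennreal (G v) \<le> heat c q y v * ennreal (g0 + e)"
        by (intro mult_left_mono ennreal_leI) auto
      then show ?thesis by (rule order_trans) simp
    qed
  qed
  also have "\<dots> = ennreal (g0 + e) + (\<integral>\<^sup>+v. heat c q y v * ?i v \<partial>?C) * ennreal Q"
    by (simp add: nn_integral_add nn_integral_multc mass[OF q0])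
  also have "\<dots> \<le> ennreal (g0 + e) + ennreal \<theta> * ennreal Q"
    by (intro add_left_mono mult_right_mono tail) simp
  also have "\<dots> = ennreal (g0 + e + Q * \<theta>)"
    using nonneg by (simp add: ennreal_mult[symmetric] mult.commute)
  finally have J_le: "J \<le> ennreal (g0 + e + Q * \<theta>)" .
  \<comment> \<open>For \<open>g0 < e\<close> the left side is 0 in \<open>ennreal\<close> and the
    lower bound is trivial.\<close>
  have "ennreal (g0 - e) = (\<integral>\<^sup>+v. heat c q y v * ennreal (g0 - e) \<partial>?C)"
    by (simp add: nn_integral_multc mass[OF q0])
  also have "\<dots> \<le> (\<integral>\<^sup>+v. heat c q y v * ennreal (G v) + heat c q y v * ?i v * ennreal g0 \<partial>?C)"
  proof (rule nn_integral_mono)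
    fix v
    show "heat c q y v * ennreal (g0 - e) \<le> heat c q y v * ennreal (G v) + heat c q y v * ?i v * ennreal g0"
    proof (cases "\<rho> \<le> ldist y v")
      case True
      then have "heat c q y v * ennreal (g0 - e) \<le> heat c q y v * ?i v * ennreal g0"
        using nonneg by (simp add: mult_left_mono ennreal_leI)
      then show ?thesis by (rule order_trans) simp
    next
      case False
      then have "g0 - e \<le> G v" using near[of v] by simp
      then have "heat c q y v * ennreal (g0 - e) \<le> heat c q y v * ennreal (G v)"
        by (intro mult_left_mono ennreal_leI) auto
      then show ?thesis by (rule order_trans) simp
    qed
  qed
  also have "\<dots> = J + (\<integral>\<^sup>+v. heat c q y v * ?i v \<partial>?C) * ennreal g0"
    by (simp add: nn_integral_add nn_integral_multc J)
  also have "\<dots> \<le> J + ennreal \<theta> * ennreal g0"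
    by (intro add_left_mono mult_right_mono tail) simp
  finally have J_ge: "ennreal (g0 - e) \<le> J + ennreal \<theta> * ennreal g0" .
  obtain j where j: "J = ennreal j" "0 \<le> j"
    using J_le by (cases J) (auto simp: top_unique)
  have Ihk: "I = ennreal (hk c (r + q) 0 y)"
    using r q by (simp add: I_def ennreal_hk)
  have 1: "hk c (r + q) 0 y \<le> j + E" "j \<le> hk c (r + q) 0 y + E"
    using IJ JI E0 j(2) hk_nonneg[of "r + q" 0 y] unfolding j(1) Ihk
    by (simp_all add: ennreal_plus[symmetric] del: ennreal_plus)
  have 2: "j \<le> g0 + e + Q * \<theta>"
    using J_le nonneg j(2) unfolding j(1) by (subst (asm) ennreal_le_iff) auto
  have 3: "g0 - e \<le> j + g0 * \<theta>"
  proof -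
    have "ennreal (g0 - e) \<le> ennreal (j + g0 * \<theta>)"
      using J_ge nonneg j by (simp add: ennreal_mult mult.commute)
    then show ?thesis using nonneg j(2) by (subst (asm) ennreal_le_iff) auto
  qed
  have "0 \<le> g0 * \<theta>" "0 \<le> Q * \<theta>" using nonneg by auto
  then show ?thesis using 1 2 3 unfolding distrib_right by linarith
qed

end

text \<open>Pointwise convergence on a finite net spreads by the common Lipschitz bound. The mesh
  uses \<open>L + 1\<close>, which is positive even for \<open>L = 0\<close>.\<close>

lemma Lipschitz_uniform_convergence:
  fixes A :: "nat \<Rightarrow> 'a::metric_space \<Rightarrow> real"
  assumes S: "compact S" and L: "0 \<le> L"
    and A: "\<And>j x y. \<bar>A j x - A j y\<bar> \<le> L * dist x y"
    and a: "\<And>x y. \<bar>a x - a y\<bar> \<le> L * dist x y"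
    and lim: "\<And>x. (\<lambda>j. A j x) \<longlonglongrightarrow> a x" and e: "0 < e"
  shows "eventually (\<lambda>j. \<forall>x\<in>S. \<bar>A j x - a x\<bar> < e) sequentially"
proof -
  define S' where "S' = L + 1"
  have S': "0 < S'" using L by (simp add: S'_def)
  define d where "d = e / (3 * S')"
  have d: "0 < d" using e S' by (simp add: d_def)
  have Ld: "L * d \<le> e / 3"
  proof -
    have "L * d \<le> S' * d" using d by (simp add: S'_def)
    also have "\<dots> = e / 3" using S' by (simp add: d_def)
    finally show ?thesis .
  qed
  obtain k where k: "finite k" "S \<subseteq> (\<Union>x\<in>k. ball x d)"
    using S d unfolding compact_eq_totally_bounded by blast
  have "eventually (\<lambda>j. \<forall>x\<in>k. \<bar>A j x - a x\<bar> < e / 3) sequentially"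
  proof (intro eventually_ball_finite[OF k(1)] ballI)
    fix x
    show "eventually (\<lambda>j. \<bar>A j x - a x\<bar> < e / 3) sequentially"
      using tendstoD[OF lim, of "e / 3" x] e by (simp add: dist_real_def)
  qed
  then show ?thesis
  proof eventually_elim
    case (elim j)
    show ?case
    proof
      fix y assume "y \<in> S"
      then obtain x where x: "x \<in> k" "dist x y < d" using k by auto
      have "L * dist x y \<le> e / 3"
        using mult_left_mono[OF less_imp_le[OF x(2)] L] Ld by linarith
      then show "\<bar>A j y - a y\<bar> < e"
      proof -
        have "\<bar>A j x - a x\<bar> < e / 3" using elim x(1) by blast
        then show ?thesis using A[of j x y] a[of x y] \<open>L * dist x y \<le> e / 3\<close> by linarith
      qed
    qed
  qed
qed

lemma norm_emb_vfloor_le: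
  fixes x :: "real ^ 'd::finite"
  shows "norm (emb (vfloor x) - x) \<le> real CARD('d)"
proof -
  have "norm (emb (vfloor x) - x) \<le> (\<Sum>i\<in>UNIV. \<bar>(emb (vfloor x) - x) $ i\<bar>)"
    by (rule norm_le_l1_cart)
  also have "\<dots> \<le> (\<Sum>i\<in>(UNIV::'d set). 1)"
  proof (rule sum_mono)
    fix i
    show "\<bar>(emb (vfloor x) - x) $ i\<bar> \<le> 1"
      by (simp add: emb_def vfloor_def) linarith
  qed
  finally show ?thesis by simp
qed

lemma gauss_kernel_locally_constant:
  fixes x :: "real ^ 'd::finite"
  assumes \<sigma>: "0 < \<sigma>" and t: "0 < t" and e: "0 < e"
  obtains \<rho> where "0 < \<rho>"
    "\<And>\<tau> \<xi>. \<bar>\<tau> - t\<bar> \<le> \<rho> \<Longrightarrow> dist x \<xi> \<le> \<rho> \<Longrightarrow> \<bar>gauss_kernel \<sigma> \<tau> \<xi> - gauss_kernel \<sigma> t x\<bar> \<le> e"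
proof -
  have "((\<lambda>p. gauss_kernel \<sigma> (fst p) (snd p)) \<longlongrightarrow> gauss_kernel \<sigma> (fst (t, x)) (snd (t, x))) (at (t, x))"
    unfolding gauss_kernel_def using \<sigma> t
    by (intro tendsto_intros) auto
  then obtain s where s: "0 < s" "\<And>p. p \<noteq> (t, x) \<Longrightarrow> dist p (t, x) < s \<Longrightarrow>
      \<bar>gauss_kernel \<sigma> (fst p) (snd p) - gauss_kernel \<sigma> t x\<bar> < e"
    using e unfolding LIM_def by (auto simp: dist_real_def)
  show ?thesis
  proof (rule that[of "s / 3"])
    fix \<tau> \<xi> assume *: "\<bar>\<tau> - t\<bar> \<le> s / 3" "dist x \<xi> \<le> s / 3"
    have "dist (\<tau>, \<xi>) (t, x) \<le> dist \<tau> t + dist \<xi> x"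
      unfolding dist_Pair_Pair by (rule sqrt_sum_squares_le_sum) auto
    then have "dist (\<tau>, \<xi>) (t, x) < s" using * s(1) by (simp add: dist_real_def dist_commute)
    then show "\<bar>gauss_kernel \<sigma> \<tau> \<xi> - gauss_kernel \<sigma> t x\<bar> \<le> e"
      using s(2)[of "(\<tau>, \<xi>)"] e by (cases "(\<tau>, \<xi>) = (t, x)") auto
  qed (use s in simp)
qed

lemma tendsto_exp_neg_sqrt:
  fixes N :: "nat \<Rightarrow> real"
  assumes "0 < a" "filterlim N at_top sequentially"
  shows "(\<lambda>j. exp (- (a * sqrt (N j)))) \<longlonglongrightarrow> 0"
proof -
  have "filterlim (\<lambda>j. a * sqrt (N j)) at_top sequentially"
    by (intro filterlim_tendsto_pos_mult_at_top[OF tendsto_const assms(1)]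
          filterlim_compose[OF sqrt_at_top assms(2)])
  then show ?thesis
    by (intro filterlim_compose[OF exp_at_bot] filterlim_compose[OF filterlim_uminus_at_bot_at_top])
qed

text \<open>The environment is frozen at a point outside all exceptional null sets, with
  \<open>U\<close> the realised random scales. The only randomness left is that of the
  trajectory.\<close>

locale quenched_walk = elliptic_walk c
  for c :: "'d::finite conf" +
  fixes c3 c4 \<sigma> :: real and U :: "int ^ 'd \<Rightarrow> real"
    and W :: "'b measure" and B :: "real \<Rightarrow> 'b \<Rightarrow> real ^ 'd"
  assumes c3: "0 < c3" and c4: "0 < c4" and sigma: "0 < \<sigma>"
    and on_diagonal: "0 < t \<Longrightarrow> hk c t x y \<le> c3 * t powr (- real CARD('d) / 2)"
    and off_diagonal: "0 < t \<Longrightarrow> U x \<le> max (ldist x y) (sqrt t) \<Longrightarrow> ldist x y \<le> t \<Longrightarrow>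
      hk c t x y \<le> c3 * t powr (- real CARD('d) / 2) * exp (- c4 * (ldist x y)\<^sup>2 / t)"
    and off_diagonal_small: "0 < t \<Longrightarrow> U x \<le> max (ldist x y) (sqrt t) \<Longrightarrow> t \<le> ldist x y \<Longrightarrow>
      hk c t x y \<le> c3 * exp (- c4 * ldist x y)"
    and growth: "0 < \<kappa> \<Longrightarrow> \<exists>C. \<forall>x. U x \<le> \<kappa> * norm (emb x) + C"
    and BM: "brownian_motion \<sigma> W B"
    and conv: "converges_in_law (vsrw_law c 0) scaled_vsrw W B"
begin

definition tail_const :: real where
  "tail_const = c3 * exp c4 * (4 * (real CARD('d) + c4) / c4) ^ CARD('d)"

text \<open>Adding the bounds of the two regimes removes the distinction between
  \<open>ldist x y \<le> t\<close> and \<open>t \<le> ldist x y\<close>, so that one sum over the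
  lattice handles both.\<close>

lemma hk_far:
  assumes "0 < t" "U x \<le> ldist x y"
  shows "hk c t x y \<le> c3 * t powr (- real CARD('d) / 2) * exp (- c4 * (ldist x y)\<^sup>2 / t)
     + c3 * exp (- c4 * ldist x y)"
proof -
  have U: "U x \<le> max (ldist x y) (sqrt t)" using assms(2) by simp
  have nn: "0 \<le> c3 * t powr (- real CARD('d) / 2) * exp (- c4 * (ldist x y)\<^sup>2 / t)"
    "0 \<le> c3 * exp (- c4 * ldist x y)" using c3 by auto
  show ?thesis
    using off_diagonal[OF assms(1) U] off_diagonal_small[OF assms(1) U] nn
    by (cases "ldist x y \<le> t") linarith+
qed

lemma heat_tail:
  assumes "1 \<le> t" "0 \<le> \<rho>" "U y \<le> \<rho>"
  shows "(\<integral>\<^sup>+z. heat c t y z * indicator {z. \<rho> \<le> ldist y z} z \<partial>count_space UNIV) \<le>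
    ennreal (tail_const * (exp (- (c4 * \<rho> / sqrt t)) + exp (- (c4 * \<rho> / 2))))"
  using nn_integral_heat_kernel_tail[OF c3 c4 assms(1,2), of y "hk c t y"] hk_far[of t y] assms
  unfolding tail_const_def by (simp add: ennreal_hk)

lemma measurable_scaled_vsrw: "scaled_vsrw \<epsilon> s \<in> borel_measurable (vsrw_law c x)"
  unfolding scaled_vsrw_def[abs_def]
  by (rule measurable_compose[OF measurable_vsrw_at]) simp

text \<open>The time \<open>r j\<close> of the walk is the macroscopic time
  \<open>r j * (\<epsilon> j)^2\<close> at scale \<open>\<epsilon> j\<close>, and this is only
  required to converge.\<close>

lemma smoothed_law_converges:
  fixes \<epsilon> r :: "nat \<Rightarrow> real"
  assumes \<epsilon>: "\<And>j. 0 < \<epsilon> j" "\<epsilon> \<longlonglongrightarrow> 0" and r: "\<And>j. 0 \<le> r j" "(\<lambda>j. r j * (\<epsilon> j)\<^sup>2) \<longlonglongrightarrow> \<tau>" and \<delta>: "0 < \<delta>"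
  shows "(\<lambda>j. \<integral>p. tent \<delta> (\<zeta> - \<epsilon> j *\<^sub>R emb (the (vsrw_at (r j) p))) \<partial>vsrw_law c 0) \<longlonglongrightarrow>
     (\<integral>w. tent \<delta> (\<zeta> - B \<tau> w) \<partial>W)"
proof -
  have BM': "prob_space W" "\<And>s. 0 \<le> s \<Longrightarrow> B s \<in> borel_measurable W"
    "AE w in W. continuous_on {0..} (\<lambda>t. B t w)"
    using BM unfolding brownian_motion_def by blast+
  have "(\<lambda>j. \<integral>p. tent \<delta> (\<zeta> - scaled_vsrw (\<epsilon> j) (r j * (\<epsilon> j)\<^sup>2) p) \<partial>vsrw_law c 0) \<longlonglongrightarrow>
     (\<integral>w. tent \<delta> (\<zeta> - B \<tau> w) \<partial>W)"
    by (rule converges_in_law_marginal[OF conv prob_space_vsrw_law BM'(1) measurable_scaled_vsrw BM'(2,3) \<epsilon> _ r(2)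
          bounded_Lipschitz_tent[OF \<delta>]]) (use r(1) in auto)
  moreover have "scaled_vsrw (\<epsilon> j) (r j * (\<epsilon> j)\<^sup>2) p = \<epsilon> j *\<^sub>R emb (the (vsrw_at (r j) p))"
    for j and p :: "nat \<Rightarrow> (int ^ 'd) \<times> real"
    using \<epsilon>(1)[of j] by (simp add: scaled_vsrw_def)
  ultimately show ?thesis by simp
qed

lemma integral_tent_Lipschitz:
  assumes P: "prob_space P" and Y: "Y \<in> borel_measurable P" and \<delta>: "0 < \<delta>"
  shows "\<bar>(\<integral>p. tent \<delta> (x - Y p) \<partial>P) - (\<integral>p. tent \<delta> (y - Y p) \<partial>P)\<bar> \<le> real CARD('d) / \<delta> * dist x (y :: real ^ 'd)"
proof -
  interpret prob_space P by fact
  note [measurable] = Y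
  have int: "integrable P (\<lambda>p. tent \<delta> (x - Y p))" for x
    by (intro integrable_const_bound[where B = 1] AE_I2) (auto simp: abs_of_nonneg tent_nonneg tent_le_1[OF \<delta>])
  have "\<bar>(\<integral>p. tent \<delta> (x - Y p) \<partial>P) - (\<integral>p. tent \<delta> (y - Y p) \<partial>P)\<bar> = \<bar>\<integral>p. tent \<delta> (x - Y p) - tent \<delta> (y - Y p) \<partial>P\<bar>"
    by (simp add: Bochner_Integration.integral_diff[OF int int])
  also have "\<dots> \<le> (\<integral>p. \<bar>tent \<delta> (x - Y p) - tent \<delta> (y - Y p)\<bar> \<partial>P)"
    by (rule integral_abs_bound)
  also have "\<dots> \<le> (\<integral>p. real CARD('d) / \<delta> * dist x y \<partial>P)"
  proof (rule integral_mono)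
    fix p
    show "\<bar>tent \<delta> (x - Y p) - tent \<delta> (y - Y p)\<bar> \<le> real CARD('d) / \<delta> * dist x y"
      using tent_Lipschitz[OF \<delta>, of "x - Y p" "y - Y p"] by (simp add: dist_norm)
  qed (use int in auto)
  finally show ?thesis by (simp add: prob_space)
qed

end

context quenched_walk
begin

lemma on_diagonal_scaled:
  assumes "0 < N" "0 < s" "N * s \<le> r"
  shows "hk c r x y \<le> N powr (- real CARD('d) / 2) * (c3 * s powr (- real CARD('d) / 2))"
proof -
  have r: "0 < r" using assms mult_pos_pos[of N s] by linarith
  have "hk c r x y \<le> c3 * r powr (- real CARD('d) / 2)" by (rule on_diagonal[OF r])
  also have "\<dots> \<le> c3 * (N * s) powr (- real CARD('d) / 2)"
    using assms c3 by (intro mult_left_mono powr_mono2') auto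
  also have "(N * s) powr (- real CARD('d) / 2) = N powr (- real CARD('d) / 2) * s powr (- real CARD('d) / 2)"
    using assms by (simp add: powr_mult)
  finally show ?thesis by (simp add: mult_ac)
qed

lemma local_convergence:
  fixes N t :: "nat \<Rightarrow> real" and x :: "nat \<Rightarrow> real ^ 'd"
  assumes N1: "\<And>j. 1 \<le> N j" and N: "filterlim N at_top sequentially"
    and T: "0 < T" and tT: "\<And>j. T \<le> t j" and t: "t \<longlonglongrightarrow> t0" and x: "x \<longlonglongrightarrow> x0"
  shows "(\<lambda>j. N j powr (real CARD('d) / 2) * hk c (N j * t j) 0 (vfloor (sqrt (N j) *\<^sub>R x j)))
    \<longlonglongrightarrow> gauss_kernel \<sigma> t0 x0"
proof (rule LIMSEQ_I)
  fix e :: real assume e: "0 < e"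
  define d where "d = real CARD('d)"
  define k0 where "k0 = gauss_kernel \<sigma> t0 x0"
  \<comment> \<open>Five errors of size \<kappa> add up in the end: one from the shifts, two from
    the smoothed law (invariance principle, variation of the Gaussian), one from the normalisation
    \<open>b j\<close>, one from the tail.\<close>
  define \<kappa> where "\<kappa> = e / 6"
  have \<kappa>: "0 < \<kappa>" using e by (simp add: \<kappa>_def)
  have d: "1 \<le> d" by (simp add: d_def Suc_leI)
  have k0: "0 \<le> k0" by (simp add: k0_def gauss_kernel_nonneg)
  have t0T: "T \<le> t0" using tT by (intro LIMSEQ_le_const[OF t]) auto
  then have t0: "0 < t0" using T by simp
  obtain \<rho>0 where \<rho>0: "0 < \<rho>0"
    "\<And>\<tau> \<xi>. \<bar>\<tau> - t0\<bar> \<le> \<rho>0 \<Longrightarrow> dist x0 \<xi> \<le> \<rho>0 \<Longrightarrow> \<bar>gauss_kernel \<sigma> \<tau> \<xi> - k0\<bar> \<le> \<kappa>"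
    unfolding k0_def using gauss_kernel_locally_constant[OF sigma t0 \<kappa>, of x0] by blast
  \<comment> \<open>Three displacements of at most \<open>l\<close> each: from \<open>x0\<close> to
    the rescaled \<open>y j\<close>, from there to the rescaled \<open>z\<close>, and across the
    support of the tent.\<close>
  define l where "l = \<rho>0 / 3"
  have l: "0 < l" using \<rho>0 by (simp add: l_def)
  define Q where "Q = c3 * (T / 2) powr (- d / 2)"
  have Q: "0 < Q" using c3 T by (simp add: Q_def)
  define \<theta> where "\<theta> = \<kappa> / (Q + k0 + 1)"
  have \<theta>: "0 < \<theta>" using \<kappa> Q k0 by (simp add: \<theta>_def)
  have Q\<theta>: "(Q + k0) * \<theta> \<le> \<kappa>"
  proof -
    have "(Q + k0) * \<theta> \<le> (Q + k0 + 1) * \<theta>" using \<theta> by (intro mult_right_mono) auto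
    then show ?thesis using Q k0 by (simp add: \<theta>_def)
  qed
  \<comment> \<open>The bound by \<open>\<rho>0\<close> keeps \<open>t0 - s\<close> where the
    Gaussian is nearly constant, the bound by \<open>T / 2\<close> leaves time for the kernel from
    0, and the last condition confines the kernel from \<open>y j\<close> at time
    \<open>N j * s\<close> to distance \<open>l * sqrt (N j)\<close>.\<close>
  obtain s where s: "0 < s" "s \<le> \<rho>0" "s \<le> T / 2"
    "tail_const * exp (- (c4 * l / sqrt s)) \<le> \<theta> / 2"
  proof -
    have "((\<lambda>s. tail_const * exp (- (c4 * l / sqrt s))) \<longlongrightarrow> tail_const * 0) (at_right 0)"
    proof (intro tendsto_mult tendsto_const filterlim_compose[OF exp_at_bot]
        filterlim_compose[OF filterlim_uminus_at_bot_at_top])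
      have "filterlim (\<lambda>s. sqrt s) (at_right 0) (at_right 0)"
        unfolding filterlim_at
        by (auto intro!: tendsto_eq_intros eventually_at_rightI[of 0 1])
      then show "filterlim (\<lambda>s. c4 * l / sqrt s) at_top (at_right 0)"
        unfolding divide_inverse using c4 l
        by (intro filterlim_tendsto_pos_mult_at_top[OF tendsto_const]
            filterlim_compose[OF filterlim_inverse_at_top_right]) auto
    qed
    then have "eventually (\<lambda>s. tail_const * exp (- (c4 * l / sqrt s)) < \<theta> / 2) (at_right 0)"
      using \<theta> by (intro order_tendstoD(2)) auto
    then obtain b where b: "0 < b" "\<And>s. 0 < s \<Longrightarrow> s < b \<Longrightarrow> tail_const * exp (- (c4 * l / sqrt s)) < \<theta> / 2"
      unfolding eventually_at_right_field by blast
    show ?thesis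
      by (rule that[of "min (b / 2) (min \<rho>0 (T / 2))"]) (use b \<rho>0 T in \<open>auto intro!: less_imp_le b(2)\<close>)
  qed
  define S where "S = 2 * (c3 * s powr (- d / 2)) / s"
  have S: "0 < S" using c3 s by (simp add: S_def)
  define H where "H = d * sqrt Q * sqrt S * 2"
  have H: "0 < H" using d Q S by (simp add: H_def)
  \<comment> \<open>The first entry keeps the support of the tent within \<open>l\<close>. The
    second controls the shift error, whose factor \<open>S\<close> blows up as \<open>s\<close>
    tends to 0, so \<delta> has to come after \<open>s\<close>. The 2 in \<open>H\<close> allows for
    \<open>\<rho> j < 2 * \<delta>\<close>.\<close>
  define \<delta> where "\<delta> = min (l / d) (\<kappa> / H)"
  have \<delta>: "0 < \<delta>" "d * \<delta> \<le> l" "H * \<delta> \<le> \<kappa>"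
  proof -
    show "0 < \<delta>" using l d \<kappa> H by (simp add: \<delta>_def)
    have "d * \<delta> \<le> d * (l / d)" using d by (intro mult_left_mono) (auto simp: \<delta>_def)
    then show "d * \<delta> \<le> l" using d by simp
    have "H * \<delta> \<le> H * (\<kappa> / H)" using H by (intro mult_left_mono) (auto simp: \<delta>_def)
    then show "H * \<delta> \<le> \<kappa>" using H by simp
  qed
  define M where "M = \<delta> ^ CARD('d)"
  have M: "0 < M" using \<delta> by (simp add: M_def)
  \<comment> \<open>The width \<delta> at scale \<open>sqrt (N j)\<close>, rounded up to an integer
    as the exact lattice sum of the tent requires.\<close>
  define m where "m j = nat \<lceil>\<delta> * sqrt (N j)\<rceil>" for j
  have sN: "1 \<le> sqrt (N j)" for j using N1[of j] by simp
  have sNlim: "filterlim (\<lambda>j. sqrt (N j)) at_top sequentially"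
    by (rule filterlim_compose[OF sqrt_at_top N])
  have m: "\<delta> * sqrt (N j) \<le> real (m j)" "real (m j) \<le> \<delta> * sqrt (N j) + 1" "0 < m j" for j
  proof -
    have p: "0 < \<delta> * sqrt (N j)" using \<delta>(1) sN[of j] by (intro mult_pos_pos) auto
    then show "\<delta> * sqrt (N j) \<le> real (m j)" "real (m j) \<le> \<delta> * sqrt (N j) + 1"
      unfolding m_def by linarith+
    with p show "0 < m j" by (cases "m j") auto
  qed
  define \<rho> where "\<rho> j = real (m j) / sqrt (N j)" for j
  have \<rho>\<delta>: "\<delta> \<le> \<rho> j" "\<rho> j \<le> \<delta> + 1 / sqrt (N j)" for j
  proof -
    have "0 < sqrt (N j)" using sN[of j] by linarith
    then show "\<delta> \<le> \<rho> j" "\<rho> j \<le> \<delta> + 1 / sqrt (N j)"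
      using m(1,2)[of j] by (auto simp: \<rho>_def field_simps)
  qed
  have inv: "(\<lambda>j. 1 / sqrt (N j)) \<longlonglongrightarrow> 0"
    by (rule tendsto_divide_0[OF tendsto_const filterlim_at_top_imp_at_infinity[OF sNlim]])
  have \<rho>lim: "\<rho> \<longlonglongrightarrow> \<delta>"
  proof (rule tendsto_sandwich[OF _ _ tendsto_const])
    show "(\<lambda>j. \<delta> + 1 / sqrt (N j)) \<longlonglongrightarrow> \<delta>"
      using tendsto_add[OF tendsto_const inv, of \<delta>] by simp
  qed (use \<rho>\<delta> in auto)
  \<comment> \<open>Instead of \<open>1 / sqrt (N j)\<close>, the scale that carries the lattice
    tent of width \<open>m j\<close> exactly to the tent of width \<delta>. The two scales agree
    asymptotically, since \<open>\<epsilon> j * sqrt (N j) = \<delta> / \<rho> j\<close> tends to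
    1.\<close>
  define \<epsilon> where "\<epsilon> j = \<delta> / real (m j)" for j
  have \<epsilon>: "0 < \<epsilon> j" for j using \<delta> m(3)[of j] by (simp add: \<epsilon>_def)
  have \<epsilon>N: "\<epsilon> j * sqrt (N j) = \<delta> / \<rho> j" for j by (simp add: \<epsilon>_def \<rho>_def)
  have \<epsilon>N1: "\<delta> / \<rho> j \<le> 1" for j using \<rho>\<delta>(1)[of j] \<delta> by (simp add: divide_le_eq)
  have ratio: "(\<lambda>j. \<delta> / \<rho> j) \<longlonglongrightarrow> 1"
    using tendsto_divide[OF tendsto_const \<rho>lim, of \<delta>] \<delta> by simp
  have \<epsilon>eq: "\<epsilon> j = \<delta> / \<rho> j * (1 / sqrt (N j))" for j
    using sN[of j] by (simp add: \<epsilon>_def \<rho>_def)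
  have \<epsilon>lim: "\<epsilon> \<longlonglongrightarrow> 0"
    using tendsto_mult[OF ratio inv] by (simp add: \<epsilon>eq[abs_def])
  define r where "r j = N j * (t j - s)" for j
  have ts: "T / 2 \<le> t j - s" for j using tT[of j] s by linarith
  have r: "N j * (T / 2) \<le> r j" for j
    unfolding r_def using ts[of j] N1[of j] by (intro mult_left_mono) auto
  have rpos: "0 < r j" for j
    unfolding r_def using ts[of j] N1[of j] T by (intro mult_pos_pos) linarith+
  have rlim: "(\<lambda>j. r j * (\<epsilon> j)\<^sup>2) \<longlonglongrightarrow> t0 - s"
  proof -
    have "r j * (\<epsilon> j)\<^sup>2 = (t j - s) * (\<delta> / \<rho> j)\<^sup>2" for j
    proof -
      have "N j * (\<epsilon> j)\<^sup>2 = (\<epsilon> j * sqrt (N j))\<^sup>2" using N1[of j] by (simp add: power_mult_distrib)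
      then show ?thesis unfolding r_def \<epsilon>N by (simp add: mult_ac)
    qed
    moreover have "(\<lambda>j. (t j - s) * (\<delta> / \<rho> j)\<^sup>2) \<longlonglongrightarrow> (t0 - s) * 1\<^sup>2"
      by (intro tendsto_intros t ratio)
    ultimately show ?thesis by simp
  qed
  define A where "A j \<zeta> = (\<integral>p. tent \<delta> (\<zeta> - \<epsilon> j *\<^sub>R emb (the (vsrw_at (r j) p))) \<partial>vsrw_law c 0)" for j \<zeta>
  define a where "a \<zeta> = (\<integral>w. tent \<delta> (\<zeta> - B (t0 - s) w) \<partial>W)" for \<zeta>
  have t0s: "0 < t0 - s" using t0T s T by linarith
  \<comment> \<open>Uniformity in \<zeta> is essential: all sites \<open>z\<close> near
    \<open>y j\<close> enter the overlap at once.\<close>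
  have aev: "eventually (\<lambda>j. \<forall>\<zeta>\<in>cball x0 (2 * l). \<bar>A j \<zeta> - a \<zeta>\<bar> < \<kappa> * M) sequentially"
  proof (rule Lipschitz_uniform_convergence[where L = "d / \<delta>"])
    show "\<bar>A j \<zeta> - A j \<xi>\<bar> \<le> d / \<delta> * dist \<zeta> \<xi>" for j \<zeta> \<xi>
      unfolding A_def d_def
      by (rule integral_tent_Lipschitz[OF prob_space_vsrw_law measurable_compose[OF measurable_vsrw_at] \<delta>(1)]) simp
    show "\<bar>a \<zeta> - a \<xi>\<bar> \<le> d / \<delta> * dist \<zeta> \<xi>" for \<zeta> \<xi>
      unfolding a_def d_def using BM t0s
      by (intro integral_tent_Lipschitz \<delta>(1)) (auto simp: brownian_motion_def)
    show "(\<lambda>j. A j \<zeta>) \<longlonglongrightarrow> a \<zeta>" for \<zeta>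
      unfolding A_def a_def
      by (rule smoothed_law_converges[OF \<epsilon> \<epsilon>lim less_imp_le[OF rpos] rlim \<delta>(1)])
  qed (use d \<delta> \<kappa> M in auto)
  have a: "\<bar>a \<zeta> - M * k0\<bar> \<le> \<kappa> * M" if "dist x0 \<zeta> \<le> 2 * l" for \<zeta>
    unfolding a_def M_def
  proof (rule brownian_tent_estimate[OF BM sigma t0s \<delta>(1)])
    fix \<xi> assume "dist \<zeta> \<xi> \<le> real CARD('d) * \<delta>"
    then have "dist x0 \<xi> \<le> 3 * l"
      using that dist_triangle[of x0 \<xi> \<zeta>] \<delta>(2) by (simp add: d_def)
    then show "\<bar>gauss_kernel \<sigma> (t0 - s) \<xi> - k0\<bar> \<le> \<kappa>"
      using s by (intro \<rho>0(2)) (auto simp: l_def)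
  qed
  have Aev: "eventually (\<lambda>j. \<forall>\<zeta>. dist x0 \<zeta> \<le> 2 * l \<longrightarrow> \<bar>A j \<zeta> - M * k0\<bar> \<le> 2 * \<kappa> * M) sequentially"
    using aev
  proof eventually_elim
    case (elim j)
    show ?case
    proof (intro allI impI)
      fix \<zeta> assume \<zeta>: "dist x0 \<zeta> \<le> 2 * l"
      then have "\<bar>A j \<zeta> - a \<zeta>\<bar> < \<kappa> * M" using elim by simp
      then show "\<bar>A j \<zeta> - M * k0\<bar> \<le> 2 * \<kappa> * M" using a[OF \<zeta>] by linarith
    qed
  qed
  \<comment> \<open>The ratio of the two normalisations, \<open>M * N j powr (d / 2)\<close> against
    \<open>m j ^ d\<close>.\<close>
  define b where "b j = (\<delta> / \<rho> j) ^ CARD('d)" for j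
  have b01: "0 \<le> b j" "b j \<le> 1" for j
    using \<epsilon>N1[of j] \<rho>\<delta>(1)[of j] \<delta>(1) by (auto simp: b_def power_le_one)
  have "b \<longlonglongrightarrow> 1 ^ CARD('d)"
    unfolding b_def by (intro tendsto_intros ratio)
  then have "(\<lambda>j. \<bar>b j - 1\<bar> * k0) \<longlonglongrightarrow> \<bar>1 - 1\<bar> * k0"
    by (intro tendsto_intros) simp
  then have bev: "eventually (\<lambda>j. \<bar>b j - 1\<bar> * k0 < \<kappa>) sequentially"
    using \<kappa> by (intro order_tendstoD(2)) auto
  have \<rho>ev: "eventually (\<lambda>j. \<rho> j < 2 * \<delta>) sequentially"
    using \<rho>lim \<delta> by (intro order_tendstoD(2)) auto
  define y where "y j = vfloor (sqrt (N j) *\<^sub>R x j)" for j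
  have ylim: "(\<lambda>j. \<epsilon> j *\<^sub>R emb (y j)) \<longlonglongrightarrow> x0"
  proof -
    have "(\<lambda>j. \<epsilon> j * d) \<longlonglongrightarrow> 0"
      using tendsto_mult[OF \<epsilon>lim tendsto_const, of d] by simp
    then have "(\<lambda>j. \<epsilon> j *\<^sub>R (emb (y j) - sqrt (N j) *\<^sub>R x j)) \<longlonglongrightarrow> 0"
    proof (rule Lim_null_comparison[rotated], intro always_eventually allI)
      fix j
      show "norm (\<epsilon> j *\<^sub>R (emb (y j) - sqrt (N j) *\<^sub>R x j)) \<le> \<epsilon> j * d"
        using norm_emb_vfloor_le[of "sqrt (N j) *\<^sub>R x j"] \<epsilon>[of j]
        by (simp add: y_def d_def mult_left_mono)
    qed
    moreover have "(\<lambda>j. (\<delta> / \<rho> j) *\<^sub>R x j) \<longlonglongrightarrow> 1 *\<^sub>R x0"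
      by (intro tendsto_intros ratio x)
    ultimately have "(\<lambda>j. (\<delta> / \<rho> j) *\<^sub>R x j + \<epsilon> j *\<^sub>R (emb (y j) - sqrt (N j) *\<^sub>R x j)) \<longlonglongrightarrow> 1 *\<^sub>R x0 + 0"
      by (intro tendsto_add)
    then show ?thesis by (simp add: \<epsilon>N[symmetric] scaleR_diff_right)
  qed
  have yev: "eventually (\<lambda>j. dist (\<epsilon> j *\<^sub>R emb (y j)) x0 < l) sequentially"
    by (rule tendstoD[OF ylim l])
  have Uev: "eventually (\<lambda>j. U (y j) \<le> l * sqrt (N j)) sequentially"
  proof -
    define R where "R = norm x0 + 1"
    have R: "0 < R" by (simp add: R_def add_nonneg_pos)
    \<comment> \<open>Since \<open>y j\<close> has norm at most \<open>R * sqrt (N j)\<close> for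
      large \<open>j\<close>, this slope uses up half of \<open>l * sqrt (N j)\<close>; the other
      half absorbs \<open>C\<close>.\<close>
    obtain C where C: "\<forall>z. U z \<le> l / (2 * R) * norm (emb z) + C"
      using growth[of "l / (2 * R)"] l R by auto
    have "(\<lambda>j. norm (\<epsilon> j *\<^sub>R emb (y j)) / (\<delta> / \<rho> j)) \<longlonglongrightarrow> norm x0 / 1"
      by (intro tendsto_intros ylim ratio) simp
    then have "eventually (\<lambda>j. norm (\<epsilon> j *\<^sub>R emb (y j)) / (\<delta> / \<rho> j) < R) sequentially"
      by (intro order_tendstoD(2)) (auto simp: R_def)
    moreover have "eventually (\<lambda>j. C * 2 / l \<le> sqrt (N j)) sequentially"
      using sNlim by (simp add: filterlim_at_top)
    ultimately show ?thesis
    proof eventually_elim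
      case (elim j)
      have sp: "0 < sqrt (N j)" using sN[of j] by linarith
      have "norm (\<epsilon> j *\<^sub>R emb (y j)) / (\<delta> / \<rho> j) = norm (emb (y j)) / sqrt (N j)"
        unfolding \<epsilon>N[symmetric] using \<epsilon>[of j] by simp
      then have "norm (emb (y j)) \<le> R * sqrt (N j)"
        using elim(1) sp by (simp add: pos_divide_less_eq)
      then have "l / (2 * R) * norm (emb (y j)) \<le> l / (2 * R) * (R * sqrt (N j))"
        using l R by (intro mult_left_mono) auto
      also have "\<dots> = l / 2 * sqrt (N j)" using R by simp
      finally have "l / (2 * R) * norm (emb (y j)) \<le> l / 2 * sqrt (N j)" .
      moreover have "C \<le> l / 2 * sqrt (N j)"
        using elim(2) l by (simp add: pos_divide_le_eq mult_ac)
      ultimately show ?case using C[THEN spec, of "y j"] by linarith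
    qed
  qed
  have tailev: "eventually (\<lambda>j. tail_const * exp (- (c4 * l / 2 * sqrt (N j))) < \<theta> / 2) sequentially"
  proof -
    have "(\<lambda>j. tail_const * exp (- (c4 * l / 2 * sqrt (N j)))) \<longlonglongrightarrow> tail_const * 0"
      using c4 l by (intro tendsto_mult tendsto_const tendsto_exp_neg_sqrt N) auto
    then show ?thesis using \<theta> by (intro order_tendstoD(2)) auto
  qed
  \<comment> \<open>Ensures \<open>1 \<le> N j * s\<close>, as the tail estimate demands.\<close>
  have Nev: "eventually (\<lambda>j. 1 / s \<le> N j) sequentially"
    using N by (simp add: filterlim_at_top)
  have "eventually (\<lambda>j. norm (N j powr (real CARD('d) / 2) * hk c (N j * t j) 0 (y j) - k0) < e) sequentially"
    using Aev bev \<rho>ev yev Uev tailev Nev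
  proof eventually_elim
    case (elim j)
    \<comment> \<open>The natural size of the kernel at times of order \<open>N j\<close>; all
      errors are multiples of it, and it is divided out at the end.\<close>
    define \<nu> where "\<nu> = N j powr (- d / 2)"
    have \<nu>: "0 < \<nu>" using N1[of j] by (simp add: \<nu>_def)
    have \<nu>1: "N j powr (d / 2) * \<nu> = 1"
      using N1[of j] by (simp add: \<nu>_def powr_add[symmetric])
    have sp: "0 < sqrt (N j)" using sN[of j] by linarith
    have Npos: "0 < N j" using N1[of j] by linarith
    have sNd: "sqrt (N j) ^ CARD('d) = N j powr (d / 2)"
      using Npos by (subst powr_realpow[symmetric]) (auto simp: powr_half_sqrt[symmetric] powr_powr d_def)
    define E where "E = sqrt (hk c (2 * r j) 0 0) * (real CARD('d) * real (m j) * sqrt (2 * hk c (N j * s) (y j) (y j) / (N j * s)))"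
    have E: "E \<le> \<nu> * \<kappa>"
    proof -
      have "hk c (2 * r j) 0 0 \<le> \<nu> * Q"
        unfolding \<nu>_def Q_def d_def using Npos T r[of j] rpos[of j] by (intro on_diagonal_scaled) auto
      then have 1: "sqrt (hk c (2 * r j) 0 0) \<le> sqrt \<nu> * sqrt Q"
        unfolding real_sqrt_mult[symmetric] by (rule real_sqrt_le_mono)
      have "hk c (N j * s) (y j) (y j) \<le> \<nu> * (c3 * s powr (- d / 2))"
        unfolding \<nu>_def d_def using Npos s by (intro on_diagonal_scaled) auto
      then have "2 * hk c (N j * s) (y j) (y j) / (N j * s) \<le> 2 * (\<nu> * (c3 * s powr (- d / 2))) / (N j * s)"
        using Npos s by (intro divide_right_mono) auto
      also have "\<dots> = \<nu> * S / N j" by (simp add: S_def mult_ac)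
      finally have 2: "sqrt (2 * hk c (N j * s) (y j) (y j) / (N j * s)) \<le> sqrt \<nu> * sqrt S / sqrt (N j)"
        unfolding real_sqrt_mult[symmetric] real_sqrt_divide[symmetric] by (rule real_sqrt_le_mono)
      have "E \<le> (sqrt \<nu> * sqrt Q) * (real CARD('d) * real (m j) * (sqrt \<nu> * sqrt S / sqrt (N j)))"
        unfolding E_def using \<nu> Q 2
        by (intro mult_mono 1 mult_left_mono mult_nonneg_nonneg) (auto simp: hk_nonneg Npos less_imp_le s(1))
      also have "\<dots> = (sqrt \<nu> * sqrt \<nu>) * (d * sqrt Q * sqrt S * \<rho> j)"
        by (simp add: \<rho>_def d_def)
      also have "\<dots> = \<nu> * (d * sqrt Q * sqrt S * \<rho> j)"
        using \<nu> by simp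
      also have "\<dots> \<le> \<nu> * (d * sqrt Q * sqrt S * (2 * \<delta>))"
        using \<nu> d Q S elim(3) by (intro mult_left_mono) auto
      also have "\<dots> \<le> \<nu> * \<kappa>"
        using \<nu> \<delta>(3) by (intro mult_left_mono) (auto simp: H_def mult_ac)
      finally show ?thesis .
    qed
    have near: "\<bar>(\<integral>p. tent (real (m j)) (emb z - emb (the (vsrw_at (r j) p))) \<partial>vsrw_law c 0) / real (m j) ^ CARD('d) - \<nu> * k0\<bar>
        \<le> \<nu> * (3 * \<kappa>)" if z: "ldist (y j) z < l * sqrt (N j)" for z
    proof -
      let ?\<zeta> = "\<epsilon> j *\<^sub>R emb z"
      have mp: "0 < real (m j)" using m(3)[of j] by simp
      have "tent (real (m j)) (emb z - emb (the (vsrw_at (r j) p))) = tent \<delta> (?\<zeta> - \<epsilon> j *\<^sub>R emb (the (vsrw_at (r j) p)))"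
        for p :: "nat \<Rightarrow> (int ^ 'd) \<times> real"
        using tent_scale[OF \<epsilon>[of j], of "real (m j)" "emb z - emb (the (vsrw_at (r j) p))"] mp
        by (simp add: \<epsilon>_def scaleR_diff_right)
      then have "(\<integral>p. tent (real (m j)) (emb z - emb (the (vsrw_at (r j) p))) \<partial>vsrw_law c 0) = A j ?\<zeta>"
        by (simp add: A_def)
      moreover have "A j ?\<zeta> / real (m j) ^ CARD('d) = \<nu> * (b j * (A j ?\<zeta> / M))"
      proof -
        have "\<delta> / \<rho> j = \<delta> * sqrt (N j) / real (m j)" by (simp add: \<rho>_def)
        then have "b j = M * N j powr (d / 2) / real (m j) ^ CARD('d)"
          unfolding b_def M_def by (simp add: power_mult_distrib power_divide sNd)
        then have "\<nu> * (b j * (A j ?\<zeta> / M)) = (N j powr (d / 2) * \<nu>) * (A j ?\<zeta> / real (m j) ^ CARD('d))"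
          using M by simp
        then show ?thesis unfolding \<nu>1 by simp
      qed
      moreover have "\<bar>b j * (A j ?\<zeta> / M) - k0\<bar> \<le> 3 * \<kappa>"
      proof -
        have "dist x0 ?\<zeta> \<le> dist x0 (\<epsilon> j *\<^sub>R emb (y j)) + dist (\<epsilon> j *\<^sub>R emb (y j)) ?\<zeta>"
          by (rule dist_triangle)
        also have "dist (\<epsilon> j *\<^sub>R emb (y j)) ?\<zeta> = \<epsilon> j * ldist (y j) z"
          using \<epsilon>[of j] by (simp add: dist_norm ldist_def scaleR_diff_right[symmetric])
        also have "\<epsilon> j * ldist (y j) z \<le> \<epsilon> j * (l * sqrt (N j))"
          using \<epsilon>[of j] z by (intro mult_left_mono) auto
        also have "\<dots> = l * (\<delta> / \<rho> j)" by (simp add: \<epsilon>N[symmetric])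
        also have "\<dots> \<le> l" using mult_left_mono[OF \<epsilon>N1[of j] less_imp_le[OF l]] by simp
        finally have "dist x0 ?\<zeta> \<le> 2 * l" using elim(4) by (simp add: dist_commute)
        then have "\<bar>A j ?\<zeta> - M * k0\<bar> \<le> 2 * \<kappa> * M" using elim(1) by blast
        then have "\<bar>A j ?\<zeta> - M * k0\<bar> / M \<le> 2 * \<kappa>" using M by (simp add: pos_divide_le_eq)
        moreover have "\<bar>A j ?\<zeta> - M * k0\<bar> / M = \<bar>A j ?\<zeta> / M - k0\<bar>"
        proof -
          have "(A j ?\<zeta> - M * k0) / M = A j ?\<zeta> / M - k0" using M by (simp add: diff_divide_distrib)
          then have "\<bar>(A j ?\<zeta> - M * k0) / M\<bar> = \<bar>A j ?\<zeta> / M - k0\<bar>" by (rule arg_cong)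
          then show ?thesis using M by (simp only: abs_divide abs_of_pos)
        qed
        ultimately have "b j * \<bar>A j ?\<zeta> / M - k0\<bar> \<le> 1 * (2 * \<kappa>)"
          using b01[of j] by (intro mult_mono) auto
        moreover have "\<bar>b j * (A j ?\<zeta> / M) - k0\<bar> \<le> b j * \<bar>A j ?\<zeta> / M - k0\<bar> + \<bar>b j - 1\<bar> * k0"
        proof -
          have "b j * (A j ?\<zeta> / M) - k0 = b j * (A j ?\<zeta> / M - k0) + (b j - 1) * k0"
            by (simp add: algebra_simps)
          then have "\<bar>b j * (A j ?\<zeta> / M) - k0\<bar> \<le> \<bar>b j * (A j ?\<zeta> / M - k0)\<bar> + \<bar>(b j - 1) * k0\<bar>"
            by (simp only: abs_triangle_ineq)
          then show ?thesis using b01[of j] k0 by (simp only: abs_mult abs_of_nonneg)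
        qed
        ultimately show ?thesis using elim(2) by linarith
      qed
      moreover have "\<bar>\<nu> * u - \<nu> * k0\<bar> = \<nu> * \<bar>u - k0\<bar>" for u
        using \<nu> by (simp add: right_diff_distrib[symmetric] abs_mult)
      ultimately show ?thesis
        using \<nu> by (simp only: mult_le_cancel_left_pos)
    qed
    have tail: "(\<integral>\<^sup>+z. heat c (N j * s) (y j) z * indicator {z. l * sqrt (N j) \<le> ldist (y j) z} z \<partial>count_space UNIV) \<le> ennreal \<theta>"
    proof -
      have "1 \<le> N j * s" using elim(7) s(1) by (simp add: pos_divide_le_eq)
      then have "(\<integral>\<^sup>+z. heat c (N j * s) (y j) z * indicator {z. l * sqrt (N j) \<le> ldist (y j) z} z \<partial>count_space UNIV) \<le>
        ennreal (tail_const * (exp (- (c4 * (l * sqrt (N j)) / sqrt (N j * s))) + exp (- (c4 * (l * sqrt (N j)) / 2))))"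
        using l sp elim(5) by (intro heat_tail) auto
      also have "\<dots> \<le> ennreal \<theta>"
      proof (rule ennreal_leI)
        have q1: "c4 * (l * sqrt (N j)) / sqrt (N j * s) = c4 * l / sqrt s"
          using sp by (simp add: real_sqrt_mult)
        have q2: "c4 * (l * sqrt (N j)) / 2 = c4 * l / 2 * sqrt (N j)" by simp
        show "tail_const * (exp (- (c4 * (l * sqrt (N j)) / sqrt (N j * s))) + exp (- (c4 * (l * sqrt (N j)) / 2))) \<le> \<theta>"
          unfolding distrib_left q1 q2 using s(4) elim(6) by linarith
      qed
      finally show ?thesis .
    qed
    have sup: "hk c (r j) 0 z \<le> \<nu> * Q" for z
      unfolding \<nu>_def Q_def d_def using Npos T r[of j] by (intro on_diagonal_scaled) auto
    have "\<bar>hk c (r j + N j * s) 0 (y j) - \<nu> * k0\<bar> \<le> E + \<nu> * (3 * \<kappa>) + (\<nu> * Q + \<nu> * k0) * \<theta>"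
      unfolding E_def using rpos[of j] Npos s(1) m(3) \<nu> k0 \<kappa> Q \<theta>
      by (intro overlap_estimate[where \<rho> = "l * sqrt (N j)"] near tail sup) auto
    also have "r j + N j * s = N j * t j" by (simp add: r_def algebra_simps)
    also have "E + \<nu> * (3 * \<kappa>) + (\<nu> * Q + \<nu> * k0) * \<theta> \<le> \<nu> * \<kappa> + \<nu> * (3 * \<kappa>) + \<nu> * \<kappa>"
    proof -
      have "(\<nu> * Q + \<nu> * k0) * \<theta> = \<nu> * ((Q + k0) * \<theta>)" by (simp add: distrib_left distrib_right)
      then show ?thesis using E mult_left_mono[OF Q\<theta> less_imp_le[OF \<nu>]] by linarith
    qed
    also have "\<dots> = \<nu> * (5 * \<kappa>)" by simp
    finally have "N j powr (d / 2) * \<bar>hk c (N j * t j) 0 (y j) - \<nu> * k0\<bar> \<le> N j powr (d / 2) * (\<nu> * (5 * \<kappa>))"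
      by (intro mult_left_mono) auto
    also have "\<dots> = 5 * \<kappa>" using \<nu>1 by (simp add: mult.assoc[symmetric])
    also have "N j powr (d / 2) * \<bar>hk c (N j * t j) 0 (y j) - \<nu> * k0\<bar> = \<bar>N j powr (d / 2) * hk c (N j * t j) 0 (y j) - k0\<bar>"
    proof -
      have "N j powr (d / 2) * hk c (N j * t j) 0 (y j) - k0 = N j powr (d / 2) * (hk c (N j * t j) 0 (y j) - \<nu> * k0)"
        using \<nu>1 by (simp add: right_diff_distrib mult.assoc[symmetric])
      then show ?thesis by (simp add: abs_mult)
    qed
    finally show ?case using e unfolding d_def \<kappa>_def by simp
  qed
  then show "\<exists>no. \<forall>n\<ge>no. norm (N n powr (real CARD('d) / 2) * hk c (N n * t n) 0 (vfloor (sqrt (N n) *\<^sub>R x n)) -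
      gauss_kernel \<sigma> t0 x0) < e"
    unfolding eventually_sequentially y_def k0_def .
qed

end

section \<open>From convergence along sequences to uniform convergence\<close>

lemma tendsto_exp_neg_square_at_top:
  fixes a :: real
  assumes "0 < a"
  shows "((\<lambda>R. exp (- (a * R\<^sup>2))) \<longlongrightarrow> 0) at_top"
  using assms
  by (intro filterlim_compose[OF exp_at_bot] filterlim_compose[OF filterlim_uminus_at_bot_at_top]
      filterlim_tendsto_pos_mult_at_top[OF tendsto_const] filterlim_pow_at_top filterlim_ident) auto

lemma tendsto_0_ennrealI:
  fixes f :: "nat \<Rightarrow> ennreal"
  assumes "\<And>e. 0 < e \<Longrightarrow> eventually (\<lambda>n. f n \<le> ennreal e) sequentially"
  shows "f \<longlonglongrightarrow> 0"
proof (rule order_tendstoI)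
  fix a :: ennreal assume "0 < a"
  obtain e where e: "0 < e" "ennreal e < a"
  proof (cases a)
    case (real r)
    then show ?thesis using \<open>0 < a\<close> that[of "r / 2"] by (auto simp: ennreal_less_iff)
  next
    case top
    then show ?thesis using that[of 1] by simp
  qed
  from assms[OF e(1)] show "eventually (\<lambda>n. f n < a) sequentially"
    by (rule eventually_mono) (rule le_less_trans[OF _ e(2)])
qed simp

context quenched_walk
begin

definition kernel_error :: "nat \<Rightarrow> real \<Rightarrow> real ^ 'd \<Rightarrow> real" where
  "kernel_error n t x = \<bar>real n powr (real CARD('d) / 2) * hk c (real n * t) 0 (vfloor (sqrt (real n) *\<^sub>R x))
     - gauss_kernel \<sigma> t x\<bar>"

lemma kernel_error_le:
  "kernel_error n t x \<le> real n powr (real CARD('d) / 2) * hk c (real n * t) 0 (vfloor (sqrt (real n) *\<^sub>R x))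
     + gauss_kernel \<sigma> t x"
proof -
  have "0 \<le> real n powr (real CARD('d) / 2) * hk c (real n * t) 0 (vfloor (sqrt (real n) *\<^sub>R x))"
    by (simp add: hk_nonneg)
  then show ?thesis
    unfolding kernel_error_def using gauss_kernel_nonneg[of \<sigma> t x] by linarith
qed

text \<open>Both kernels are separately of order \<open>t powr (- d / 2)\<close>, uniformly in
  \<open>n\<close> and \<open>x\<close>.\<close>

lemma kernel_error_large_time:
  assumes e: "0 < e"
  obtains T where "0 < T" "\<And>n t x. 0 < n \<Longrightarrow> T \<le> t \<Longrightarrow> kernel_error n t x < e"
proof -
  let ?d = "real CARD('d)"
  let ?h = "\<lambda>t. c3 * t powr (- ?d / 2) + (2 * pi * t * \<sigma>\<^sup>2) powr (- ?d / 2)"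
  have "filterlim (\<lambda>t. 2 * pi * t * \<sigma>\<^sup>2) at_top at_top"
  proof -
    have "filterlim (\<lambda>t. (2 * pi * \<sigma>\<^sup>2) * t) at_top at_top"
      using sigma by (intro filterlim_tendsto_pos_mult_at_top[OF tendsto_const] filterlim_ident) auto
    then show ?thesis by (simp add: mult_ac)
  qed
  then have "(?h \<longlongrightarrow> c3 * 0 + 0) at_top"
    by (intro tendsto_intros tendsto_neg_powr filterlim_ident) auto
  then have "eventually (\<lambda>t. ?h t < e) at_top"
    using e by (intro order_tendstoD(2)) auto
  then obtain T where T: "\<And>t. T \<le> t \<Longrightarrow> ?h t < e"
    unfolding eventually_at_top_linorder by blast
  show ?thesis
  proof (rule that[of "max T 1"])
    fix n :: nat and t :: real and x :: "real ^ 'd" assume n: "0 < n" and "max T 1 \<le> t"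
    then have t: "T \<le> t" "0 < t" by auto
    have "real n powr (?d / 2) * hk c (real n * t) 0 (vfloor (sqrt (real n) *\<^sub>R x)) \<le>
        real n powr (?d / 2) * (real n powr (- ?d / 2) * (c3 * t powr (- ?d / 2)))"
      using n t by (intro mult_left_mono on_diagonal_scaled) auto
    also have "\<dots> = c3 * t powr (- ?d / 2)"
      using n by (simp add: mult.assoc[symmetric] powr_add[symmetric])
    finally have 1: "real n powr (?d / 2) * hk c (real n * t) 0 (vfloor (sqrt (real n) *\<^sub>R x)) \<le> c3 * t powr (- ?d / 2)" .
    have "exp (- (norm x)\<^sup>2 / (2 * \<sigma>\<^sup>2 * t)) \<le> 1" using t by simp
    then have "gauss_kernel \<sigma> t x \<le> (2 * pi * t * \<sigma>\<^sup>2) powr (- ?d / 2) * 1"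
      unfolding gauss_kernel_def by (intro mult_left_mono) auto
    then show "kernel_error n t x < e"
      using kernel_error_le[of n t x] 1 T[OF t(1)] by linarith
  qed simp
qed

text \<open>Both terms are small separately, and the point is uniformity in \<open>n\<close>. In the
  Gaussian bound \<open>n\<close> cancels from squared distance over time. In the purely exponential
  one the prefactor \<open>n powr (d / 2)\<close> is beaten because the distance is at least
  \<open>sqrt n * R / 2\<close> and \<open>exp (- u) \<le> d! / u^d\<close>.\<close>

lemma kernel_error_large_space:
  assumes e: "0 < e" and T: "0 < T"
  obtains R where "\<And>n t x. 0 < n \<Longrightarrow> T \<le> t \<Longrightarrow> t \<le> T' \<Longrightarrow> R \<le> norm x \<Longrightarrow> kernel_error n t x < e"
proof (cases "T \<le> T'")
  case False
  then show ?thesis using that by fastforce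
next
  case True
  then have T': "0 < T'" using T by simp
  define d where "d = CARD('d)"
  have d: "0 < d" by (simp add: d_def)
  define a where "a = c4 / (4 * T')"
  define a' where "a' = 1 / (2 * \<sigma>\<^sup>2 * T')"
  have a: "0 < a" "0 < a'" using c4 T' sigma by (auto simp: a_def a'_def)
  define D where "D = c3 * T powr (- real d / 2)"
  define D' where "D' = (2 * pi * T * \<sigma>\<^sup>2) powr (- real d / 2)"
  let ?h = "\<lambda>R. D * exp (- (a * R\<^sup>2)) + c3 * (fact d * (2 / c4 / R) ^ d) + D' * exp (- (a' * R\<^sup>2))"
  have "(?h \<longlongrightarrow> D * 0 + c3 * (fact d * 0 ^ d) + D' * 0) at_top"
    by (intro tendsto_intros tendsto_exp_neg_square_at_top a tendsto_divide_0[OF tendsto_const]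
        filterlim_at_top_imp_at_infinity filterlim_ident)
  moreover have "D * 0 + c3 * (fact d * 0 ^ d) + D' * 0 = 0" using d by simp
  ultimately have "(?h \<longlongrightarrow> 0) at_top" by (simp only:)
  then have "eventually (\<lambda>R. ?h R < e) at_top"
    using e by (rule order_tendstoD(2))
  \<comment> \<open>\<open>R \<ge> 2 * d\<close> absorbs the rounding to the lattice;
    \<open>R \<ge> 2 * U 0\<close> brings the target into the range of the off-diagonal
    bounds.\<close>
  moreover have "eventually (\<lambda>R. max 1 (max (2 * real d) (2 * U 0)) \<le> R) at_top"
    by (rule eventually_ge_at_top)
  ultimately have "eventually (\<lambda>R. ?h R < e \<and> max 1 (max (2 * real d) (2 * U 0)) \<le> R) at_top"
    by (rule eventually_conj)
  then obtain R where R: "?h R < e" "1 \<le> R" "2 * real d \<le> R" "2 * U 0 \<le> R"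
    unfolding eventually_at_top_linorder by auto
  show ?thesis
  proof (rule that[of R])
    fix n :: nat and t :: real and x :: "real ^ 'd"
    assume n: "0 < n" and t: "T \<le> t" "t \<le> T'" and x: "R \<le> norm x"
    have t0: "0 < t" using t T by simp
    define y where "y = vfloor (sqrt (real n) *\<^sub>R x)"
    have sn: "1 \<le> sqrt (real n)" using n by simp
    have r: "sqrt (real n) * (R / 2) \<le> ldist 0 y"
    proof -
      have "sqrt (real n) * norm x - norm (emb y) \<le> norm (sqrt (real n) *\<^sub>R x - emb y)"
        using norm_triangle_ineq2[of "sqrt (real n) *\<^sub>R x" "emb y"] by simp
      also have "\<dots> \<le> real d"
        using norm_emb_vfloor_le[of "sqrt (real n) *\<^sub>R x"] by (simp add: y_def d_def norm_minus_commute)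
      also have "\<dots> \<le> sqrt (real n) * (R / 2)"
        using R(2,3) mult_mono[OF sn, of "real d" "R / 2"] by simp
      finally have "sqrt (real n) * norm x - sqrt (real n) * (R / 2) \<le> norm (emb y)" by simp
      moreover have "sqrt (real n) * R \<le> sqrt (real n) * norm x" using x by (intro mult_left_mono) auto
      ultimately have "sqrt (real n) * (R / 2) \<le> norm (emb y)" by simp
      moreover have "emb (0 :: int ^ 'd) = 0" by (simp add: emb_def vec_eq_iff)
      ultimately show ?thesis by (simp add: ldist_def)
    qed
    have U: "U 0 \<le> ldist 0 y"
    proof -
      have "1 * (R / 2) \<le> sqrt (real n) * (R / 2)" using sn R(2) by (intro mult_right_mono) auto
      then show ?thesis using r R(4) by linarith
    qed
    let ?\<nu> = "real n powr (real d / 2)"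
    have \<nu>: "?\<nu> * (real n * t) powr (- real d / 2) = t powr (- real d / 2)"
      using n t0 by (simp add: powr_mult mult.assoc[symmetric] powr_add[symmetric])
    have "?\<nu> * hk c (real n * t) 0 y \<le> ?\<nu> * (c3 * (real n * t) powr (- real d / 2) * exp (- c4 * (ldist 0 y)\<^sup>2 / (real n * t))
        + c3 * exp (- c4 * ldist 0 y))"
      unfolding d_def using n t0 U by (intro mult_left_mono hk_far) auto
    also have "\<dots> = c3 * (?\<nu> * (real n * t) powr (- real d / 2)) * exp (- c4 * (ldist 0 y)\<^sup>2 / (real n * t)) + c3 * (?\<nu> * exp (- c4 * ldist 0 y))"
      by (simp only: distrib_left mult_ac)
    also have "\<dots> \<le> D * exp (- (a * R\<^sup>2)) + c3 * (fact d * (2 / c4 / R) ^ d)"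
    proof (rule add_mono)
      have 1: "c3 * (?\<nu> * (real n * t) powr (- real d / 2)) \<le> D"
        unfolding \<nu> D_def using c3 T t by (intro mult_left_mono powr_mono2') auto
      have "real n * (R\<^sup>2 / 4) \<le> (ldist 0 y)\<^sup>2"
        using power_mono[OF r, of 2] R(2) by (simp add: power_mult_distrib power_divide)
      then have "c4 * (real n * (R\<^sup>2 / 4)) / (real n * T') \<le> c4 * (ldist 0 y)\<^sup>2 / (real n * t)"
        using c4 n t t0 by (intro frac_le mult_left_mono) auto
      moreover have "c4 * (real n * (R\<^sup>2 / 4)) / (real n * T') = a * R\<^sup>2"
        using n by (simp add: a_def)
      ultimately have "exp (- c4 * (ldist 0 y)\<^sup>2 / (real n * t)) \<le> exp (- (a * R\<^sup>2))" by simp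
      with 1 show "c3 * (?\<nu> * (real n * t) powr (- real d / 2)) * exp (- c4 * (ldist 0 y)\<^sup>2 / (real n * t))
          \<le> D * exp (- (a * R\<^sup>2))"
        using c3 by (intro mult_mono) (auto simp: D_def)
      have p: "0 < c4 * (sqrt (real n) * (R / 2))" using c4 sn R(2) by (intro mult_pos_pos) auto
      have "exp (- c4 * ldist 0 y) \<le> exp (- (c4 * (sqrt (real n) * (R / 2))))"
        using c4 r by simp
      also have "\<dots> \<le> fact d / (c4 * (sqrt (real n) * (R / 2))) ^ d"
        by (rule exp_neg_le_inverse_power[OF p])
      finally have "?\<nu> * exp (- c4 * ldist 0 y) \<le> ?\<nu> * (fact d / (c4 * (sqrt (real n) * (R / 2))) ^ d)"
        by (intro mult_left_mono) auto
      also have "(c4 * (sqrt (real n) * (R / 2))) ^ d = ?\<nu> * (c4 * R / 2) ^ d"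
      proof -
        have "sqrt (real n) ^ d = ?\<nu>"
          using n by (subst powr_realpow[symmetric]) (auto simp: powr_half_sqrt[symmetric] powr_powr)
        moreover have "c4 * (sqrt (real n) * (R / 2)) = sqrt (real n) * (c4 * R / 2)" by simp
        ultimately show ?thesis by (simp only: power_mult_distrib)
      qed
      also have "?\<nu> * (fact d / (?\<nu> * (c4 * R / 2) ^ d)) = fact d * (2 / c4 / R) ^ d"
        using n c4 R(2) by (simp add: power_divide power_mult_distrib)
      finally have "?\<nu> * exp (- c4 * ldist 0 y) \<le> fact d * (2 / c4 / R) ^ d" .
      then show "c3 * (?\<nu> * exp (- c4 * ldist 0 y)) \<le> c3 * (fact d * (2 / c4 / R) ^ d)"
        using c3 by (intro mult_left_mono) auto
    qed
    finally have 1: "?\<nu> * hk c (real n * t) 0 y \<le> D * exp (- (a * R\<^sup>2)) + c3 * (fact d * (2 / c4 / R) ^ d)" .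
    have 2: "gauss_kernel \<sigma> t x \<le> D' * exp (- (a' * R\<^sup>2))"
    proof -
      have "(2 * pi * t * \<sigma>\<^sup>2) powr (- real d / 2) \<le> D'"
        unfolding D'_def using T t sigma by (intro powr_mono2' mult_right_mono mult_left_mono) auto
      moreover have "exp (- (norm x)\<^sup>2 / (2 * \<sigma>\<^sup>2 * t)) \<le> exp (- (a' * R\<^sup>2))"
      proof -
        have "R\<^sup>2 \<le> (norm x)\<^sup>2" using x R(2) by (intro power_mono) auto
        then have "R\<^sup>2 / (2 * \<sigma>\<^sup>2 * T') \<le> (norm x)\<^sup>2 / (2 * \<sigma>\<^sup>2 * t)"
          using t t0 sigma by (intro frac_le mult_left_mono) auto
        then show ?thesis by (simp add: a'_def)
      qed
      ultimately show ?thesis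
        unfolding gauss_kernel_def d_def[symmetric] by (intro mult_mono) (auto simp: D'_def)
    qed
    show "kernel_error n t x < e"
      using kernel_error_le[of n t x] 1 2 R(1) unfolding y_def d_def by linarith
  qed
qed

lemma uniform_convergence:
  assumes T: "0 < T" and e: "0 < e"
  shows "eventually (\<lambda>n. \<forall>x. \<forall>t\<ge>T. kernel_error n t x \<le> e) sequentially"
proof (rule ccontr)
  assume "\<not> ?thesis"
  \<comment> \<open>Asking for \<open>Suc j\<close> makes the bad indices tend to infinity and also
    keeps them positive.\<close>
  then have "\<forall>j. \<exists>n\<ge>Suc j. \<exists>x. \<exists>t\<ge>T. e < kernel_error n t x"
    unfolding eventually_sequentially by (metis not_le)
  then obtain n x t where n: "\<And>j. Suc j \<le> n j" and tT: "\<And>j. T \<le> t j"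
    and bad: "\<And>j. e < kernel_error (n j) (t j) (x j)"
    by metis
  obtain T' where T': "0 < T'" "\<And>n t x. 0 < n \<Longrightarrow> T' \<le> t \<Longrightarrow> kernel_error n t x < e"
    using kernel_error_large_time[OF e] by blast
  have n0: "0 < n j" for j using n[of j] by simp
  have tT': "t j \<le> T'" for j
    using T'(2)[OF n0[of j], of "t j" "x j"] bad[of j] by linarith
  obtain R where R: "\<And>n t x. 0 < n \<Longrightarrow> T \<le> t \<Longrightarrow> t \<le> T' \<Longrightarrow> R \<le> norm x \<Longrightarrow> kernel_error n t x < e"
    using kernel_error_large_space[OF e T] by blast
  have xR: "norm (x j) \<le> R" for j
    using R[OF n0[of j] tT[of j] tT'[of j], of "x j"] bad[of j] by linarith
  have "seq_compact ({T..T'} \<times> cball (0 :: real ^ 'd) R)"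
    by (intro compact_imp_seq_compact compact_Times) auto
  moreover have "\<forall>j. (t j, x j) \<in> {T..T'} \<times> cball 0 R"
    using tT tT' xR by simp
  ultimately obtain p k where p: "p \<in> {T..T'} \<times> cball 0 R" and k: "strict_mono k"
    and lim: "((\<lambda>j. (t j, x j)) \<circ> k) \<longlonglongrightarrow> p"
    by (rule seq_compactE)
  have tk: "(\<lambda>j. t (k j)) \<longlonglongrightarrow> fst p" and xk: "(\<lambda>j. x (k j)) \<longlonglongrightarrow> snd p"
    using tendsto_fst[OF lim] tendsto_snd[OF lim] by (simp_all add: comp_def)
  have p0: "0 < fst p" using p T by auto
  have kn: "real j \<le> real (n (k j))" for j
    using n[of "k j"] seq_suble[OF k, of j] by simp
  have "(\<lambda>j. real (n (k j)) powr (real CARD('d) / 2) *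
      hk c (real (n (k j)) * t (k j)) 0 (vfloor (sqrt (real (n (k j))) *\<^sub>R x (k j)))) \<longlonglongrightarrow> gauss_kernel \<sigma> (fst p) (snd p)"
  proof (rule local_convergence[OF _ _ T tT tk xk])
    show "1 \<le> real (n (k j))" for j using n0[of "k j"] by simp
    show "filterlim (\<lambda>j. real (n (k j))) at_top sequentially"
      by (rule filterlim_at_top_mono[OF filterlim_real_sequentially always_eventually]) (rule allI, rule kn)
  qed
  moreover have "(\<lambda>j. gauss_kernel \<sigma> (t (k j)) (x (k j))) \<longlonglongrightarrow> gauss_kernel \<sigma> (fst p) (snd p)"
    unfolding gauss_kernel_def using sigma p0
    by (intro tendsto_intros tk xk) auto
  ultimately have "(\<lambda>j. kernel_error (n (k j)) (t (k j)) (x (k j))) \<longlonglongrightarrow>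
      \<bar>gauss_kernel \<sigma> (fst p) (snd p) - gauss_kernel \<sigma> (fst p) (snd p)\<bar>"
    unfolding kernel_error_def by (intro tendsto_intros)
  then have "eventually (\<lambda>j. kernel_error (n (k j)) (t (k j)) (x (k j)) < e) sequentially"
    using e by (intro order_tendstoD(2)) auto
  then show False
    using bad less_asym unfolding eventually_sequentially by blast
qed

lemma local_limit_theorem:
  assumes T: "0 < T"
  shows "(\<lambda>n. SUP x::real ^ 'd. SUP t\<in>{T..}. ennreal (kernel_error n t x)) \<longlonglongrightarrow> 0"
proof (rule tendsto_0_ennrealI)
  fix e :: real assume "0 < e"
  from uniform_convergence[OF T this]
  show "eventually (\<lambda>n. (SUP x::real ^ 'd. SUP t\<in>{T..}. ennreal (kernel_error n t x)) \<le> ennreal e) sequentially"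
    by eventually_elim (auto intro!: SUP_least ennreal_leI)
qed

end

theorem theorem5p14:
  fixes M :: "'w measure"
    and \<mu> :: "(int ^ 'd::finite) set \<Rightarrow> 'w \<Rightarrow> real"
    and \<sigma> T :: real
    and W :: "'b measure"
    and B :: "real \<Rightarrow> 'b \<Rightarrow> real ^ 'd"
  assumes dim: "2 \<le> CARD('d)"
    and prob: "prob_space M"
    and rv: "\<And>e. e \<in> edges \<Longrightarrow> \<mu> e \<in> borel_measurable M"
    and stationary: "stationary_env M \<mu>"
    and ergodic: "ergodic_env M \<mu>"
    and symmetric: "symmetric_env M \<mu>"
    and ge_1: "AE \<omega> in M. \<forall>e\<in>edges. 1 \<le> \<mu> e \<omega>"
    and hk_bounds: "heat_kernel_bounds M \<mu>"
    and sigma_pos: "0 < \<sigma>"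
    and BM: "brownian_motion \<sigma> W B"
    and sigma_V: "AE \<omega> in M. converges_in_law (vsrw_law (\<lambda>e. \<mu> e \<omega>) 0) scaled_vsrw W B"
    and T_pos: "0 < T"
  shows "AE \<omega> in M.
    (\<lambda>n. SUP x::real ^ 'd. SUP t\<in>{T..}.
       ennreal \<bar>real n powr (real CARD('d) / 2)
                 * hk (\<lambda>e. \<mu> e \<omega>) (real n * t) 0 (vfloor (sqrt (real n) *\<^sub>R x))
               - gauss_kernel \<sigma> t x\<bar>)
    \<longlonglongrightarrow> 0"
proof -
  \<comment> \<open>With \<eta> = 1/2 the tails are of the square-root form that
    \<open>AE_sublinear_growth\<close> handles.\<close>
  have "0 < (1 / 2 :: real) \<and> (1 / 2 :: real) < 1" by simp
  from hk_bounds[unfolded heat_kernel_bounds_def, rule_format, OF this]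
  obtain U :: "int ^ 'd \<Rightarrow> 'w \<Rightarrow> real" and c :: "nat \<Rightarrow> real" where
    c: "\<forall>i. 0 < c i" and U: "\<forall>x. U x \<in> borel_measurable M \<and> (\<forall>\<omega>\<in>space M. 0 \<le> U x \<omega>)"
    and tail: "\<forall>x (n::nat). measure M {\<omega> \<in> space M. real n \<le> U x \<omega>} \<le> c 1 * exp (- c 2 * real n powr (1 / 2))"
    and bounds: "AE \<omega> in M. \<forall>x y. \<forall>t>0.
           let q = hk (\<lambda>e. \<mu> e \<omega>) t x y; r = ldist x y; D = t powr (- real CARD('d) / 2) in
             q \<le> c 3 * D \<and>
             (U x \<omega> \<le> max r (sqrt t) \<longrightarrow>
                (r \<le> t \<longrightarrow> q \<le> c 3 * D * exp (- c 4 * r\<^sup>2 / t)) \<and>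
                (t \<le> r \<longrightarrow> q \<le> c 3 * exp (- c 4 * r * max 1 (ln (r / t))))) \<and>
             (max ((U x \<omega>)\<^sup>2) (r powr (1 + 1 / 2)) \<le> t \<longrightarrow>
                c 5 * D * exp (- c 6 * r\<^sup>2 / t) \<le> q)"
    by blast
  have growth: "AE \<omega> in M. \<forall>\<kappa>>0. \<exists>C. \<forall>x. U x \<omega> \<le> \<kappa> * norm (emb x) + C"
    by (rule AE_sublinear_growth[OF prob, of U "c 2" "c 1"]) (use U c tail in auto)
  show ?thesis
    using ge_1 sigma_V bounds growth
  proof eventually_elim
    case (elim \<omega>)
    let ?c = "\<lambda>e. \<mu> e \<omega>"
    interpret positive_conductances ?c
      by standard (use elim(1) in force)
    have bounds: "hk ?c t x y \<le> c 3 * t powr (- real CARD('d) / 2)"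
      "U x \<omega> \<le> max (ldist x y) (sqrt t) \<Longrightarrow> ldist x y \<le> t \<Longrightarrow>
        hk ?c t x y \<le> c 3 * t powr (- real CARD('d) / 2) * exp (- c 4 * (ldist x y)\<^sup>2 / t)"
      "U x \<omega> \<le> max (ldist x y) (sqrt t) \<Longrightarrow> t \<le> ldist x y \<Longrightarrow>
        hk ?c t x y \<le> c 3 * exp (- c 4 * ldist x y * max 1 (ln (ldist x y / t)))"
      "max ((U x \<omega>)\<^sup>2) (ldist x y powr (1 + 1 / 2)) \<le> t \<Longrightarrow>
        c 5 * t powr (- real CARD('d) / 2) * exp (- c 6 * (ldist x y)\<^sup>2 / t) \<le> hk ?c t x y"
      if "0 < t" for t x y
      using elim(3)[rule_format, OF that, of x y] unfolding Let_def by blast+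
    \<comment> \<open>Cadlag paths are part of convergence in law, and at scale 1 the process is the
      walk itself.\<close>
    have "AE p in vsrw_law ?c 0. (\<lambda>t. scaled_vsrw 1 t p) \<in> cadlag"
      using elim(2) unfolding converges_in_law_def by (meson zero_less_one)
    note mass0 = nn_integral_heat_eq_1[OF this]
    have mass: "(\<integral>\<^sup>+y. heat ?c t z y \<partial>count_space UNIV) = 1" if "0 \<le> t" for t z
    proof -
      \<comment> \<open>A time late enough for the lower heat kernel bound between 0 and
        \<open>z\<close>; the \<open>+ 1\<close> makes it positive. The resulting
        \<open>heat ?c s 0 z \<noteq> 0\<close> is what transfers mass one from 0 to
        \<open>z\<close>.\<close>
      define s where "s = max ((U 0 \<omega>)\<^sup>2) (ldist 0 z powr (1 + 1 / 2)) + 1"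
      have s: "0 < s" "max ((U 0 \<omega>)\<^sup>2) (ldist 0 z powr (1 + 1 / 2)) \<le> s"
      proof -
        have "0 \<le> (U 0 \<omega>)\<^sup>2" by simp
        then show "0 < s" unfolding s_def by linarith
      qed (simp add: s_def)
      have "0 < c 5 * s powr (- real CARD('d) / 2) * exp (- c 6 * (ldist 0 z)\<^sup>2 / s)"
        using c s by simp
      then have "0 < hk ?c s 0 z" using bounds(4)[OF s] by linarith
      then have nz: "heat ?c s 0 z \<noteq> 0" using s by (auto simp: ennreal_hk[symmetric] ennreal_eq_0_iff)
      show ?thesis
      proof (rule nn_integral_heat_eq_1_transfer[where x = 0 and s = s])
        show "(\<integral>\<^sup>+y. heat ?c t 0 y \<partial>count_space UNIV) = 1" if "0 \<le> t" for t
          by (rule mass0[OF that])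
      qed (use nz s that in simp_all)
    qed
    interpret quenched_walk ?c "c 3" "c 4" \<sigma> "\<lambda>x. U x \<omega>" W B
    proof
      fix t :: real and x y :: "int ^ 'd"
      assume t: "0 < t" and le: "U x \<omega> \<le> max (ldist x y) (sqrt t)" "t \<le> ldist x y"
      have "c 4 * ldist x y * 1 \<le> c 4 * ldist x y * max 1 (ln (ldist x y / t))"
        using c t le(2) by (intro mult_left_mono mult_nonneg_nonneg) (auto simp: less_imp_le)
      then have "exp (- c 4 * ldist x y * max 1 (ln (ldist x y / t))) \<le> exp (- c 4 * ldist x y)"
        by simp
      then show "hk ?c t x y \<le> c 3 * exp (- c 4 * ldist x y)"
        using bounds(3)[OF t le] mult_left_mono[of _ _ "c 3"] c by (meson less_imp_le order_trans)
    qed (use elim c mass bounds sigma_pos BM in auto)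
    show ?case
      using local_limit_theorem[OF T_pos] unfolding kernel_error_def .
  qed
qed

end
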